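(* Let $p,q\in\mathbb{N}$, let $\alpha_1\in(0,1)$ with $|\alpha_1-1/2|>1/\sqrt{12}$, $\alpha_2=1-\alpha_1$, let $\mathbf{A}\in\mathbb{R}^{p\times p}$ and $\mathbf{B}\in\mathbb{R}^{q\times q}$ be symmetric positive definite, let $\mathbf{T}_1\neq\mathbf{T}_2$ be matrices in $\mathbb{R}^{p\times q}$, and let $\mathbf{X}_1,\mathbf{X}_2,\ldots$ be i.i.d. random $p\times q$ matrices with distribution $$\alpha_1\mathcal{N}_{p\times q}(\mathbf{T}_1,\mathbf{A},\mathbf{B})+\alpha_2\mathcal{N}_{p\times q}(\mathbf{T}_2,\mathbf{A},\mathbf{B}).$$ Let $d$ be the rank of $\mathbf{A}^{-1/2}(\mathbf{T}_2-\mathbf{T}_1)\mathbf{B}^{-1/2}$ and assume that the $d$ non-zero singular values of this matrix are distinct. Let $(\mathbf{u}_{01},\mathbf{v}_{01}),\ldots,(\mathbf{u}_{0d},\mathbf{v}_{0d})$ be any collection of first $d$ (unit length) singular pairs of $\mathbf{A}^{-1/2}(\mathbf{T}_2-\mathbf{T}_1)\mathbf{B}^{-1/2}$, ordered by decreasing singular value. For each $n>pq$, let $(\mathbf{u}_{n1},\mathbf{v}_{n1}),\ldots,(\mathbf{u}_{nd},\mathbf{v}_{nd})\in\mathbb{S}^{p-1}\times\mathbb{S}^{q-1}$ be any sequence of $(\mathcal{G}_{n1,\mathbf{X}},\mathcal{G}_{n2,\mathbf{X}})$-maximizers of $\kappa_{n\mathbf{X}}$, or any sequence of $(\mathcal{G}_{n1,\mathbf{X}},\mathcal{G}_{n2,\mathbf{X}})$-maximizers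 of $(\psi_{n\mathbf{X}},\psi_{n\mathbf{X}'})$ (the same choice of index for all $n$). Then there exist sequences (in $n$) of signs $s_{nu1},\ldots,s_{nud}\in\{-1,1\}$ and $s_{nv1},\ldots,s_{nvd}\in\{-1,1\}$ such that, as $n\to\infty$, $$s_{nuj}\mathbf{u}_{nj}\to\frac{\mathbf{A}^{-1/2}\mathbf{u}_{0j}}{\|\mathbf{A}^{-1/2}\mathbf{u}_{0j}\|}\qquad\text{and}\qquad s_{nvj}\mathbf{v}_{nj}\to\frac{\mathbf{B}^{-1/2}\mathbf{v}_{0j}}{\|\mathbf{B}^{-1/2}\mathbf{v}_{0j}\|}$$ almost surely, for all $j=1,\ldots,d$.
   Context: Prime denotes transpose, $\mathbb{S}^{p-1}$ is the unit sphere of $\mathbb{R}^p$, $\mathcal{U}_0:=\mathbb{S}^{p-1}\times\mathbb{S}^{q-1}$. $\mathcal{N}_{p\times q}(\mathbf{T},\mathbf{A},\mathbf{B})$ is the distribution of $\mathbf{T}+\mathbf{A}^{1/2}\mathbf{Z}\mathbf{B}^{1/2}$, where the entries of the $p\times q$ random matrix $\mathbf{Z}$ are i.i.d. standard normal and square roots are the symmetric positive definite ones; $\alpha_1 P_1+\alpha_2 P_2$ denotes the mixture distribution. A singular pair of a matrix $\mathbf{R}$ for the singular value $\sigma$ is a pair of unit vectors $(\mathbf{u},\mathbf{v})$ with $\mathbf{R}\mathbf{v}=\sigma\mathbf{u}$ and $\mathbf{R}'\mathbf{u}=\sigma\mathbf{v}$. The signs $s_{nuj},s_{nvj}$ may depend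 on the sample (they are random). Sample indices, with $\bar{\mathbf{X}}=\frac1n\sum_{i=1}^n\mathbf{X}_i$ and $\mathbf{Y}_i=\mathbf{X}_i-\bar{\mathbf{X}}$ (almost surely well-defined on the whole domain for $n>pq$): $$\kappa_{n\mathbf{X}}(\mathbf{u},\mathbf{v}):=\frac{\frac1n\sum_{i=1}^n(\mathbf{u}'\mathbf{Y}_i\mathbf{v})^4}{\left(\frac1n\sum_{i=1}^n(\mathbf{u}'\mathbf{Y}_i\mathbf{v})^2\right)^2},\qquad \psi_{n\mathbf{X}}(\mathbf{u}):=\frac1n\sum_{i=1}^n\left[\mathbf{u}'\mathbf{Y}_i\left\{\frac1n\sum_{l=1}^n\mathbf{Y}_l'\mathbf{u}\mathbf{u}'\mathbf{Y}_l\right\}^{-1}\mathbf{Y}_i'\mathbf{u}\right]^2,$$ for $\mathbf{u}\in\mathbb{S}^{p-1}$, $\mathbf{v}\in\mathbb{S}^{q-1}$, and $\psi_{n\mathbf{X}'}(\mathbf{v})$ is defined in the same way from the transposed matrices $\mathbf{X}_1',\ldots,\mathbf{X}_n'$. Given pairs $(\mathbf{u}_{n1},\mathbf{v}_{n1}),\ldots,(\mathbf{u}_{nd},\mathbf{v}_{nd})\in\mathcal{U}_0$, put, for $k=1,\ldots,d-1$, $\mathbf{G}_{n1k,\mathbf{X}}:=\frac1n\sum_{i=1}^n\mathbf{Y}_i\mathbf{v}_{nk}\mathbf{v}_{nk}'\mathbf{Y}_i'$ and $\mathbf{G}_{n2k,\mathbf{X}}:=\frac1n\sum_{i=1}^n\mathbf{Y}_i'\mathbf{u}_{nk}\mathbf{u}_{nk}'\mathbf{Y}_i$,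 and let $\mathcal{G}_{n1,\mathbf{X}},\mathcal{G}_{n2,\mathbf{X}}$ be the corresponding collections. The pairs form a sequence of $(\mathcal{G}_{n1,\mathbf{X}},\mathcal{G}_{n2,\mathbf{X}})$-maximizers of $g:\mathcal{U}_0\to\mathbb{R}$ if $(\mathbf{u}_{n1},\mathbf{v}_{n1})$ maximizes $g$ in $\mathcal{U}_0$ and, for each $j=2,\ldots,d$, $(\mathbf{u}_{nj},\mathbf{v}_{nj})$ maximizes $g$ over those $(\mathbf{u},\mathbf{v})\in\mathcal{U}_0$ with $\mathbf{u}'\mathbf{G}_{n1k,\mathbf{X}}\mathbf{u}_{nk}=0$ and $\mathbf{v}'\mathbf{G}_{n2k,\mathbf{X}}\mathbf{v}_{nk}=0$ for all $k=1,\ldots,j-1$. They form a sequence of $(\mathcal{G}_{n1,\mathbf{X}},\mathcal{G}_{n2,\mathbf{X}})$-maximizers of a pair $(g_1,g_2)$, $g_1:\mathbb{S}^{p-1}\to\mathbb{R}$, $g_2:\mathbb{S}^{q-1}\to\mathbb{R}$, if $\mathbf{u}_{n1}$ maximizes $g_1$, $\mathbf{v}_{n1}$ maximizes $g_2$, and, for each $j=2,\ldots,d$, $\mathbf{u}_{nj}$ maximizes $g_1$ over those $\mathbf{u}\in\mathbb{S}^{p-1}$ with $\mathbf{u}'\mathbf{G}_{n1k,\mathbf{X}}\mathbf{u}_{nk}=0$ for all $k<j$, and $\mathbf{v}_{nj}$ maximizes $g_2$ over those $\mathbf{v}\in\mathbb{S}^{q-1}$ with $\mathbf{v}'\mathbf{G}_{n2k,\mathbf{X}}\mathbf{v}_{nk}=0$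 for all $k<j$. *)

theory Defs
  imports "HOL-Probability.Probability"
begin

text \<open>
  A \<open>p \<times> q\<close> matrix is an element of \<open>real^'q^'p\<close>, with \<open>p = CARD('p)\<close> and \<open>q = CARD('q)\<close>.
  Samples, singular pairs and maximizing pairs are indexed from 1.
\<close>

definition outer_prod :: "real^'m \<Rightarrow> real^'n \<Rightarrow> real^'n^'m" where
  "outer_prod x y = (\<chi> i j. x $ i * y $ j)"

definition sym_posdef :: "real^'n^'n \<Rightarrow> bool" where
  "sym_posdef A \<longleftrightarrow> transpose A = A \<and> (\<forall>x. x \<noteq> 0 \<longrightarrow> x \<bullet> (A *v x) > 0)"

definition mat_sqrt :: "real^'n^'n \<Rightarrow> real^'n^'n" where
  "mat_sqrt A = (THE S. sym_posdef S \<and> S ** S = A)"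

definition mat_inv_sqrt :: "real^'n^'n \<Rightarrow> real^'n^'n" where
  "mat_inv_sqrt A = matrix_inv (mat_sqrt A)"

definition singular_pair :: "real^'q^'p \<Rightarrow> real \<Rightarrow> real^'p \<Rightarrow> real^'q \<Rightarrow> bool" where
  "singular_pair R \<sigma> u v \<longleftrightarrow>
     norm u = 1 \<and> norm v = 1 \<and> R *v v = \<sigma> *\<^sub>R u \<and> transpose R *v u = \<sigma> *\<^sub>R v"

text \<open>
  Singular values are nonnegative by convention, so the non-zero ones are the positive ones
  (without the sign condition, \<open>(u, -v)\<close> would be a pair for \<open>-\<sigma>\<close>).
\<close>

definition nonzero_singular_values :: "real^'q^'p \<Rightarrow> real set" where
  "nonzero_singular_values R = {\<sigma>. \<sigma> > 0 \<and> (\<exists>u v. singular_pair R \<sigma> u v)}"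

definition std_normal_matrix :: "(real^'q^'p) measure" where
  "std_normal_matrix =
     distr (PiM (UNIV :: ('p \<times> 'q) set) (\<lambda>_. density lborel std_normal_density)) borel
       (\<lambda>z. \<chi> i j. z (i, j))"

definition matrix_normal ::
    "real^'q^'p \<Rightarrow> real^'p^'p \<Rightarrow> real^'q^'q \<Rightarrow> (real^'q^'p) measure" where
  "matrix_normal T A B =
     distr std_normal_matrix borel (\<lambda>Z. T + mat_sqrt A ** Z ** mat_sqrt B)"

text \<open>The mixture is meant for two measures on the same \<open>\<sigma>\<close>-algebra.\<close>

definition mixture :: "real \<Rightarrow> 'a measure \<Rightarrow> real \<Rightarrow> 'a measure \<Rightarrow> 'a measure" where
  "mixture a1 M1 a2 M2 =
     measure_of (space M1) (sets M1)
       (\<lambda>S. ennreal a1 * emeasure M1 S + ennreal a2 * emeasure M2 S)"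

lemma emeasure_mixture:
  assumes sets: "sets M2 = sets M1" and S: "S \<in> sets M1"
  shows "emeasure (mixture a1 M1 a2 M2) S =
           ennreal a1 * emeasure M1 S + ennreal a2 * emeasure M2 S"
proof (rule emeasure_measure_of[OF mixture_def])
  show "sets M1 \<subseteq> Pow (space M1)"
    by (rule sets.space_closed)
  show "S \<in> sets (mixture a1 M1 a2 M2)"
    using S by (simp add: mixture_def)
  show "positive (sets (mixture a1 M1 a2 M2))
      (\<lambda>S. ennreal a1 * emeasure M1 S + ennreal a2 * emeasure M2 S)"
    by (simp add: positive_def)
  show "countably_additive (sets (mixture a1 M1 a2 M2))
      (\<lambda>S. ennreal a1 * emeasure M1 S + ennreal a2 * emeasure M2 S)"
  proof (rule countably_additiveI)
    fix F :: "nat \<Rightarrow> 'a set"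
    assume "range F \<subseteq> sets (mixture a1 M1 a2 M2)" and disj: "disjoint_family F"
    then have F1: "range F \<subseteq> sets M1" and F2: "range F \<subseteq> sets M2"
      by (simp_all add: mixture_def sets)
    show "(\<Sum>i. ennreal a1 * emeasure M1 (F i) + ennreal a2 * emeasure M2 (F i)) =
        ennreal a1 * emeasure M1 (\<Union>(range F)) + ennreal a2 * emeasure M2 (\<Union>(range F))"
      by (simp add: suminf_add[symmetric] suminf_emeasure[OF F1 disj] suminf_emeasure[OF F2 disj])
  qed
qed

definition centered :: "nat \<Rightarrow> (nat \<Rightarrow> real^'q^'p) \<Rightarrow> nat \<Rightarrow> real^'q^'p" where
  "centered n X i = X i - (1 / real n) *\<^sub>R (\<Sum>l=1..n. X l)"

definition kappa :: "nat \<Rightarrow> (nat \<Rightarrow> real^'q^'p) \<Rightarrow> real^'p \<Rightarrow> real^'q \<Rightarrow> real" where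
  "kappa n X u v =
     ((1 / real n) * (\<Sum>i=1..n. (u \<bullet> (centered n X i *v v)) ^ 4)) /
     ((1 / real n) * (\<Sum>i=1..n. (u \<bullet> (centered n X i *v v)) ^ 2)) ^ 2"

text \<open>
  Below, \<open>u' Y\<^sub>i\<close> is handled through the column vector \<open>Y\<^sub>i' u\<close>, and \<open>Y\<^sub>l' u u' Y\<^sub>l\<close> is the outer
  product of \<open>Y\<^sub>l' u\<close> with itself. The index for the transposed sample is
  \<open>psi n (\<lambda>i. transpose (X i))\<close>.
\<close>

definition psi :: "nat \<Rightarrow> (nat \<Rightarrow> real^'q^'p) \<Rightarrow> real^'p \<Rightarrow> real" where
  "psi n X u =
     (let w = (\<lambda>i. transpose (centered n X i) *v u);
          C = (1 / real n) *\<^sub>R (\<Sum>l=1..n. outer_prod (w l) (w l))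
      in (1 / real n) * (\<Sum>i=1..n. (w i \<bullet> (matrix_inv C *v w i)) ^ 2))"

definition G1 :: "nat \<Rightarrow> (nat \<Rightarrow> real^'q^'p) \<Rightarrow> real^'q \<Rightarrow> real^'p^'p" where
  "G1 n X v =
     (1 / real n) *\<^sub>R (\<Sum>i=1..n. outer_prod (centered n X i *v v) (centered n X i *v v))"

definition G2 :: "nat \<Rightarrow> (nat \<Rightarrow> real^'q^'p) \<Rightarrow> real^'p \<Rightarrow> real^'q^'q" where
  "G2 n X u =
     (1 / real n) *\<^sub>R
       (\<Sum>i=1..n. outer_prod (transpose (centered n X i) *v u) (transpose (centered n X i) *v u))"

text \<open>For \<open>j = 1\<close> the orthogonality constraints below are void.\<close>

definition joint_maximizers ::
    "nat \<Rightarrow> (nat \<Rightarrow> real^'p^'p) \<Rightarrow> (nat \<Rightarrow> real^'q^'q) \<Rightarrow> (real^'p \<Rightarrow> real^'q \<Rightarrow> real) \<Rightarrow>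
     (nat \<Rightarrow> real^'p) \<Rightarrow> (nat \<Rightarrow> real^'q) \<Rightarrow> bool" where
  "joint_maximizers d GG1 GG2 g u v \<longleftrightarrow>
     (\<forall>j\<in>{1..d}. is_arg_max (\<lambda>(x, y). g x y)
        (\<lambda>(x, y). x \<in> sphere 0 1 \<and> y \<in> sphere 0 1 \<and>
           (\<forall>k\<in>{1..<j}. x \<bullet> (GG1 k *v u k) = 0 \<and> y \<bullet> (GG2 k *v v k) = 0))
        (u j, v j))"

definition separate_maximizers ::
    "nat \<Rightarrow> (nat \<Rightarrow> real^'p^'p) \<Rightarrow> (nat \<Rightarrow> real^'q^'q) \<Rightarrow> (real^'p \<Rightarrow> real) \<Rightarrow> (real^'q \<Rightarrow> real) \<Rightarrow>
     (nat \<Rightarrow> real^'p) \<Rightarrow> (nat \<Rightarrow> real^'q) \<Rightarrow> bool" where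
  "separate_maximizers d GG1 GG2 g1 g2 u v \<longleftrightarrow>
     (\<forall>j\<in>{1..d}.
        is_arg_max g1
          (\<lambda>x. x \<in> sphere 0 1 \<and> (\<forall>k\<in>{1..<j}. x \<bullet> (GG1 k *v u k) = 0)) (u j) \<and>
        is_arg_max g2
          (\<lambda>y. y \<in> sphere 0 1 \<and> (\<forall>k\<in>{1..<j}. y \<bullet> (GG2 k *v v k) = 0)) (v j))"

definition kappa_maximizers ::
    "nat \<Rightarrow> nat \<Rightarrow> (nat \<Rightarrow> real^'q^'p) \<Rightarrow> (nat \<Rightarrow> real^'p) \<Rightarrow> (nat \<Rightarrow> real^'q) \<Rightarrow> bool" where
  "kappa_maximizers d n X u v \<longleftrightarrow>
     joint_maximizers d (\<lambda>k. G1 n X (v k)) (\<lambda>k. G2 n X (u k)) (kappa n X) u v"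

definition psi_maximizers ::
    "nat \<Rightarrow> nat \<Rightarrow> (nat \<Rightarrow> real^'q^'p) \<Rightarrow> (nat \<Rightarrow> real^'p) \<Rightarrow> (nat \<Rightarrow> real^'q) \<Rightarrow> bool" where
  "psi_maximizers d n X u v \<longleftrightarrow>
     separate_maximizers d (\<lambda>k. G1 n X (v k)) (\<lambda>k. G2 n X (u k))
       (psi n X) (psi n (\<lambda>i. transpose (X i))) u v"

end

theory Submission
  imports Defs
begin

text \<open>
  The fourth-moment strong law makes all empirical monomials of degree at most four converge almost
  surely, so that almost surely \<open>\<kappa>\<^sub>n\<close> and \<open>\<psi>\<^sub>n\<close> converge along every convergent sequence of
  arguments. Put \<open>c = \<alpha>\<^sub>1 \<alpha>\<^sub>2\<close>, \<open>a = A\<^bsup>1/2\<^esup> u\<close>, \<open>b = B\<^bsup>1/2\<^esup> v\<close>. A projection of the centred mixture is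
  Gaussian noise plus an independent centred two-point variable of variance proportional to \<open>c\<close>,
  and its kurtosis is \<open>3 + c (1 - 6 c) (t / (1 + c t))\<^sup>2\<close> with \<open>t = (a' R b)\<^sup>2 / (|a|\<^sup>2 |b|\<^sup>2)\<close>. The limit of
  \<open>\<psi>\<^sub>n\<close> is the same function of \<open>t = |R' a|\<^sup>2 / |a|\<^sup>2\<close>, up to an additive constant. The condition on \<open>\<alpha>\<^sub>1\<close> says
  \<open>c < 1/6\<close>, so both limits increase strictly with \<open>t\<close>. In the limit the orthogonality constraints become
  \<open>a \<perp> u\<^sub>0\<^sub>k\<close> and \<open>b \<perp> v\<^sub>0\<^sub>k\<close>, and under these constraints \<open>t\<close> is maximal exactly at the \<open>j\<close>-th singular pair
  of \<open>R\<close>, up to signs. Compactness then gives convergence of the maximizers by induction on \<open>j\<close>.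
\<close>

section \<open>Moments of independent sums and a strong law of large numbers\<close>

text \<open>The obstacle is that the feasible set at stage \<open>j\<close> depends on
  \<open>n\<close> and on the earlier maximizers: the expected limit direction is in general
  feasible for no finite sample, so it cannot be compared with the maximizer directly. It is
  replaced by feasible points that converge to it.

  The limiting constraints become plain orthogonality for a structural reason. The constraint matrix
  tends to a noise part \<open>(v' B v) A\<close> plus a rank-one shift part
  \<open>c D v v' D'\<close> with \<open>D = T2 - T1\<close>; applied to the limit direction, both
  give multiples of \<open>A^{1/2} u0_k\<close>, the second because
  \<open>R v0_k = \<sigma>_k u0_k\<close>.

  The factor \<open>c (1 - 6 c)\<close> is the fourth cumulant of a centred Bernoulli variable,
  while Gaussian noise has fourth cumulant zero. As \<open>c = 1/4 - (\<alpha>1 - 1/2)^2\<close>, it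
  changes sign exactly at distance \<open>1 / sqrt 12\<close> from 1/2.

  Randomness is confined to one almost sure event, on which finitely many empirical moments
  converge. On it the sample is a fixed sequence, and maximizers and signs are treated
  pathwise.\<close>

context
  fixes M :: "'a measure"
  assumes prob_space_M: "prob_space M"
begin

interpretation prob_space M by (rule prob_space_M)

lemma integrable_power_le:
  fixes f :: "'a \<Rightarrow> real"
  assumes [measurable]: "f \<in> borel_measurable M"
    and f: "integrable M (\<lambda>x. \<bar>f x\<bar> ^ n)" and mn: "m \<le> n"
  shows "integrable M (\<lambda>x. f x ^ m)"
proof (rule Bochner_Integration.integrable_bound)
  show "integrable M (\<lambda>x. 1 + \<bar>f x\<bar> ^ n)"
    using f by simp
  have "\<bar>y ^ m\<bar> \<le> \<bar>1 + \<bar>y\<bar> ^ n\<bar>" for y :: real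
  proof (cases "\<bar>y\<bar> \<le> 1")
    case True
    then have "\<bar>y\<bar> ^ m \<le> 1" by (simp add: power_le_one)
    then show ?thesis by (simp add: power_abs add_increasing2 abs_of_nonneg)
  next
    case False
    then have "\<bar>y\<bar> ^ m \<le> \<bar>y\<bar> ^ n" using mn by (intro power_increasing) auto
    then show ?thesis by (simp add: power_abs)
  qed
  then show "AE x in M. norm (f x ^ m) \<le> norm (1 + \<bar>f x\<bar> ^ n)" by simp
qed simp

lemma integrable_power4_le:
  fixes f :: "'a \<Rightarrow> real"
  assumes "f \<in> borel_measurable M" "integrable M (\<lambda>x. f x ^ 4)" "m \<le> 4"
  shows "integrable M (\<lambda>x. f x ^ m)"
  using integrable_power_le[of f 4 m] assms by (simp add: power_even_abs)

lemma indep_var_power_times: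
  fixes f g :: "'a \<Rightarrow> real"
  assumes ind: "indep_var borel f borel g"
    and f: "integrable M (\<lambda>x. f x ^ 4)" and g: "integrable M (\<lambda>x. g x ^ 4)"
    and "i \<le> 4" "j \<le> 4"
  shows "has_bochner_integral M (\<lambda>x. f x ^ i * g x ^ j)
           (expectation (\<lambda>x. f x ^ i) * expectation (\<lambda>x. g x ^ j))"
proof -
  have m: "f \<in> borel_measurable M" "g \<in> borel_measurable M"
    using ind indep_var_rv1 indep_var_rv2 by blast+
  have ind': "indep_var borel (\<lambda>x. f x ^ i) borel (\<lambda>x. g x ^ j)"
    using indep_var_compose[OF ind, of "\<lambda>x. x ^ i" borel "\<lambda>x. x ^ j" borel]
    by (simp add: comp_def)
  have "integrable M (\<lambda>x. f x ^ i)" "integrable M (\<lambda>x. g x ^ j)"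
    using assms m by (auto intro: integrable_power4_le)
  then show ?thesis
    using indep_var_lebesgue_integral[OF ind'] indep_var_integrable[OF ind']
    by (simp add: has_bochner_integral_iff)
qed

text \<open>Every mixed term of the two expansions other than \<open>f^2 g^2\<close> contains a
  first power of \<open>f\<close> or of \<open>g\<close>; by independence its expectation has a
  factor zero, so third moments never enter.\<close>

lemma indep_var_add_moments:
  fixes f g :: "'a \<Rightarrow> real"
  assumes ind: "indep_var borel f borel g"
    and f4: "integrable M (\<lambda>x. f x ^ 4)" and g4: "integrable M (\<lambda>x. g x ^ 4)"
    and f1: "expectation f = 0" and g1: "expectation g = 0"
  shows "has_bochner_integral M (\<lambda>x. (f x + g x)\<^sup>2)
      (expectation (\<lambda>x. (f x)\<^sup>2) + expectation (\<lambda>x. (g x)\<^sup>2))"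
    and "has_bochner_integral M (\<lambda>x. (f x + g x) ^ 4)
      (expectation (\<lambda>x. f x ^ 4) + 6 * expectation (\<lambda>x. (f x)\<^sup>2) * expectation (\<lambda>x. (g x)\<^sup>2)
        + expectation (\<lambda>x. g x ^ 4))"
proof -
  note p = indep_var_power_times[OF ind f4 g4]
  note [simp] = f1 g1 prob_space
  \<comment> \<open>Exponents 0 and 1 are kept so that every term, pure powers included, is an
    instance of the single product rule \<open>p\<close>.\<close>
  have "has_bochner_integral M (\<lambda>x. f x ^ 2 * g x ^ 0 + 2 * (f x ^ 1 * g x ^ 1) + f x ^ 0 * g x ^ 2)
      (expectation (\<lambda>x. f x ^ 2) * expectation (\<lambda>x. g x ^ 0)
       + 2 * (expectation (\<lambda>x. f x ^ 1) * expectation (\<lambda>x. g x ^ 1))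
       + expectation (\<lambda>x. f x ^ 0) * expectation (\<lambda>x. g x ^ 2))"
    by (intro has_bochner_integral_add has_bochner_integral_mult_right p) auto
  then show "has_bochner_integral M (\<lambda>x. (f x + g x)\<^sup>2)
      (expectation (\<lambda>x. (f x)\<^sup>2) + expectation (\<lambda>x. (g x)\<^sup>2))"
    by (simp add: power2_sum algebra_simps)
  have "has_bochner_integral M
      (\<lambda>x. f x ^ 4 * g x ^ 0 + 4 * (f x ^ 3 * g x ^ 1) + 6 * (f x ^ 2 * g x ^ 2)
         + 4 * (f x ^ 1 * g x ^ 3) + f x ^ 0 * g x ^ 4)
      (expectation (\<lambda>x. f x ^ 4) * expectation (\<lambda>x. g x ^ 0)
       + 4 * (expectation (\<lambda>x. f x ^ 3) * expectation (\<lambda>x. g x ^ 1))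
       + 6 * (expectation (\<lambda>x. f x ^ 2) * expectation (\<lambda>x. g x ^ 2))
       + 4 * (expectation (\<lambda>x. f x ^ 1) * expectation (\<lambda>x. g x ^ 3))
       + expectation (\<lambda>x. f x ^ 0) * expectation (\<lambda>x. g x ^ 4))"
    by (intro has_bochner_integral_add has_bochner_integral_mult_right p) auto
  moreover have "(a + b) ^ 4 = a ^ 4 + 4 * (a ^ 3 * b) + 6 * (a ^ 2 * b ^ 2) + 4 * (a * b ^ 3) + b ^ 4"
    for a b :: real by algebra
  ultimately show "has_bochner_integral M (\<lambda>x. (f x + g x) ^ 4)
      (expectation (\<lambda>x. f x ^ 4) + 6 * expectation (\<lambda>x. (f x)\<^sup>2) * expectation (\<lambda>x. (g x)\<^sup>2)
        + expectation (\<lambda>x. g x ^ 4))"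
    by (simp add: mult.assoc)
qed

text \<open>The formula for the fourth moment says that fourth cumulants are additive.\<close>

lemma indep_vars_sum_moments:
  fixes Z :: "'i \<Rightarrow> 'a \<Rightarrow> real"
  assumes "finite I" and "indep_vars (\<lambda>_. borel) Z I"
    and "\<And>i. i \<in> I \<Longrightarrow> integrable M (\<lambda>x. Z i x ^ 4)"
    and "\<And>i. i \<in> I \<Longrightarrow> expectation (Z i) = 0"
  shows "expectation (\<lambda>x. \<Sum>i\<in>I. Z i x) = 0 \<and>
    expectation (\<lambda>x. (\<Sum>i\<in>I. Z i x)\<^sup>2) = (\<Sum>i\<in>I. expectation (\<lambda>x. (Z i x)\<^sup>2)) \<and>
    has_bochner_integral M (\<lambda>x. (\<Sum>i\<in>I. Z i x) ^ 4)
      ((\<Sum>i\<in>I. expectation (\<lambda>x. Z i x ^ 4) - 3 * (expectation (\<lambda>x. (Z i x)\<^sup>2))\<^sup>2)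
        + 3 * (\<Sum>i\<in>I. expectation (\<lambda>x. (Z i x)\<^sup>2))\<^sup>2)"
  using assms
proof (induction I rule: finite_induct)
  case empty
  show ?case by (simp add: has_bochner_integral_zero)
next
  case (insert j I)
  let ?S = "\<lambda>x. \<Sum>i\<in>I. Z i x"
  have IH: "expectation ?S = 0"
    "expectation (\<lambda>x. (?S x)\<^sup>2) = (\<Sum>i\<in>I. expectation (\<lambda>x. (Z i x)\<^sup>2))"
    "has_bochner_integral M (\<lambda>x. ?S x ^ 4)
      ((\<Sum>i\<in>I. expectation (\<lambda>x. Z i x ^ 4) - 3 * (expectation (\<lambda>x. (Z i x)\<^sup>2))\<^sup>2)
        + 3 * (\<Sum>i\<in>I. expectation (\<lambda>x. (Z i x)\<^sup>2))\<^sup>2)"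
  proof -
    have "indep_vars (\<lambda>_. borel) Z I"
      by (rule indep_vars_subset[OF insert.prems(1)]) blast
    moreover have "integrable M (\<lambda>x. Z i x ^ 4)" "expectation (Z i) = 0" if "i \<in> I" for i
      using insert.prems(2,3) that by simp_all
    ultimately have *: "expectation ?S = 0 \<and>
        expectation (\<lambda>x. (?S x)\<^sup>2) = (\<Sum>i\<in>I. expectation (\<lambda>x. (Z i x)\<^sup>2)) \<and>
        has_bochner_integral M (\<lambda>x. ?S x ^ 4)
          ((\<Sum>i\<in>I. expectation (\<lambda>x. Z i x ^ 4) - 3 * (expectation (\<lambda>x. (Z i x)\<^sup>2))\<^sup>2)
            + 3 * (\<Sum>i\<in>I. expectation (\<lambda>x. (Z i x)\<^sup>2))\<^sup>2)"
      by (rule insert.IH)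
    then show "expectation ?S = 0"
      "expectation (\<lambda>x. (?S x)\<^sup>2) = (\<Sum>i\<in>I. expectation (\<lambda>x. (Z i x)\<^sup>2))"
      "has_bochner_integral M (\<lambda>x. ?S x ^ 4)
        ((\<Sum>i\<in>I. expectation (\<lambda>x. Z i x ^ 4) - 3 * (expectation (\<lambda>x. (Z i x)\<^sup>2))\<^sup>2)
          + 3 * (\<Sum>i\<in>I. expectation (\<lambda>x. (Z i x)\<^sup>2))\<^sup>2)"
      by (simp_all only: conj_assoc)
  qed
  have ind: "indep_var borel (Z j) borel ?S"
    by (rule indep_vars_sum[OF insert.hyps insert.prems(1)])
  have int: "integrable M (\<lambda>x. Z j x ^ 4)" "integrable M (\<lambda>x. ?S x ^ 4)"
    and m: "expectation (Z j) = 0"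
    using insert.prems IH(3) by (auto simp: has_bochner_integral_iff)
  note mom = indep_var_add_moments[OF ind int m IH(1)]
  have S4: "expectation (\<lambda>x. ?S x ^ 4) =
      (\<Sum>i\<in>I. expectation (\<lambda>x. Z i x ^ 4) - 3 * (expectation (\<lambda>x. (Z i x)\<^sup>2))\<^sup>2)
        + 3 * (\<Sum>i\<in>I. expectation (\<lambda>x. (Z i x)\<^sup>2))\<^sup>2"
    using IH(3) by (rule has_bochner_integral_integral_eq)
  have "integrable M (Z j)" "integrable M ?S"
    using int ind indep_var_rv1[OF ind] indep_var_rv2[OF ind]
      integrable_power4_le[of "Z j" 1] integrable_power4_le[of ?S 1] by auto
  then have e1: "expectation (\<lambda>x. Z j x + ?S x) = 0"
    using m IH(1) by simp
  have e2: "expectation (\<lambda>x. (Z j x + ?S x)\<^sup>2) =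
      expectation (\<lambda>x. (Z j x)\<^sup>2) + (\<Sum>i\<in>I. expectation (\<lambda>x. (Z i x)\<^sup>2))"
    using has_bochner_integral_integral_eq[OF mom(1)] IH(2) by simp
  \<comment> \<open>The cross term is the one in \<open>3 (E Z_j^2 + E S^2)^2\<close>, and the
    square \<open>3 (E Z_j^2)^2\<close> created there cancels against the one subtracted in the
    cumulant of \<open>Z_j\<close>.\<close>
  have eq: "expectation (\<lambda>x. Z j x ^ 4) + 6 * expectation (\<lambda>x. (Z j x)\<^sup>2) * expectation (\<lambda>x. (?S x)\<^sup>2)
        + expectation (\<lambda>x. ?S x ^ 4) =
      (\<Sum>i\<in>insert j I. expectation (\<lambda>x. Z i x ^ 4) - 3 * (expectation (\<lambda>x. (Z i x)\<^sup>2))\<^sup>2)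
        + 3 * (\<Sum>i\<in>insert j I. expectation (\<lambda>x. (Z i x)\<^sup>2))\<^sup>2"
    unfolding S4 IH(2) sum.insert[OF insert.hyps] by (simp add: power2_eq_square algebra_simps)
  show ?case
    using e1 e2 mom(2) insert.hyps unfolding eq by simp
qed

section \<open>Strong law of large numbers under fourth moments\<close>

lemma AE_tendsto_zero_if_summable_moments:
  fixes Y :: "nat \<Rightarrow> 'a \<Rightarrow> real"
  assumes [measurable]: "\<And>n. Y n \<in> borel_measurable M"
    and bound: "\<And>n. (\<integral>\<^sup>+x. ennreal (Y n x ^ 4) \<partial>M) \<le> ennreal (k n)"
    and k: "summable k" "\<And>n. 0 \<le> k n"
  shows "AE \<omega> in M. (\<lambda>n. Y n \<omega>) \<longlonglongrightarrow> 0"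
proof -
  have "(\<integral>\<^sup>+x. (\<Sum>n. ennreal (Y n x ^ 4)) \<partial>M) = (\<Sum>n. \<integral>\<^sup>+x. ennreal (Y n x ^ 4) \<partial>M)"
    by (rule nn_integral_suminf) simp
  also have "\<dots> \<le> (\<Sum>n. ennreal (k n))"
    by (rule suminf_le) (rule bound, rule summableI, rule summableI)
  also have "\<dots> = ennreal (suminf k)"
    by (rule suminf_ennreal2[OF k(2,1)])
  finally have "(\<integral>\<^sup>+x. (\<Sum>n. ennreal (Y n x ^ 4)) \<partial>M) \<noteq> \<infinity>"
    by (metis ennreal_less_top infinity_ennreal_def leD)
  \<comment> \<open>A series of non-negative terms with finite expectation is finite almost
    everywhere, and the terms of a convergent series tend to zero; this takes the place of a
    Borel-Cantelli argument.\<close>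
  then have "AE x in M. (\<Sum>n. ennreal (Y n x ^ 4)) \<noteq> \<infinity>"
    by (rule nn_integral_noteq_infinite[rotated]) measurable
  then show ?thesis
  proof (rule AE_mp, intro AE_I2 impI)
    fix x assume "(\<Sum>n. ennreal (Y n x ^ 4)) \<noteq> \<infinity>"
    then have "(\<Sum>n. ennreal (Y n x ^ 4)) \<noteq> top"
      unfolding infinity_ennreal_def .
    then have "summable (\<lambda>n. Y n x ^ 4)"
      by (rule summable_suminf_not_top[rotated]) simp
    then have "(\<lambda>n. Y n x ^ 4) \<longlonglongrightarrow> 0"
      by (rule summable_LIMSEQ_zero)
    then have "(\<lambda>n. root 4 (Y n x ^ 4)) \<longlonglongrightarrow> root 4 0"
      by (rule tendsto_real_root)
    moreover have "root 4 (y ^ 4) = \<bar>y\<bar>" for y :: real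
      using root_abs_power[of 4 y] by (simp add: power_even_abs)
    ultimately have "(\<lambda>n. \<bar>Y n x\<bar>) \<longlonglongrightarrow> 0"
      by simp
    then show "(\<lambda>n. Y n x) \<longlonglongrightarrow> 0"
      by (rule tendsto_rabs_zero_cancel)
  qed
qed

text \<open>The fourth moment of a sum of \<open>n\<close> centred variables grows like
  \<open>n^2\<close>, so that of their mean decays like \<open>n^(-2)\<close>, which is summable. At
  \<open>n = 0\<close> both sides are 0, since \<open>1 / 0 = 0\<close>.\<close>

lemma fourth_moment_scaling_bound:
  fixes a b :: real
  shows "(1 / real n) ^ 4 * (real n * (b - 3 * a\<^sup>2) + 3 * (real n * a)\<^sup>2)
    \<le> (\<bar>b\<bar> + 3 * a\<^sup>2) * (1 / real n ^ 2)"
proof (cases "n = 0")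
  case False
  then have n1: "real n \<ge> 1" by simp
  have "real n * b \<le> real n * \<bar>b\<bar>" by (simp add: mult_left_mono)
  also have "\<dots> \<le> real n ^ 2 * \<bar>b\<bar>"
    using n1 by (simp add: power2_eq_square mult_right_mono)
  finally have "real n * b \<le> real n ^ 2 * \<bar>b\<bar>" .
  moreover have "real n * (b - 3 * a\<^sup>2) \<le> real n * b"
    by (simp add: mult_left_mono)
  moreover have "real n ^ 2 * (\<bar>b\<bar> + 3 * a\<^sup>2) = real n ^ 2 * \<bar>b\<bar> + 3 * (real n * a)\<^sup>2"
    by (simp add: algebra_simps power_mult_distrib)
  ultimately have "real n * (b - 3 * a\<^sup>2) + 3 * (real n * a)\<^sup>2 \<le> real n ^ 2 * (\<bar>b\<bar> + 3 * a\<^sup>2)"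
    by linarith
  then have "(1 / real n) ^ 4 * (real n * (b - 3 * a\<^sup>2) + 3 * (real n * a)\<^sup>2)
      \<le> (1 / real n) ^ 4 * (real n ^ 2 * (\<bar>b\<bar> + 3 * a\<^sup>2))"
    by (rule mult_left_mono) simp
  also have "\<dots> = (\<bar>b\<bar> + 3 * a\<^sup>2) * (1 / real n ^ 2)"
    using n1 by (simp add: field_simps eval_nat_numeral)
  finally show ?thesis .
qed simp

lemma fourth_moment_strong_law_centered:
  fixes Z :: "nat \<Rightarrow> 'a \<Rightarrow> real"
  assumes ind: "indep_vars (\<lambda>_. borel) Z {1..}"
    and int: "\<And>i. i \<ge> 1 \<Longrightarrow> integrable M (\<lambda>x. Z i x ^ 4)"
    and mean: "\<And>i. i \<ge> 1 \<Longrightarrow> expectation (Z i) = 0"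
    and m2: "\<And>i. i \<ge> 1 \<Longrightarrow> expectation (\<lambda>x. (Z i x)\<^sup>2) = a"
    and m4: "\<And>i. i \<ge> 1 \<Longrightarrow> expectation (\<lambda>x. Z i x ^ 4) = b"
  shows "AE \<omega> in M. (\<lambda>n. (1 / real n) * (\<Sum>i=1..n. Z i \<omega>)) \<longlonglongrightarrow> 0"
proof (rule AE_tendsto_zero_if_summable_moments)
  let ?K = "\<bar>b\<bar> + 3 * a\<^sup>2"
  have Z: "Z i \<in> borel_measurable M" if "i \<ge> 1" for i
    using ind that unfolding indep_vars_def by simp
  have "(\<lambda>\<omega>. \<Sum>i=1..n. Z i \<omega>) \<in> borel_measurable M" for n
    by (rule borel_measurable_sum) (simp add: Z)
  then show "(\<lambda>\<omega>. (1 / real n) * (\<Sum>i=1..n. Z i \<omega>)) \<in> borel_measurable M" for n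
    by (rule borel_measurable_times[OF borel_measurable_const])
  show "summable (\<lambda>n. ?K * (1 / real n ^ 2))"
    by (rule summable_mult) (use inverse_power_summable[of 2, where 'a = real] in \<open>simp add: inverse_eq_divide\<close>)
  show "0 \<le> ?K * (1 / real n ^ 2)" for n
    by simp
  fix n
  have "indep_vars (\<lambda>_. borel) Z {1..n}"
    by (rule indep_vars_subset[OF ind]) simp
  from indep_vars_sum_moments[OF _ this int mean]
  have "has_bochner_integral M (\<lambda>x. (\<Sum>i=1..n. Z i x) ^ 4) (real n * (b - 3 * a\<^sup>2) + 3 * (real n * a)\<^sup>2)"
    by (simp add: m2 m4)
  then have "has_bochner_integral M (\<lambda>x. (1 / real n) ^ 4 * (\<Sum>i=1..n. Z i x) ^ 4)
      ((1 / real n) ^ 4 * (real n * (b - 3 * a\<^sup>2) + 3 * (real n * a)\<^sup>2))"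
    by (rule has_bochner_integral_mult_right)
  then have h: "has_bochner_integral M (\<lambda>x. ((1 / real n) * (\<Sum>i=1..n. Z i x)) ^ 4)
      ((1 / real n) ^ 4 * (real n * (b - 3 * a\<^sup>2) + 3 * (real n * a)\<^sup>2))"
    unfolding power_mult_distrib .
  have "(\<integral>\<^sup>+x. ennreal (((1 / real n) * (\<Sum>i=1..n. Z i x)) ^ 4) \<partial>M) =
      ennreal ((1 / real n) ^ 4 * (real n * (b - 3 * a\<^sup>2) + 3 * (real n * a)\<^sup>2))"
    unfolding has_bochner_integral_integral_eq[OF h, symmetric]
    by (rule nn_integral_eq_integral[OF integrable.intros[OF h]]) simp
  also have "\<dots> \<le> ennreal (?K * (1 / real n ^ 2))"
    by (rule ennreal_leI[OF fourth_moment_scaling_bound])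
  finally show "(\<integral>\<^sup>+x. ennreal (((1 / real n) * (\<Sum>i=1..n. Z i x)) ^ 4) \<partial>M) \<le> ennreal (?K * (1 / real n ^ 2))" .
qed

text \<open>A function \<open>f\<close> of the observations is averaged because the law will be
  applied to monomials in matrix entries. Its fourth moment controls the lower powers that appear
  when \<open>f\<close> is centred.\<close>

lemma fourth_moment_strong_law:
  fixes X :: "nat \<Rightarrow> 'a \<Rightarrow> 'b::topological_space" and f :: "'b \<Rightarrow> real"
  assumes ind: "indep_vars (\<lambda>_. borel) X {1..}"
    and [measurable]: "f \<in> borel_measurable borel"
    and distr: "\<And>i. i \<ge> 1 \<Longrightarrow> distr M borel (X i) = D"
    and int: "integrable M (\<lambda>x. f (X 1 x) ^ 4)"
  shows "AE \<omega> in M. (\<lambda>n. (1 / real n) * (\<Sum>i=1..n. f (X i \<omega>))) \<longlonglongrightarrow> expectation (\<lambda>\<omega>. f (X 1 \<omega>))"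
proof -
  have X[measurable]: "X i \<in> borel_measurable M" if "i \<ge> 1" for i
    using ind that unfolding indep_vars_def by auto
  define m where "m = expectation (\<lambda>\<omega>. f (X 1 \<omega>))"
  define g where "g x = f x - m" for x
  have [measurable]: "g \<in> borel_measurable borel" unfolding g_def by measurable
  have tr: "expectation (\<lambda>\<omega>. h (X i \<omega>)) = expectation (\<lambda>\<omega>. h (X 1 \<omega>))"
    "integrable M (\<lambda>\<omega>. h (X i \<omega>)) \<longleftrightarrow> integrable M (\<lambda>\<omega>. h (X 1 \<omega>))"
    if "i \<ge> 1" and [measurable]: "h \<in> borel_measurable borel" for h :: "'b \<Rightarrow> real" and i
    using integral_distr[OF X[OF that(1)] that(2)] integral_distr[OF X[of 1] that(2)]
      integrable_distr_eq[OF X[OF that(1)] that(2)] integrable_distr_eq[OF X[of 1] that(2)]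
    unfolding distr[OF that(1)] distr[of 1, OF order_refl] by simp_all
  have pw: "integrable M (\<lambda>x. f (X 1 x) ^ k)" if "k \<le> 4" for k
    by (rule integrable_power4_le[OF _ int that]) measurable
  have "integrable M (\<lambda>x. f (X 1 x))"
    using pw[of 1] by simp
  then have g1: "expectation (\<lambda>x. g (X 1 x)) = 0"
    unfolding g_def m_def by (simp add: prob_space)
  have g4: "integrable M (\<lambda>x. g (X 1 x) ^ 4)"
  proof -
    have "integrable M (\<lambda>x. f (X 1 x) ^ 4 - 4 * m * f (X 1 x) ^ 3 + 6 * m\<^sup>2 * f (X 1 x) ^ 2
        - 4 * m ^ 3 * f (X 1 x) ^ 1 + m ^ 4)"
      by (intro Bochner_Integration.integrable_add Bochner_Integration.integrable_diff
          integrable_mult_right pw) auto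
    moreover have "g (X 1 x) ^ 4 = f (X 1 x) ^ 4 - 4 * m * f (X 1 x) ^ 3 + 6 * m\<^sup>2 * f (X 1 x) ^ 2
        - 4 * m ^ 3 * f (X 1 x) ^ 1 + m ^ 4" for x
      unfolding g_def by algebra
    ultimately show ?thesis by presburger
  qed
  have "AE \<omega> in M. (\<lambda>n. (1 / real n) * (\<Sum>i=1..n. g (X i \<omega>))) \<longlonglongrightarrow> 0"
  proof (rule fourth_moment_strong_law_centered)
    show "indep_vars (\<lambda>_. borel) (\<lambda>i x. g (X i x)) {1..}"
      by (rule indep_vars_compose2[OF ind]) auto
    fix i :: nat assume i: "i \<ge> 1"
    show "integrable M (\<lambda>x. g (X i x) ^ 4)"
      using tr(2)[OF i, of "\<lambda>x. g x ^ 4"] g4 by simp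
    show "expectation (\<lambda>x. g (X i x)) = 0"
      using tr(1)[OF i, of g] g1 by simp
    show "expectation (\<lambda>x. (g (X i x))\<^sup>2) = expectation (\<lambda>x. (g (X 1 x))\<^sup>2)"
      using tr(1)[OF i, of "\<lambda>x. (g x)\<^sup>2"] by simp
    show "expectation (\<lambda>x. g (X i x) ^ 4) = expectation (\<lambda>x. g (X 1 x) ^ 4)"
      using tr(1)[OF i, of "\<lambda>x. g x ^ 4"] by simp
  qed
  then show ?thesis
  proof (rule AE_mp, intro AE_I2 impI)
    fix \<omega> assume "(\<lambda>n. (1 / real n) * (\<Sum>i=1..n. g (X i \<omega>))) \<longlonglongrightarrow> 0"
    then have "(\<lambda>n. (1 / real n) * (\<Sum>i=1..n. g (X i \<omega>)) + m) \<longlonglongrightarrow> 0 + m"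
      by (intro tendsto_intros)
    \<comment> \<open>Only eventually: at \<open>n = 0\<close> the left side is \<open>m\<close> and
      the right side is 0.\<close>
    moreover have "\<forall>\<^sub>F n in sequentially. (1 / real n) * (\<Sum>i=1..n. g (X i \<omega>)) + m
        = (1 / real n) * (\<Sum>i=1..n. f (X i \<omega>))"
      using eventually_gt_at_top[of 0]
      by eventually_elim (simp add: g_def sum_subtractf field_simps)
    ultimately show "(\<lambda>n. (1 / real n) * (\<Sum>i=1..n. f (X i \<omega>))) \<longlonglongrightarrow> expectation (\<lambda>\<omega>. f (X 1 \<omega>))"
      unfolding m_def[symmetric] by (simp add: Lim_transform_eventually)
  qed
qed

end

section \<open>Positive definite matrices\<close>

lemma transpose_inner: "(transpose A *v x) \<bullet> y = x \<bullet> (A *v (y::real^'n))" for A :: "real^'n^'m"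
  by (metis dot_lmul_matrix transpose_matrix_vector)

lemma inner_axis_matrix: "axis i 1 \<bullet> ((A::real^'n^'m) *v axis j 1) = A $ i $ j"
  by (simp add: inner_axis' matrix_vector_mult_basis column_def)

lemma inner_matrix_sum: "x \<bullet> ((A::real^'n^'m) *v y) = (\<Sum>i\<in>UNIV. \<Sum>j\<in>UNIV. x $ i * A $ i $ j * y $ j)"
  by (simp add: inner_vec_def matrix_vector_mult_def sum_distrib_left mult.assoc)

lemma sym_posdef_symD: "sym_posdef A \<Longrightarrow> transpose A = A"
  and sym_posdef_posD: "sym_posdef A \<Longrightarrow> x \<noteq> 0 \<Longrightarrow> x \<bullet> (A *v x) > 0"
  by (auto simp: sym_posdef_def)

lemma sym_posdef_inner_sym: "sym_posdef A \<Longrightarrow> x \<bullet> (A *v y) = y \<bullet> (A *v x)"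
  by (metis inner_commute sym_posdef_symD transpose_inner)

lemma sym_posdef_invertible:
  assumes "sym_posdef (A::real^'n^'n)"
  shows "invertible A"
proof -
  have "x = 0" if "A *v x = 0" for x
    using that sym_posdef_posD[OF assms, of x] by force
  then show ?thesis
    using matrix_left_invertible_ker[of A] invertible_left_inverse by blast
qed

lemma matrix_inv_mult:
  assumes "invertible (A::real^'n^'n)"
  shows "A ** matrix_inv A = mat 1" "matrix_inv A ** A = mat 1"
proof -
  have "A ** matrix_inv A = mat 1 \<and> matrix_inv A ** A = mat 1"
    unfolding matrix_inv_def by (rule someI_ex) (use assms in \<open>simp add: invertible_def\<close>)
  then show "A ** matrix_inv A = mat 1" "matrix_inv A ** A = mat 1" by auto
qed

lemma sym_posdef_inv:
  assumes "sym_posdef (A::real^'n^'n)"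
  shows "sym_posdef (matrix_inv A)"
proof -
  note inv = matrix_inv_mult[OF sym_posdef_invertible[OF assms]]
  have "transpose (matrix_inv A) ** A = mat 1"
    using arg_cong[OF inv(1), of transpose] sym_posdef_symD[OF assms]
    by (simp add: matrix_transpose_mul)
  then have "transpose (matrix_inv A) = matrix_inv A"
    by (metis inv(1) matrix_mul_assoc matrix_mul_lid matrix_mul_rid)
  moreover have "x \<bullet> (matrix_inv A *v x) > 0" if "x \<noteq> 0" for x
  proof -
    define y where "y = matrix_inv A *v x"
    have x: "x = A *v y"
      by (simp add: y_def matrix_vector_mul_assoc inv)
    then have "y \<noteq> 0" using that by auto
    from sym_posdef_posD[OF assms this] show ?thesis
      by (simp add: x inner_commute matrix_vector_mul_assoc inv)
  qed
  ultimately show ?thesis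
    by (simp add: sym_posdef_def)
qed

section \<open>Square roots of positive definite matrices\<close>

text \<open>If \<open>S\<close> and \<open>S'\<close> are two roots and \<open>D = S - S'\<close>, then \<open>S D + D S' = 0\<close>, so that
  \<open>tr (D (S + S') D) = 0\<close>.\<close>

lemma sym_posdef_sqrt_unique:
  fixes S S' :: "real^'n^'n"
  assumes S: "sym_posdef S" and S': "sym_posdef S'" and eq: "S ** S = S' ** S'"
  shows "S = S'"
proof -
  define D where "D = S - S'"
  have Dt: "transpose D = D"
    using S S' by (simp add: D_def sym_posdef_def transpose_def vec_eq_iff)
  have "S ** D + D ** S' = S ** S - S' ** S'"
    by (simp add: D_def matrix_eq matrix_vector_mult_add_rdistrib matrix_vector_mult_diff_rdistrib
        matrix_vector_mul_assoc[symmetric] matrix_vector_mult_diff_distrib)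
  then have "D ** (S ** D) + D ** (D ** S') = 0"
    using eq by (simp add: matrix_add_ldistrib[symmetric] times0_right)
  moreover have "trace (D ** (D ** S')) = trace (D ** (S' ** D))"
    by (metis trace_mul_sym matrix_mul_assoc)
  ultimately have tr: "trace (D ** (S ** D)) + trace (D ** (S' ** D)) = 0"
    by (metis trace_add trace_0 mat_0)
  \<comment> \<open>As \<open>D\<close> is symmetric, the trace is the sum of the form of
    \<open>Q\<close> over the columns of \<open>D\<close>. Both traces are then non-negative, hence
    zero, and definiteness of \<open>S\<close> makes each column vanish.\<close>
  have tr_eq: "trace (D ** (Q ** D)) = (\<Sum>i\<in>UNIV. (D *v axis i 1) \<bullet> (Q *v (D *v axis i 1)))" for Q
    unfolding trace_def inner_axis_matrix[symmetric]
    by (simp add: matrix_vector_mul_assoc[symmetric]) (metis Dt inner_commute transpose_inner)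
  have nn: "(D *v axis i 1) \<bullet> (Q *v (D *v axis i 1)) \<ge> 0" if "sym_posdef Q" for Q i
    using sym_posdef_posD[OF that, of "D *v axis i 1"] by (cases "D *v axis i 1 = 0") auto
  have "trace (D ** (S ** D)) = 0"
  proof -
    have "trace (D ** (S ** D)) \<ge> 0" "trace (D ** (S' ** D)) \<ge> 0"
      unfolding tr_eq by (rule sum_nonneg, rule nn, rule S S')+
    then show ?thesis using tr by linarith
  qed
  then have "(D *v axis i 1) \<bullet> (S *v (D *v axis i 1)) = 0" for i
    unfolding tr_eq using nn[OF S] by (simp add: sum_nonneg_eq_0_iff)
  then have D0: "D *v axis i 1 = 0" for i
    using sym_posdef_posD[OF S, of "D *v axis i 1"] by force
  have "D $ i $ j = 0" for i j
    using D0[of j] by (metis inner_axis_matrix inner_zero_right)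
  then have "D = 0" by (simp add: vec_eq_iff)
  then show ?thesis by (simp add: D_def)
qed

text \<open>The constants are the extreme values of the form on the unit sphere. By compactness the
  minimum is attained, so definiteness makes it positive.\<close>

lemma sym_posdef_bounds:
  assumes "sym_posdef (A::real^'n^'n)"
  shows "\<exists>m c. 0 < m \<and> m \<le> c \<and> (\<forall>x. m * (x \<bullet> x) \<le> x \<bullet> (A *v x) \<and> x \<bullet> (A *v x) \<le> c * (x \<bullet> x))"
proof -
  have cont: "continuous_on (sphere (0::real^'n) 1) (\<lambda>x. x \<bullet> (A *v x))"
    by (intro continuous_intros)
  have ne: "sphere (0::real^'n) 1 \<noteq> {}" by simp
  obtain a where a: "a \<in> sphere 0 1" "\<And>y. y \<in> sphere 0 1 \<Longrightarrow> a \<bullet> (A *v a) \<le> y \<bullet> (A *v y)"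
    using continuous_attains_inf[OF compact_sphere ne cont] by blast
  obtain b where b: "b \<in> sphere 0 1" "\<And>y. y \<in> sphere 0 1 \<Longrightarrow> y \<bullet> (A *v y) \<le> b \<bullet> (A *v b)"
    using continuous_attains_sup[OF compact_sphere ne cont] by blast
  have "a \<noteq> 0" using a(1) by auto
  then have pos: "a \<bullet> (A *v a) > 0" using assms by (simp add: sym_posdef_def)
  have "(a \<bullet> (A *v a)) * (x \<bullet> x) \<le> x \<bullet> (A *v x) \<and> x \<bullet> (A *v x) \<le> (b \<bullet> (A *v b)) * (x \<bullet> x)" for x
  proof (cases "x = 0")
    case False
    define y where "y = x /\<^sub>R norm x"
    have x: "x = norm x *\<^sub>R y" using False by (simp add: y_def)
    have y: "y \<in> sphere 0 1" using False by (simp add: y_def)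
    have "x \<bullet> (A *v x) = (norm x)\<^sup>2 * (y \<bullet> (A *v y))"
      by (subst x, subst (2) x) (simp add: matrix_vector_mult_scaleR power2_eq_square)
    then show ?thesis
      using a(2)[OF y] b(2)[OF y]
      by (simp add: power2_norm_eq_inner[symmetric] mult_left_mono mult.commute[of "(norm x)\<^sup>2"] mult_right_mono)
  qed simp
  with pos a b show ?thesis by blast
qed

text \<open>Cauchy-Schwarz for the semidefinite form \<open>x' E y\<close>, taken at
  \<open>x = E y\<close>, gives \<open>|E y|^4 <= \<rho>^2 |E y|^2 |y|^2\<close>.\<close>

lemma psd_blinfun_norm_le:
  fixes E :: "(real^'n) \<Rightarrow>\<^sub>L (real^'n)"
  assumes sym: "\<And>x y. blinfun_apply E x \<bullet> y = x \<bullet> blinfun_apply E y"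
    and nn: "\<And>x. 0 \<le> x \<bullet> blinfun_apply E x" and le: "\<And>x. x \<bullet> blinfun_apply E x \<le> \<rho> * (x \<bullet> x)"
  shows "norm E \<le> \<rho>"
proof -
  obtain e :: "real^'n" where e: "norm e = 1"
    using vector_choose_size[of 1] by auto
  then have "e \<bullet> e = 1" by (simp add: norm_eq_1)
  with nn[of e] le[of e] have "0 \<le> \<rho>" by simp
  have cs: "(x \<bullet> blinfun_apply E y)\<^sup>2 \<le> (x \<bullet> blinfun_apply E x) * (y \<bullet> blinfun_apply E y)" for x y
  proof -
    have "(x + t *\<^sub>R y) \<bullet> blinfun_apply E (x + t *\<^sub>R y) =
        x \<bullet> blinfun_apply E x + 2 * t * (x \<bullet> blinfun_apply E y) + t\<^sup>2 * (y \<bullet> blinfun_apply E y)" for t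
      by (simp add: blinfun.add_right blinfun.scaleR_right inner_add_left inner_add_right power2_eq_square)
        (use sym[of y x] in \<open>simp add: inner_commute algebra_simps\<close>)
    then have q: "0 \<le> x \<bullet> blinfun_apply E x + 2 * t * (x \<bullet> blinfun_apply E y) + t\<^sup>2 * (y \<bullet> blinfun_apply E y)" for t
      by (metis nn)
    let ?b = "x \<bullet> blinfun_apply E y" and ?a = "x \<bullet> blinfun_apply E x" and ?c = "y \<bullet> blinfun_apply E y"
    show ?thesis
    proof (cases "?c = 0")
      case True
      \<comment> \<open>The form may be degenerate. Then the polynomial in \<open>t\<close> is
        affine, and unless its slope vanishes the chosen \<open>t\<close> gives it the value
        -1.\<close>
      have "?b = 0"
      proof (rule ccontr)
        assume "?b \<noteq> 0"
        then show False using q[of "- (?a + 1) / (2 * ?b)"] True by (simp add: field_simps)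
      qed
      then show ?thesis using True by simp
    next
      case False
      then have c: "?c > 0" using nn[of y] by linarith
      have "0 \<le> ?a - ?b\<^sup>2 / ?c"
        using q[of "- ?b / ?c"] c by (simp add: field_simps power2_eq_square)
      then show ?thesis using c by (simp add: field_simps)
    qed
  qed
  have "norm (blinfun_apply E y) \<le> \<rho> * norm y" for y
  proof (cases "blinfun_apply E y = 0")
    case False
    let ?z = "blinfun_apply E y"
    have "(?z \<bullet> ?z)\<^sup>2 \<le> (?z \<bullet> blinfun_apply E ?z) * (y \<bullet> blinfun_apply E y)"
      using cs[of ?z y] .
    also have "\<dots> \<le> (\<rho> * (?z \<bullet> ?z)) * (\<rho> * (y \<bullet> y))"
      using le[of ?z] le[of y] nn[of ?z] nn[of y] \<open>0 \<le> \<rho>\<close> by (intro mult_mono) auto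
    finally have "(?z \<bullet> ?z) * (?z \<bullet> ?z) \<le> (?z \<bullet> ?z) * (\<rho>\<^sup>2 * (y \<bullet> y))"
      by (simp add: power2_eq_square algebra_simps)
    then have "?z \<bullet> ?z \<le> \<rho>\<^sup>2 * (y \<bullet> y)"
      using False by (simp add: mult_le_cancel_left_pos)
    then have "(norm ?z)\<^sup>2 \<le> (\<rho> * norm y)\<^sup>2"
      by (simp add: power2_norm_eq_inner power_mult_distrib)
    then show ?thesis
      by (rule power2_le_imp_le) (use \<open>0 \<le> \<rho>\<close> in simp)
  qed (use \<open>0 \<le> \<rho>\<close> in simp)
  then show ?thesis
    using norm_blinfun_bound[OF \<open>0 \<le> \<rho>\<close>] by blast
qed

text \<open>After scaling, \<open>A = I - E\<close> with \<open>0 \<le> E \<le> \<rho> I\<close> and \<open>\<rho> < 1\<close>; the root is \<open>I - X\<close> where \<open>X\<close> is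
  the fixed point of the contraction \<open>X \<mapsto> (E + X X) / 2\<close> of the ball of radius \<open>\<rho>\<close>.\<close>

lemma sym_posdef_sqrt_exists:
  fixes A :: "real^'n^'n"
  assumes A: "sym_posdef A"
  shows "\<exists>S. sym_posdef S \<and> S ** S = A"
proof -
  obtain m c where mc: "0 < m" "m \<le> c"
    and lo: "\<And>x. m * (x \<bullet> x) \<le> x \<bullet> (A *v x)" and up: "\<And>x. x \<bullet> (A *v x) \<le> c * (x \<bullet> x)"
    using sym_posdef_bounds[OF A] by blast
  then have c: "c > 0" by linarith
  \<comment> \<open>For \<open>E = I - A / c\<close>, the bounds \<open>m\<close> and
    \<open>c\<close> on the form of \<open>A\<close> place the form of \<open>E\<close> between 0
    and \<open>1 - m / c\<close>.\<close>
  define \<rho> where "\<rho> = 1 - m / c"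
  have \<rho>: "0 \<le> \<rho>" "\<rho> < 1" using mc c by (auto simp: \<rho>_def)
  define E where "E = Blinfun (\<lambda>x. x - (1 / c) *\<^sub>R (A *v x))"
  have E: "blinfun_apply E x = x - (1 / c) *\<^sub>R (A *v x)" for x
    unfolding E_def by (subst bounded_linear_Blinfun_apply) (auto intro!: bounded_linear_intros)
  have nE: "norm E \<le> \<rho>"
  proof (rule psd_blinfun_norm_le)
    fix x y
    show "blinfun_apply E x \<bullet> y = x \<bullet> blinfun_apply E y"
      using sym_posdef_inner_sym[OF A, of x y]
      by (simp add: E inner_diff_left inner_diff_right inner_commute)
    have *: "x \<bullet> blinfun_apply E x = x \<bullet> x - (x \<bullet> (A *v x)) / c"
      by (simp add: E inner_diff_right)
    have "(x \<bullet> (A *v x)) / c \<le> x \<bullet> x" "(m / c) * (x \<bullet> x) \<le> (x \<bullet> (A *v x)) / c"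
      using up[of x] lo[of x] c by (auto simp: field_simps)
    then show "0 \<le> x \<bullet> blinfun_apply E x" "x \<bullet> blinfun_apply E x \<le> \<rho> * (x \<bullet> x)"
      unfolding * \<rho>_def by (auto simp: algebra_simps)
  qed
  \<comment> \<open>Symmetry is built into the complete set, so the fixed point inherits it. The map
    preserves the ball because \<open>(\<rho> + \<rho>^2) / 2 <= \<rho>\<close>.\<close>
  define K where "K = cball 0 \<rho> \<inter> {X :: (real^'n) \<Rightarrow>\<^sub>L (real^'n). \<forall>x y. blinfun_apply X x \<bullet> y = x \<bullet> blinfun_apply X y}"
  define F where "F X = (1 / 2) *\<^sub>R (E + (X o\<^sub>L X))" for X
  have "closed {X :: (real^'n) \<Rightarrow>\<^sub>L (real^'n). \<forall>x y. blinfun_apply X x \<bullet> y = x \<bullet> blinfun_apply X y}"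
    by (intro closed_Collect_all closed_Collect_eq continuous_intros)
  then have "closed K"
    unfolding K_def by (intro closed_Int closed_cball)
  moreover have "K \<noteq> {}"
  proof -
    have "0 \<in> K" using \<rho> by (simp add: K_def)
    then show ?thesis by blast
  qed
  moreover have "F ` K \<subseteq> K"
  proof safe
    fix X assume "X \<in> K"
    then have nX: "norm X \<le> \<rho>" and sX: "\<And>x y. blinfun_apply X x \<bullet> y = x \<bullet> blinfun_apply X y"
      by (auto simp: K_def)
    have "norm (X o\<^sub>L X) \<le> norm X * norm X" by (rule norm_blinfun_compose)
    also have "\<dots> \<le> \<rho> * 1" using nX \<rho> by (intro mult_mono) auto
    finally have "norm (F X) \<le> \<rho>"
      using norm_triangle_ineq[of E "X o\<^sub>L X"] nE by (simp add: F_def)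
    moreover have "blinfun_apply (F X) x \<bullet> y = x \<bullet> blinfun_apply (F X) y" for x y
      using sym_posdef_inner_sym[OF A, of x y] sX[of x "blinfun_apply X y"] sX[of "blinfun_apply X x" y]
      by (simp add: F_def blinfun.scaleR_left blinfun.add_left E inner_add_left inner_add_right
          inner_diff_left inner_diff_right inner_commute)
    ultimately show "F X \<in> K" by (auto simp: K_def)
  qed
  moreover have "dist (F X) (F Y) \<le> \<rho> * dist X Y" if "X \<in> K" "Y \<in> K" for X Y
  proof -
    have n: "norm X \<le> \<rho>" "norm Y \<le> \<rho>" using that by (auto simp: K_def)
    have eq: "F X - F Y = (1 / 2) *\<^sub>R ((X o\<^sub>L (X - Y)) + ((X - Y) o\<^sub>L Y))"
      by (rule blinfun_eqI)
        (simp add: F_def blinfun.scaleR_left blinfun.add_left blinfun.diff_left blinfun.diff_right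
          scaleR_right_diff_distrib scaleR_right_distrib)
    have "norm ((X o\<^sub>L (X - Y)) + ((X - Y) o\<^sub>L Y)) \<le> norm X * norm (X - Y) + norm (X - Y) * norm Y"
      by (intro order_trans[OF norm_triangle_ineq] add_mono norm_blinfun_compose)
    also have "\<dots> \<le> \<rho> * norm (X - Y) + norm (X - Y) * \<rho>"
      using n by (intro add_mono mult_left_mono mult_right_mono) auto
    finally show ?thesis
      unfolding dist_norm eq by simp
  qed
  ultimately have "\<exists>!X. X \<in> K \<and> F X = X"
    using Banach_fix[of K \<rho> F] \<rho> complete_eq_closed[of K] by blast
  then obtain X where X: "X \<in> K" "F X = X" by blast
  have nX: "norm X \<le> \<rho>" and sX: "\<And>x y. blinfun_apply X x \<bullet> y = x \<bullet> blinfun_apply X y"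
    using X(1) by (auto simp: K_def)
  \<comment> \<open>The fixed point satisfies \<open>2 X = E + X X\<close>, hence
    \<open>(I - X)^2 = I - 2 X + X X = I - E = A / c\<close>; the factor \<open>sqrt c\<close>
    undoes the scaling.\<close>
  define S where "S = matrix (\<lambda>x. sqrt c *\<^sub>R (x - blinfun_apply X x))"
  have "bounded_linear (\<lambda>x. sqrt c *\<^sub>R (x - blinfun_apply X x))"
    by (intro bounded_linear_intros)
  then have S: "S *v x = sqrt c *\<^sub>R (x - blinfun_apply X x)" for x
    unfolding S_def by (simp add: matrix_works linear_matrix_vector_mul_eq bounded_linear.linear)
  have fixed: "blinfun_apply X x = (1 / 2) *\<^sub>R (x - (1 / c) *\<^sub>R (A *v x) + blinfun_apply X (blinfun_apply X x))" for x
    using arg_cong[OF X(2), of "\<lambda>Z. blinfun_apply Z x"]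
    by (simp add: F_def blinfun.scaleR_left blinfun.add_left E)
  have "S *v (S *v x) = A *v x" for x
  proof -
    have "S *v (S *v x) = c *\<^sub>R (x - 2 *\<^sub>R blinfun_apply X x + blinfun_apply X (blinfun_apply X x))"
      using c by (simp add: S blinfun.diff_right blinfun.scaleR_right scaleR_right_diff_distrib
          scaleR_right_distrib scaleR_2 algebra_simps)
    also have "2 *\<^sub>R blinfun_apply X x = x - (1 / c) *\<^sub>R (A *v x) + blinfun_apply X (blinfun_apply X x)"
      by (subst fixed) simp
    finally show ?thesis using c by simp
  qed
  then have SS: "S ** S = A"
    by (simp add: matrix_eq matrix_vector_mul_assoc[symmetric])
  have "x \<bullet> (transpose S *v y) = x \<bullet> (S *v y)" for x y
    using transpose_inner[of S y x] sX[of x y]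
    by (simp add: S inner_diff_left inner_diff_right inner_commute)
  then have "transpose S = S"
    by (metis matrix_eq vector_eq_ldot)
  \<comment> \<open>The ball has radius below 1, so \<open>x' X x < |x|^2\<close> for non-zero
    \<open>x\<close>: the contraction selects the positive root.\<close>
  moreover have "x \<bullet> (S *v x) > 0" if "x \<noteq> 0" for x
  proof -
    have "x \<bullet> blinfun_apply X x \<le> norm x * norm (blinfun_apply X x)"
      by (rule norm_cauchy_schwarz)
    also have "\<dots> \<le> norm x * (norm X * norm x)"
      by (intro mult_left_mono norm_blinfun) auto
    also have "\<dots> \<le> norm x * (\<rho> * norm x)"
      using nX by (intro mult_left_mono mult_right_mono) auto
    also have "\<dots> < x \<bullet> x"
      using \<rho> that by (simp add: power2_norm_eq_inner[symmetric] power2_eq_square mult.left_commute)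
    finally show ?thesis
      using c by (simp add: S inner_diff_right)
  qed
  ultimately show ?thesis
    using SS by (auto simp: sym_posdef_def)
qed

lemma mat_sqrt:
  assumes "sym_posdef A"
  shows "sym_posdef (mat_sqrt A)" "mat_sqrt A ** mat_sqrt A = A"
proof -
  have "\<exists>!S. sym_posdef S \<and> S ** S = A"
    using sym_posdef_sqrt_exists[OF assms] sym_posdef_sqrt_unique by metis
  from theI'[OF this] show "sym_posdef (mat_sqrt A)" "mat_sqrt A ** mat_sqrt A = A"
    unfolding mat_sqrt_def by blast+
qed

section \<open>Singular pairs\<close>

lemma singular_pair_transpose:
  "singular_pair R \<sigma> u v \<Longrightarrow> singular_pair (transpose R) \<sigma> v u"
  by (auto simp: singular_pair_def)

text \<open>Both are eigenvectors of the symmetric matrix \<open>R' R\<close>, with eigenvalues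
  \<open>\<sigma>^2\<close> and \<open>\<tau>^2\<close>; the sign conditions keep these squares
  distinct.\<close>

lemma singular_vectors_orthogonal:
  fixes R :: "real^'q^'p"
  assumes "singular_pair R \<sigma> u v" "singular_pair R \<tau> u' v'" "0 \<le> \<sigma>" "0 \<le> \<tau>" "\<sigma> \<noteq> \<tau>"
  shows "v \<bullet> v' = 0"
proof -
  have RR: "transpose R *v (R *v v) = \<sigma>\<^sup>2 *\<^sub>R v" "transpose R *v (R *v v') = \<tau>\<^sup>2 *\<^sub>R v'"
    using assms(1,2) by (simp_all add: singular_pair_def matrix_vector_mult_scaleR power2_eq_square)
  have "\<sigma>\<^sup>2 * (v \<bullet> v') = (R *v v) \<bullet> (R *v v')"
    using transpose_inner[of R "R *v v" v'] RR(1) by simp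
  also have "\<dots> = \<tau>\<^sup>2 * (v \<bullet> v')"
    using transpose_inner[of R "R *v v'" v] RR(2) by (simp add: inner_commute)
  finally have "(\<sigma>\<^sup>2 - \<tau>\<^sup>2) * (v \<bullet> v') = 0" by (simp add: algebra_simps)
  moreover have "\<sigma>\<^sup>2 \<noteq> \<tau>\<^sup>2"
    using assms(3-5) by (simp add: power2_eq_iff)
  ultimately show ?thesis by simp
qed

text \<open>The rank makes the \<open>v0 k\<close> an orthonormal basis of the row space. With
  \<open>b = sum \<beta>_k v0_k + b1\<close> and \<open>R b1 = 0\<close>, the hypothesis
  \<open>ge\<close> and \<open>|b| = 1\<close> combine to \<open>sum (\<sigma>_j^2 - \<sigma>_k^2)
  \<beta>_k^2 + \<sigma>_j^2 |b1|^2 <= 0\<close>. No term is negative, as those with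
  \<open>k < j\<close> vanish by orthogonality; strict decrease and \<open>\<sigma>_j > 0\<close>
  then leave only \<open>\<beta>_j\<close>.\<close>

lemma singular_vector_attained:
  fixes R :: "real^'q^'p"
  assumes rank: "rank R = d"
    and pairs: "\<And>k. k \<in> {1..d} \<Longrightarrow> \<sigma> k > 0 \<and> singular_pair R (\<sigma> k) (u0 k) (v0 k)"
    and decreasing: "\<And>i k. i \<in> {1..d} \<Longrightarrow> k \<in> {1..d} \<Longrightarrow> i < k \<Longrightarrow> \<sigma> k < \<sigma> i"
    and j: "j \<in> {1..d}" and b: "norm b = 1"
    and orth: "\<And>k. k \<in> {1..<j} \<Longrightarrow> v0 k \<bullet> b = 0"
    and ge: "(\<sigma> j)\<^sup>2 \<le> (norm (R *v b))\<^sup>2"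
  shows "b = v0 j \<or> b = - v0 j"
proof -
  note sp = pairs[unfolded singular_pair_def]
  have v1: "v0 k \<bullet> v0 k = 1" if "k \<in> {1..d}" for k
    using sp[OF that] by (simp add: norm_eq_1)
  have RR: "transpose R *v (R *v v0 k) = (\<sigma> k)\<^sup>2 *\<^sub>R v0 k" if "k \<in> {1..d}" for k
    using sp[OF that] by (simp add: matrix_vector_mult_scaleR power2_eq_square)
  have o: "v0 k \<bullet> v0 l = 0" if kl: "k \<in> {1..d}" "l \<in> {1..d}" "k \<noteq> l" for k l
  proof -
    have "\<sigma> k \<noteq> \<sigma> l"
      using decreasing[of k l] decreasing[of l k] kl by (metis less_irrefl nat_neq_iff)
    then show ?thesis
      using singular_vectors_orthogonal[of R "\<sigma> k" "u0 k" "v0 k" "\<sigma> l" "u0 l" "v0 l"] pairs[OF kl(1)] pairs[OF kl(2)]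
      by (simp add: less_imp_le)
  qed
  let ?V = "v0 ` {1..d}"
  have inj: "inj_on v0 {1..d}"
    using o v1 by (metis inj_onI zero_neq_one)
  have "pairwise orthogonal ?V"
    using o by (auto intro!: pairwise_imageI simp: orthogonal_def)
  moreover have "0 \<notin> ?V" using v1 by force
  ultimately have ind: "independent ?V" by (rule pairwise_orthogonal_independent)
  have sub: "?V \<subseteq> range ((*v) (transpose R))"
  proof safe
    fix k assume k: "k \<in> {1..d}"
    have "v0 k = transpose R *v ((1 / (\<sigma> k)) *\<^sub>R u0 k)"
      using sp[OF k] by (simp add: matrix_vector_mult_scaleR)
    then show "v0 k \<in> range ((*v) (transpose R))" by blast
  qed
  have "dim (range ((*v) (transpose R))) = card ?V"
    using rank unfolding rank_dim_range[symmetric] card_image[OF inj] by (simp add: rank_transpose)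
  then have span: "range ((*v) (transpose R)) \<subseteq> span ?V"
    using card_ge_dim_independent[OF sub ind] by simp
  define \<beta> where "\<beta> k = v0 k \<bullet> b" for k
  define b1 where "b1 = b - (\<Sum>k\<in>{1..d}. \<beta> k *\<^sub>R v0 k)"
  have b1v: "v0 l \<bullet> b1 = 0" if l: "l \<in> {1..d}" for l
  proof -
    have "(\<Sum>k\<in>{1..d}. \<beta> k * (v0 l \<bullet> v0 k)) = (\<Sum>k\<in>{1..d}. if k = l then \<beta> l else 0)"
      using o[OF l] v1[OF l] by (intro sum.cong) auto
    then show ?thesis
      using l by (simp add: b1_def inner_diff_right inner_sum_right \<beta>_def)
  qed
  have "x \<bullet> b1 = 0" if "x \<in> span ?V" for x
    using that by (rule span_induct_alt) (auto simp: inner_add_left b1v)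
  \<comment> \<open>\<open>R' R b1\<close> lies in the row space, to which \<open>b1\<close> is
    orthogonal; the inner product is \<open>|R b1|^2\<close>.\<close>
  then have "(transpose R *v (R *v b1)) \<bullet> b1 = 0"
    using span by blast
  then have Rb1: "R *v b1 = 0"
    unfolding transpose_inner by simp
  have b_eq: "b = b1 + (\<Sum>k\<in>{1..d}. \<beta> k *\<^sub>R v0 k)" by (simp add: b1_def)
  have lin: "linear (\<lambda>x. transpose R *v (R *v x))"
    using linear_compose[OF matrix_vector_mul_linear matrix_vector_mul_linear] by (simp only: o_def)
  have "transpose R *v (R *v b) = (\<Sum>k\<in>{1..d}. \<beta> k *\<^sub>R ((\<sigma> k)\<^sup>2 *\<^sub>R v0 k))"
    by (subst b_eq) (simp only: linear_add[OF lin] linear_sum[OF lin] linear_scale[OF lin] Rb1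
        matrix_vector_mult_0_right add_0_left RR cong: sum.cong)
  then have "(transpose R *v (R *v b)) \<bullet> b = (\<Sum>k\<in>{1..d}. (\<sigma> k)\<^sup>2 * (\<beta> k)\<^sup>2)"
    by (simp only: inner_sum_left inner_scaleR_left \<beta>_def power2_eq_square mult_ac)
  then have Rb: "(norm (R *v b))\<^sup>2 = (\<Sum>k\<in>{1..d}. (\<sigma> k)\<^sup>2 * (\<beta> k)\<^sup>2)"
    unfolding power2_norm_eq_inner transpose_inner .
  have "b1 \<bullet> b1 = b \<bullet> b1"
    using arg_cong[OF b_eq, of "\<lambda>x. x \<bullet> b1"] b1v by (simp add: inner_add_left inner_sum_left)
  also have "\<dots> = 1 - (\<Sum>k\<in>{1..d}. (\<beta> k)\<^sup>2)"
    using b by (simp add: b1_def inner_diff_right inner_sum_right norm_eq_1 \<beta>_def power2_eq_square inner_commute)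
  finally have nb1: "b1 \<bullet> b1 = 1 - (\<Sum>k\<in>{1..d}. (\<beta> k)\<^sup>2)" .
  have \<sigma>j: "\<sigma> j > 0" using sp[OF j] by simp
  have nn: "((\<sigma> j)\<^sup>2 - (\<sigma> k)\<^sup>2) * (\<beta> k)\<^sup>2 \<ge> 0" if k: "k \<in> {1..d}" for k
  proof (cases "k < j")
    case True
    then show ?thesis using orth k by (simp add: \<beta>_def)
  next
    case False
    then have "\<sigma> k \<le> \<sigma> j" using decreasing[OF j k] by (cases "k = j") auto
    then show ?thesis using sp[OF k] by (simp add: power_mono)
  qed
  have sum0: "(\<Sum>k\<in>{1..d}. ((\<sigma> j)\<^sup>2 - (\<sigma> k)\<^sup>2) * (\<beta> k)\<^sup>2) + (\<sigma> j)\<^sup>2 * (b1 \<bullet> b1) \<le> 0"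
    using ge unfolding Rb nb1 by (simp add: algebra_simps sum_subtractf sum_distrib_left)
  moreover have "(\<Sum>k\<in>{1..d}. ((\<sigma> j)\<^sup>2 - (\<sigma> k)\<^sup>2) * (\<beta> k)\<^sup>2) \<ge> 0"
    by (rule sum_nonneg) (rule nn)
  moreover have "(\<sigma> j)\<^sup>2 * (b1 \<bullet> b1) \<ge> 0" by simp
  ultimately have "(\<sigma> j)\<^sup>2 * (b1 \<bullet> b1) = 0"
    and z: "(\<Sum>k\<in>{1..d}. ((\<sigma> j)\<^sup>2 - (\<sigma> k)\<^sup>2) * (\<beta> k)\<^sup>2) = 0" by linarith+
  then have b10: "b1 = 0" using \<sigma>j by simp
  have "\<beta> k = 0" if k: "k \<in> {1..d}" "k \<noteq> j" for k
  proof (cases "k < j")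
    case True
    then show ?thesis using orth k by (simp add: \<beta>_def)
  next
    case False
    then have "\<sigma> k < \<sigma> j" using decreasing[OF j k(1)] k(2) by auto
    then have "(\<sigma> k)\<^sup>2 < (\<sigma> j)\<^sup>2" using sp[OF k(1)] by (intro power_strict_mono) auto
    moreover have "((\<sigma> j)\<^sup>2 - (\<sigma> k)\<^sup>2) * (\<beta> k)\<^sup>2 = 0"
      by (rule sum_nonneg_0[OF _ nn z k(1)]) auto
    ultimately show ?thesis by simp
  qed
  then have "(\<Sum>k\<in>{1..d}. \<beta> k *\<^sub>R v0 k) = (\<Sum>k\<in>{1..d}. if k = j then \<beta> j *\<^sub>R v0 j else 0)"
    by (intro sum.cong) auto
  then have bj: "b = \<beta> j *\<^sub>R v0 j"
    using b_eq b10 j by simp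
  then have "\<bar>\<beta> j\<bar> = 1"
    using b sp[OF j] by (metis mult.right_neutral norm_scaleR)
  then have "\<beta> j = 1 \<or> \<beta> j = -1" by linarith
  then show ?thesis using bj by auto
qed

section \<open>Limits of the sample indices\<close>

text \<open>By Cramer's rule the entries of the inverse are quotients of determinants, hence
  continuous where the determinant is non-zero. Along the filter that holds eventually, because the
  limit is invertible.\<close>

lemma tendsto_matrix_inv:
  fixes C :: "'b \<Rightarrow> real^'n^'n"
  assumes C: "(C \<longlongrightarrow> C0) F" and inv: "invertible C0"
  shows "((\<lambda>n. matrix_inv (C n)) \<longlongrightarrow> matrix_inv C0) F"
proof -
  have det_lim: "((\<lambda>n. det (E n)) \<longlongrightarrow> det E0) F"
    if "\<And>i j. ((\<lambda>n. E n $ i $ j) \<longlongrightarrow> E0 $ i $ j) F" for E :: "'b \<Rightarrow> real^'n^'n" and E0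
    unfolding det_def by (intro tendsto_intros that)
  have entries: "((\<lambda>n. C n $ i $ j) \<longlongrightarrow> C0 $ i $ j) F" for i j
    by (intro tendsto_intros C)
  have d0: "det C0 \<noteq> 0" using inv by (simp add: invertible_det_nz)
  have inv_entry: "matrix_inv E $ i $ j =
      det (\<chi> k l. if l = i then axis j 1 $ k else E $ k $ l) / det E" if "det E \<noteq> 0"
    for E :: "real^'n^'n" and i j
  proof -
    have "E *v (matrix_inv E *v axis j 1) = axis j 1"
      using that by (simp add: matrix_vector_mul_assoc matrix_inv_mult invertible_det_nz)
    then have "matrix_inv E *v axis j 1 =
        (\<chi> i. det (\<chi> k l. if l = i then axis j 1 $ k else E $ k $ l) / det E)"
      using cramer[OF that] by blast
    then have "(matrix_inv E *v axis j 1) $ i =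
        det (\<chi> k l. if l = i then axis j 1 $ k else E $ k $ l) / det E" by simp
    then show ?thesis by (simp add: matrix_vector_mult_basis column_def)
  qed
  have "\<forall>\<^sub>F n in F. det (C n) \<noteq> 0"
    using tendsto_imp_eventually_ne[OF det_lim[OF entries] d0] .
  then have ev: "\<forall>\<^sub>F n in F. det (\<chi> k l. if l = i then axis j 1 $ k else C n $ k $ l) / det (C n) =
      matrix_inv (C n) $ i $ j" for i j
    by eventually_elim (simp add: inv_entry)
  have "((\<lambda>n. matrix_inv (C n) $ i $ j) \<longlongrightarrow> matrix_inv C0 $ i $ j) F" for i j
    unfolding inv_entry[OF d0]
  proof (rule Lim_transform_eventually[OF _ ev], intro tendsto_divide det_lim entries d0)
    fix k l
    show "((\<lambda>n. (\<chi> k l. if l = i then axis j 1 $ k else C n $ k $ l) $ k $ l) \<longlongrightarrow>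
        (\<chi> k l. if l = i then axis j 1 $ k else C0 $ k $ l) $ k $ l) F"
      using entries[of k l] by (cases "l = i") auto
  qed
  then show ?thesis
    by (intro vec_tendstoI)
qed

text \<open>The additional index carries the constant 1, so that products of four entries are the monomials of
  degree at most four.\<close>

definition entry :: "real^'q^'p \<Rightarrow> ('p \<times> 'q) option \<Rightarrow> real" where
  "entry x e = (case e of None \<Rightarrow> 1 | Some (i, j) \<Rightarrow> x $ i $ j)"

lemma entry_simps[simp]: "entry x None = 1" "entry x (Some (i, j)) = x $ i $ j"
  by (auto simp: entry_def)

definition centered_coeff :: "real^'q^'p \<Rightarrow> real^'p \<Rightarrow> real^'q \<Rightarrow> ('p \<times> 'q) option \<Rightarrow> real" where
  "centered_coeff m u v e = (case e of None \<Rightarrow> - (u \<bullet> (m *v v)) | Some (i, j) \<Rightarrow> u $ i * v $ j)"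

text \<open>Separates what varies with \<open>n\<close> (directions and sample mean, in the
  coefficients) from the data (in the entries). A product of four such forms then averages to a
  finite sum of coefficients times empirical monomials.\<close>

lemma centered_form_eq:
  "u \<bullet> ((x - m) *v v) = (\<Sum>e\<in>UNIV. centered_coeff m u v e * entry x e)"
proof -
  have "(\<Sum>e\<in>UNIV. centered_coeff m u v e * entry x e) =
      centered_coeff m u v None * entry x None
      + (\<Sum>e\<in>UNIV. centered_coeff m u v (Some e) * entry x (Some e))"
    by (simp add: UNIV_option_conv sum.reindex)
  also have "(\<Sum>e\<in>UNIV. centered_coeff m u v (Some e) * entry x (Some e)) =
      (\<Sum>i\<in>UNIV. \<Sum>j\<in>UNIV. u $ i * x $ i $ j * v $ j)"
    by (simp add: sum.cartesian_product centered_coeff_def split_def entry_def mult_ac)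
  also have "\<dots> = u \<bullet> (x *v v)" by (rule inner_matrix_sum[symmetric])
  finally show ?thesis
    by (simp add: centered_coeff_def matrix_vector_mult_diff_rdistrib inner_diff_right)
qed

lemma tendsto_centered_coeff:
  assumes "(m \<longlongrightarrow> m0) F" "(u \<longlongrightarrow> u0) F" "(v \<longlongrightarrow> v0) F"
  shows "((\<lambda>n. centered_coeff (m n) (u n) (v n) e) \<longlongrightarrow> centered_coeff m0 u0 v0 e) F"
proof (cases e)
  case None
  then show ?thesis
    unfolding centered_coeff_def inner_matrix_sum by (auto intro!: tendsto_intros assms)
next
  case (Some p)
  then show ?thesis
    by (cases p) (auto simp: centered_coeff_def intro!: tendsto_intros assms)
qed

lemma product_of_four_sums:
  fixes f1 f2 f3 f4 g :: "'b::finite \<Rightarrow> real"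
  shows "(\<Sum>e\<in>UNIV. f1 e * g e) * (\<Sum>e\<in>UNIV. f2 e * g e) * (\<Sum>e\<in>UNIV. f3 e * g e) * (\<Sum>e\<in>UNIV. f4 e * g e)
    = (\<Sum>((a, b), c, d)\<in>UNIV. (f1 a * f2 b * f3 c * f4 d) * (g a * g b * g c * g d))"
proof -
  have "(\<Sum>e\<in>UNIV. f1 e * g e) * (\<Sum>e\<in>UNIV. f2 e * g e) * (\<Sum>e\<in>UNIV. f3 e * g e) * (\<Sum>e\<in>UNIV. f4 e * g e) =
     (\<Sum>(a, b)\<in>UNIV. (f1 a * g a) * (f2 b * g b)) * (\<Sum>(c, d)\<in>UNIV. (f3 c * g c) * (f4 d * g d))"
    unfolding mult.assoc[of _ "(\<Sum>e\<in>UNIV. f3 e * g e)"]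
    by (simp only: sum_product sum.cartesian_product UNIV_Times_UNIV)
  also have "\<dots> = (\<Sum>((a, b), c, d)\<in>UNIV. (f1 a * f2 b * f3 c * f4 d) * (g a * g b * g c * g d))"
    by (simp only: sum_product sum.cartesian_product UNIV_Times_UNIV)
      (simp add: split_def mult_ac)
  finally show ?thesis .
qed

section \<open>Shift-to-noise ratios and pathwise limits of sample averages\<close>

definition shift_ratio :: "real^'p^'p \<Rightarrow> real^'q^'q \<Rightarrow> real^'q^'p \<Rightarrow> real^'p \<Rightarrow> real^'q \<Rightarrow> real" where
  "shift_ratio A B D u v = (u \<bullet> (D *v v))\<^sup>2 / ((u \<bullet> (A *v u)) * (v \<bullet> (B *v v)))"

text \<open>For positive definite \<open>A\<close> and \<open>B\<close> this is the maximum over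
  \<open>v\<close> of \<open>shift_ratio A B D u v\<close>, by Cauchy-Schwarz for the form of
  \<open>B\<close>; it is attained at \<open>B^{-1} D' u\<close>.\<close>

definition shift_ratio_left :: "real^'p^'p \<Rightarrow> real^'q^'q \<Rightarrow> real^'q^'p \<Rightarrow> real^'p \<Rightarrow> real" where
  "shift_ratio_left A B D u =
    ((transpose D *v u) \<bullet> (matrix_inv B *v (transpose D *v u))) / (u \<bullet> (A *v u))"

text \<open>The sample \<open>x\<close> is one fixed realization; \<open>W\<close> carries the
  population moments to which the empirical ones converge. Moments are prescribed along all
  \<open>u\<close> and \<open>v\<close>, so polarization yields the mixed ones. The last summand of
  \<open>fourth_moment\<close> is that of the two-point shift: weights \<open>\<alpha>1\<close>,
  \<open>\<alpha>2\<close> give \<open>\<alpha>1 \<alpha>2 (\<alpha>1^3 + \<alpha>2^3) = c (1 - 3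
  c)\<close>.\<close>

locale moment_sample = prob_space M for M :: "'a measure" +
  fixes W :: "'a \<Rightarrow> real^'q^'p" and x :: "nat \<Rightarrow> real^'q^'p"
    and A :: "real^'p^'p" and B :: "real^'q^'q" and D :: "real^'q^'p" and c :: real
    and m :: "real^'q^'p"
  assumes integrable_entries: "\<And>e1 e2 e3 e4. integrable M
        (\<lambda>\<omega>. entry (W \<omega>) e1 * entry (W \<omega>) e2 * entry (W \<omega>) e3 * entry (W \<omega>) e4)"
    and lln: "\<And>e1 e2 e3 e4.
        (\<lambda>n. (1 / real n) * (\<Sum>i=1..n. entry (x i) e1 * entry (x i) e2 * entry (x i) e3 * entry (x i) e4))
          \<longlonglongrightarrow> expectation (\<lambda>\<omega>. entry (W \<omega>) e1 * entry (W \<omega>) e2 * entry (W \<omega>) e3 * entry (W \<omega>) e4)"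
    and A: "sym_posdef A" and B: "sym_posdef B" and c: "0 < c" "c < 1 / 6"
    and mean: "\<And>i j. expectation (\<lambda>\<omega>. W \<omega> $ i $ j) = m $ i $ j"
    and second_moment: "\<And>u v. expectation (\<lambda>\<omega>. (u \<bullet> ((W \<omega> - m) *v v))\<^sup>2) =
        (u \<bullet> (A *v u)) * (v \<bullet> (B *v v)) + c * (u \<bullet> (D *v v))\<^sup>2"
    and fourth_moment: "\<And>u v. expectation (\<lambda>\<omega>. (u \<bullet> ((W \<omega> - m) *v v)) ^ 4) =
        3 * ((u \<bullet> (A *v u)) * (v \<bullet> (B *v v)))\<^sup>2
        + 6 * c * ((u \<bullet> (A *v u)) * (v \<bullet> (B *v v))) * (u \<bullet> (D *v v))\<^sup>2
        + c * (1 - 3 * c) * (u \<bullet> (D *v v)) ^ 4"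
begin

lemma integrable_forms:
  "integrable M (\<lambda>\<omega>. (\<Sum>e\<in>UNIV. l1 e * entry (W \<omega>) e) * (\<Sum>e\<in>UNIV. l2 e * entry (W \<omega>) e)
     * (\<Sum>e\<in>UNIV. l3 e * entry (W \<omega>) e) * (\<Sum>e\<in>UNIV. l4 e * entry (W \<omega>) e))"
  unfolding product_of_four_sums split_def
  by (intro Bochner_Integration.integrable_sum integrable_mult_right integrable_entries)

text \<open>The map \<open>r\<close> admits subsequences, along which the compactness arguments run.
  Coefficients may vary with \<open>n\<close> because they stand outside the empirical
  moments.\<close>

lemma average_forms:
  assumes r: "filterlim r at_top sequentially"
    and L: "\<And>e. (\<lambda>n. L1 n e) \<longlonglongrightarrow> l1 e" "\<And>e. (\<lambda>n. L2 n e) \<longlonglongrightarrow> l2 e"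
      "\<And>e. (\<lambda>n. L3 n e) \<longlonglongrightarrow> l3 e" "\<And>e. (\<lambda>n. L4 n e) \<longlonglongrightarrow> l4 e"
  shows "(\<lambda>n. (1 / real (r n)) * (\<Sum>i=1..r n.
       (\<Sum>e\<in>UNIV. L1 n e * entry (x i) e) * (\<Sum>e\<in>UNIV. L2 n e * entry (x i) e)
     * (\<Sum>e\<in>UNIV. L3 n e * entry (x i) e) * (\<Sum>e\<in>UNIV. L4 n e * entry (x i) e)))
   \<longlonglongrightarrow> expectation (\<lambda>\<omega>. (\<Sum>e\<in>UNIV. l1 e * entry (W \<omega>) e) * (\<Sum>e\<in>UNIV. l2 e * entry (W \<omega>) e)
     * (\<Sum>e\<in>UNIV. l3 e * entry (W \<omega>) e) * (\<Sum>e\<in>UNIV. l4 e * entry (W \<omega>) e))"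
proof -
  let ?g = "\<lambda>y ((a, b), c, d). entry y a * entry y b * entry y c * entry y d"
  let ?L = "\<lambda>n ((a, b), c, d). L1 n a * L2 n b * L3 n c * L4 n d"
  let ?l = "\<lambda>((a, b), c, d). l1 a * l2 b * l3 c * l4 d"
  have "(\<lambda>n. \<Sum>E\<in>UNIV. ?L n E * ((1 / real (r n)) * (\<Sum>i=1..r n. ?g (x i) E)))
      \<longlonglongrightarrow> (\<Sum>E\<in>UNIV. ?l E * expectation (\<lambda>\<omega>. ?g (W \<omega>) E))"
  proof (rule tendsto_sum)
    fix E :: "((('p \<times> 'q) option \<times> ('p \<times> 'q) option) \<times> ('p \<times> 'q) option \<times> ('p \<times> 'q) option)"
    obtain a b c d where E: "E = ((a, b), c, d)" by (metis surj_pair)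
    show "(\<lambda>n. ?L n E * ((1 / real (r n)) * (\<Sum>i=1..r n. ?g (x i) E)))
      \<longlonglongrightarrow> ?l E * expectation (\<lambda>\<omega>. ?g (W \<omega>) E)"
      unfolding E split
      by (intro tendsto_mult L filterlim_compose[OF lln r])
  qed
  also have "(\<Sum>E\<in>UNIV. ?l E * expectation (\<lambda>\<omega>. ?g (W \<omega>) E)) =
      expectation (\<lambda>\<omega>. \<Sum>E\<in>UNIV. ?l E * ?g (W \<omega>) E)"
    by (subst Bochner_Integration.integral_sum)
      (auto intro!: integrable_mult_right integrable_entries simp: split_def)
  also have "(\<lambda>n. \<Sum>E\<in>UNIV. ?L n E * ((1 / real (r n)) * (\<Sum>i=1..r n. ?g (x i) E))) =
      (\<lambda>n. (1 / real (r n)) * (\<Sum>i=1..r n. \<Sum>E\<in>UNIV. ?L n E * ?g (x i) E))"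
    by (subst sum.swap) (simp add: sum_distrib_left mult_ac)
  finally show ?thesis
    unfolding product_of_four_sums by (simp add: split_def)
qed

lemma sample_mean_tendsto:
  "(\<lambda>n. (1 / real n) *\<^sub>R (\<Sum>i=1..n. x i)) \<longlonglongrightarrow> m"
proof (intro vec_tendstoI)
  fix i j
  show "(\<lambda>n. ((1 / real n) *\<^sub>R (\<Sum>i=1..n. x i)) $ i $ j) \<longlonglongrightarrow> m $ i $ j"
    using lln[of "Some (i, j)" None None None] by (simp add: mean)
qed

abbreviation form :: "real^'p \<Rightarrow> real^'q \<Rightarrow> 'a \<Rightarrow> real" where
  "form u v \<omega> \<equiv> u \<bullet> ((W \<omega> - m) *v v)"

lemma integrable_form4: "integrable M (\<lambda>\<omega>. form u1 v1 \<omega> * form u2 v2 \<omega> * form u3 v3 \<omega> * form u4 v4 \<omega>)"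
  unfolding centered_form_eq by (rule integrable_forms)

text \<open>The constant 1 is itself a linear form in the extended entries, so a product of two
  forms is a product of four whose last two factors are 1.\<close>

lemma unit_form: "(\<Sum>e\<in>UNIV. of_bool (e = None) * entry y e) = 1"
  by (simp add: UNIV_option_conv sum.reindex)

lemma integrable_form2: "integrable M (\<lambda>\<omega>. form u1 v1 \<omega> * form u2 v2 \<omega>)"
  using integrable_forms[of "centered_coeff m u1 v1" "centered_coeff m u2 v2" "\<lambda>e. of_bool (e = None)" "\<lambda>e. of_bool (e = None)"]
  unfolding centered_form_eq unit_form by simp

lemma average_form4:
  assumes r: "filterlim r at_top sequentially"
    and "u1 \<longlonglongrightarrow> a1" "v1 \<longlonglongrightarrow> b1" "u2 \<longlonglongrightarrow> a2" "v2 \<longlonglongrightarrow> b2"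
    and "u3 \<longlonglongrightarrow> a3" "v3 \<longlonglongrightarrow> b3" "u4 \<longlonglongrightarrow> a4" "v4 \<longlonglongrightarrow> b4"
  shows "(\<lambda>n. (1 / real (r n)) * (\<Sum>i=1..r n.
      (u1 n \<bullet> (centered (r n) x i *v v1 n)) * (u2 n \<bullet> (centered (r n) x i *v v2 n))
      * (u3 n \<bullet> (centered (r n) x i *v v3 n)) * (u4 n \<bullet> (centered (r n) x i *v v4 n))))
    \<longlonglongrightarrow> expectation (\<lambda>\<omega>. form a1 b1 \<omega> * form a2 b2 \<omega> * form a3 b3 \<omega> * form a4 b4 \<omega>)"
  unfolding centered_def centered_form_eq
  by (intro average_forms r tendsto_centered_coeff assms filterlim_compose[OF sample_mean_tendsto r])

lemma average_form2:
  assumes r: "filterlim r at_top sequentially"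
    and "u1 \<longlonglongrightarrow> a1" "v1 \<longlonglongrightarrow> b1" "u2 \<longlonglongrightarrow> a2" "v2 \<longlonglongrightarrow> b2"
  shows "(\<lambda>n. (1 / real (r n)) * (\<Sum>i=1..r n.
      (u1 n \<bullet> (centered (r n) x i *v v1 n)) * (u2 n \<bullet> (centered (r n) x i *v v2 n))))
    \<longlonglongrightarrow> expectation (\<lambda>\<omega>. form a1 b1 \<omega> * form a2 b2 \<omega>)"
proof -
  note lim = average_forms[OF r,
      where ?L3.0 = "\<lambda>_ e. of_bool (e = None)" and ?L4.0 = "\<lambda>_ e. of_bool (e = None)"
        and ?l3.0 = "\<lambda>e. of_bool (e = None)" and ?l4.0 = "\<lambda>e. of_bool (e = None)",
      unfolded unit_form mult_1_right]
  show ?thesis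
    unfolding centered_def centered_form_eq
    by (intro lim tendsto_const tendsto_centered_coeff assms filterlim_compose[OF sample_mean_tendsto r])
qed

text \<open>Polarization \<open>4 a b = (a + b)^2 - (a - b)^2\<close> in the right argument. This
  covariance is the limit of the matrix that is inverted in \<open>psi\<close>.\<close>

lemma covariance_right:
  "expectation (\<lambda>\<omega>. form u y \<omega> * form u z \<omega>)
    = (u \<bullet> (A *v u)) * (y \<bullet> (B *v z)) + c * (u \<bullet> (D *v y)) * (u \<bullet> (D *v z))"
proof -
  have "expectation (\<lambda>\<omega>. form u y \<omega> * form u z \<omega>) =
      expectation (\<lambda>\<omega>. (1 / 4) * (form u (y + z) \<omega> * form u (y + z) \<omega> - form u (y - z) \<omega> * form u (y - z) \<omega>))"
    by (intro Bochner_Integration.integral_cong)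
      (simp_all add: matrix_vector_right_distrib matrix_vector_mult_diff_distrib inner_add_right
        inner_diff_right algebra_simps)
  also have "\<dots> = (1 / 4) * (expectation (\<lambda>\<omega>. form u (y + z) \<omega> * form u (y + z) \<omega>)
      - expectation (\<lambda>\<omega>. form u (y - z) \<omega> * form u (y - z) \<omega>))"
    by (simp only: integral_mult_right_zero Bochner_Integration.integral_diff[OF integrable_form2 integrable_form2])
  also have "\<dots> = (u \<bullet> (A *v u)) * (y \<bullet> (B *v z)) + c * (u \<bullet> (D *v y)) * (u \<bullet> (D *v z))"
    unfolding second_moment[unfolded power2_eq_square] using sym_posdef_inner_sym[OF B, of y z]
    by (simp add: matrix_vector_right_distrib
        matrix_vector_mult_diff_distrib inner_add_right inner_diff_right inner_add_left inner_diff_left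
        power2_eq_square algebra_simps)
  finally show ?thesis .
qed

text \<open>Polarization in the left argument; this covariance is the limit of the constraint
  matrices \<open>G1\<close>.\<close>

lemma covariance_left:
  "expectation (\<lambda>\<omega>. form y v \<omega> * form z v \<omega>)
    = (y \<bullet> (A *v z)) * (v \<bullet> (B *v v)) + c * (y \<bullet> (D *v v)) * (z \<bullet> (D *v v))"
proof -
  have "expectation (\<lambda>\<omega>. form y v \<omega> * form z v \<omega>) =
      expectation (\<lambda>\<omega>. (1 / 4) * (form (y + z) v \<omega> * form (y + z) v \<omega> - form (y - z) v \<omega> * form (y - z) v \<omega>))"
    by (intro Bochner_Integration.integral_cong)
      (simp_all add: inner_add_left inner_diff_left algebra_simps)
  also have "\<dots> = (1 / 4) * (expectation (\<lambda>\<omega>. form (y + z) v \<omega> * form (y + z) v \<omega>)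
      - expectation (\<lambda>\<omega>. form (y - z) v \<omega> * form (y - z) v \<omega>))"
    by (simp only: integral_mult_right_zero Bochner_Integration.integral_diff[OF integrable_form2 integrable_form2])
  also have "\<dots> = (y \<bullet> (A *v z)) * (v \<bullet> (B *v v)) + c * (y \<bullet> (D *v v)) * (z \<bullet> (D *v v))"
    unfolding second_moment[unfolded power2_eq_square] using sym_posdef_inner_sym[OF A, of y z]
    by (simp add: matrix_vector_right_distrib
        matrix_vector_mult_diff_distrib inner_add_right inner_diff_right inner_add_left inner_diff_left
        power2_eq_square algebra_simps)
  finally show ?thesis .
qed

text \<open>In \<open>12 a^2 b^2 = (a + b)^4 + (a - b)^4 - 2 a^4 - 2 b^4\<close> the two signs
  remove the odd mixed terms, so fourth moments of single forms determine this one.\<close>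

lemma mixed_fourth_moment:
  fixes u :: "real^'p" and y z :: "real^'q"
  defines "s \<equiv> u \<bullet> (A *v u)" and "\<delta>y \<equiv> u \<bullet> (D *v y)" and "\<delta>z \<equiv> u \<bullet> (D *v z)"
  defines "byy \<equiv> s * (y \<bullet> (B *v y))" and "bzz \<equiv> s * (z \<bullet> (B *v z))" and "byz \<equiv> s * (y \<bullet> (B *v z))"
  shows "expectation (\<lambda>\<omega>. form u y \<omega> * form u y \<omega> * form u z \<omega> * form u z \<omega>) =
    byy * bzz + 2 * byz\<^sup>2 + c * (byy * \<delta>z\<^sup>2 + bzz * \<delta>y\<^sup>2 + 4 * byz * \<delta>y * \<delta>z)
    + c * (1 - 3 * c) * \<delta>y\<^sup>2 * \<delta>z\<^sup>2"
proof -
  let ?q = "\<lambda>v. (\<lambda>\<omega>. form u v \<omega> ^ 4)"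
  have i4: "integrable M (?q v)" for v
    using integrable_form4[of u v u v u v u v] by (simp add: eval_nat_numeral mult.assoc)
  have pol: "a * a * b * b = (1 / 12) * ((a + b) ^ 4 + (a - b) ^ 4 - 2 * a ^ 4 - 2 * b ^ 4)" for a b :: real
    by algebra
  have "expectation (\<lambda>\<omega>. form u y \<omega> * form u y \<omega> * form u z \<omega> * form u z \<omega>) =
      expectation (\<lambda>\<omega>. (1 / 12) * (?q (y + z) \<omega> + ?q (y - z) \<omega> - 2 * ?q y \<omega> - 2 * ?q z \<omega>))"
    unfolding matrix_vector_right_distrib matrix_vector_mult_diff_distrib inner_add_right
        inner_diff_right by (intro Bochner_Integration.integral_cong refl pol)
  also have "\<dots> = (1 / 12) * (expectation (?q (y + z)) + expectation (?q (y - z))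
      - 2 * expectation (?q y) - 2 * expectation (?q z))"
    by (simp add: i4)
  also have "expectation (?q y) = 3 * byy\<^sup>2 + 6 * c * byy * \<delta>y\<^sup>2 + c * (1 - 3 * c) * \<delta>y ^ 4"
    by (simp add: fourth_moment byy_def s_def \<delta>y_def)
  also have "expectation (?q z) = 3 * bzz\<^sup>2 + 6 * c * bzz * \<delta>z\<^sup>2 + c * (1 - 3 * c) * \<delta>z ^ 4"
    by (simp add: fourth_moment bzz_def s_def \<delta>z_def)
  also have "expectation (?q (y + z)) = 3 * (byy + bzz + 2 * byz)\<^sup>2
      + 6 * c * (byy + bzz + 2 * byz) * (\<delta>y + \<delta>z)\<^sup>2 + c * (1 - 3 * c) * (\<delta>y + \<delta>z) ^ 4"
  proof -
    have "s * ((y + z) \<bullet> (B *v (y + z))) = byy + bzz + 2 * byz" "u \<bullet> (D *v (y + z)) = \<delta>y + \<delta>z"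
      using sym_posdef_inner_sym[OF B, of y z]
      by (auto simp: byy_def bzz_def byz_def \<delta>y_def \<delta>z_def matrix_vector_right_distrib inner_add_left inner_add_right algebra_simps)
    then show ?thesis unfolding fourth_moment s_def[symmetric] by (simp only:)
  qed
  also have "expectation (?q (y - z)) = 3 * (byy + bzz - 2 * byz)\<^sup>2
      + 6 * c * (byy + bzz - 2 * byz) * (\<delta>y - \<delta>z)\<^sup>2 + c * (1 - 3 * c) * (\<delta>y - \<delta>z) ^ 4"
  proof -
    have "s * ((y - z) \<bullet> (B *v (y - z))) = byy + bzz - 2 * byz" "u \<bullet> (D *v (y - z)) = \<delta>y - \<delta>z"
      using sym_posdef_inner_sym[OF B, of y z]
      by (auto simp: byy_def bzz_def byz_def \<delta>y_def \<delta>z_def matrix_vector_mult_diff_distrib inner_diff_left inner_diff_right algebra_simps)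
    then show ?thesis unfolding fourth_moment s_def[symmetric] by (simp only:)
  qed
  finally show ?thesis by (simp add: power2_eq_square power4_eq_xxxx algebra_simps)
qed

section \<open>Kurtosis as a function of the shift-to-noise ratio, and the limit of kappa\<close>

definition kurtosis_excess :: "real \<Rightarrow> real" where
  "kurtosis_excess t = c * (1 - 6 * c) * (t / (1 + c * t))\<^sup>2"

text \<open>Here \<open>c < 1/6\<close> enters, as positivity of \<open>c (1 - 6 c)\<close>. The map
  \<open>t / (1 + c t)\<close> is increasing and non-negative for \<open>t >= 0\<close>, so squaring
  keeps the order.\<close>

lemma kurtosis_excess_le_iff:
  assumes "0 \<le> s" "0 \<le> t"
  shows "kurtosis_excess s \<le> kurtosis_excess t \<longleftrightarrow> s \<le> t"
proof -
  have "0 < 1 + c * s" "0 < 1 + c * t"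
    using assms c by (auto intro!: add_pos_nonneg)
  then have "s / (1 + c * s) \<le> t / (1 + c * t) \<longleftrightarrow> s \<le> t"
    by (simp add: field_simps)
  moreover have "0 \<le> s / (1 + c * s)" "0 \<le> t / (1 + c * t)"
    using assms \<open>0 < 1 + c * s\<close> \<open>0 < 1 + c * t\<close> by auto
  moreover have "0 < c * (1 - 6 * c)" using c by simp
  ultimately show ?thesis
    unfolding kurtosis_excess_def by (simp add: mult_le_cancel_left_pos power_mono_iff)
qed

lemma shift_ratio_nonneg: "0 \<le> shift_ratio A B D u v"
proof -
  have "0 \<le> u \<bullet> (A *v u)" "0 \<le> v \<bullet> (B *v v)"
    using sym_posdef_posD[OF A, of u] sym_posdef_posD[OF B, of v]
    by (cases "u = 0"; cases "v = 0"; force)+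
  then show ?thesis by (simp add: shift_ratio_def)
qed

lemma kappa_tendsto:
  assumes r: "filterlim r at_top sequentially"
    and lim: "u \<longlonglongrightarrow> a" "v \<longlonglongrightarrow> b" and nz: "a \<noteq> 0" "b \<noteq> 0"
  shows "(\<lambda>n. kappa (r n) x (u n) (v n)) \<longlonglongrightarrow> 3 + kurtosis_excess (shift_ratio A B D a b)"
proof -
  define s where "s = (a \<bullet> (A *v a)) * (b \<bullet> (B *v b))"
  define e where "e = (a \<bullet> (D *v b))\<^sup>2"
  have s: "s > 0" using sym_posdef_posD[OF A nz(1)] sym_posdef_posD[OF B nz(2)] by (simp add: s_def)
  have e: "e \<ge> 0" by (simp add: e_def)
  have pos: "s + c * e > 0" using s e c by (simp add: add_pos_nonneg)
  have n4: "(\<lambda>n. (1 / real (r n)) * (\<Sum>i=1..r n. (u n \<bullet> (centered (r n) x i *v v n)) ^ 4))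
      \<longlonglongrightarrow> 3 * s\<^sup>2 + 6 * c * s * e + c * (1 - 3 * c) * e\<^sup>2"
    using average_form4[OF r lim lim lim lim] fourth_moment[of a b]
    by (simp add: power4_eq_xxxx power2_eq_square mult.assoc s_def e_def)
  have n2: "(\<lambda>n. (1 / real (r n)) * (\<Sum>i=1..r n. (u n \<bullet> (centered (r n) x i *v v n)) ^ 2)) \<longlonglongrightarrow> s + c * e"
    using average_form2[OF r lim lim] second_moment[of a b]
    by (simp add: power2_eq_square mult.assoc s_def e_def)
  have "(\<lambda>n. kappa (r n) x (u n) (v n)) \<longlonglongrightarrow>
      (3 * s\<^sup>2 + 6 * c * s * e + c * (1 - 3 * c) * e\<^sup>2) / (s + c * e)\<^sup>2"
    unfolding kappa_def by (intro tendsto_divide tendsto_power n4 n2) (use pos in simp)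
  also have "(3 * s\<^sup>2 + 6 * c * s * e + c * (1 - 3 * c) * e\<^sup>2) / (s + c * e)\<^sup>2 =
      3 + c * (1 - 6 * c) * (e / (s + c * e))\<^sup>2"
  proof -
    \<comment> \<open>Three times the squared variance is split off; the remainder
      \<open>c (1 - 6 c) e^2\<close> is the fourth cumulant of the shift.\<close>
    have "3 * s\<^sup>2 + 6 * c * s * e + c * (1 - 3 * c) * e\<^sup>2 = 3 * (s + c * e)\<^sup>2 + c * (1 - 6 * c) * e\<^sup>2"
      by algebra
    then show ?thesis using pos by (simp add: add_divide_distrib power_divide)
  qed
  also have "e / (s + c * e) = (e / s) / (1 + c * (e / s))"
    using pos s by (simp add: field_simps)
  finally show ?thesis
    by (simp add: kurtosis_excess_def shift_ratio_def s_def e_def)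
qed

section \<open>Limits of the constraint matrices and of psi\<close>

lemma outer_prod_vector: "outer_prod a b *v z = (b \<bullet> z) *\<^sub>R a"
  by (simp add: vec_eq_iff outer_prod_def matrix_vector_mult_def inner_vec_def sum_distrib_left mult_ac)

lemma sum_matrix_vector: "(\<Sum>i\<in>I. F i) *v z = (\<Sum>i\<in>I. F i *v z)" for F :: "'i \<Rightarrow> real^'n^'k"
  by (induction I rule: infinite_finite_induct) (auto simp: matrix_vector_mult_add_rdistrib)

lemma G1_form:
  "y \<bullet> (G1 n x v *v z) =
    (1 / real n) * (\<Sum>i=1..n. (y \<bullet> (centered n x i *v v)) * (z \<bullet> (centered n x i *v v)))"
  unfolding G1_def
  by (simp add: scaleR_matrix_vector_assoc[symmetric] sum_matrix_vector outer_prod_vector inner_sum_right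
      inner_commute mult.commute)

lemma G1_tendsto:
  assumes r: "filterlim r at_top sequentially"
    and lim: "y \<longlonglongrightarrow> y0" "u \<longlonglongrightarrow> a" "v \<longlonglongrightarrow> b"
  shows "(\<lambda>n. y n \<bullet> (G1 (r n) x (v n) *v u n)) \<longlonglongrightarrow>
    (y0 \<bullet> (A *v a)) * (b \<bullet> (B *v b)) + c * (y0 \<bullet> (D *v b)) * (a \<bullet> (D *v b))"
  unfolding G1_form covariance_left[symmetric] by (intro average_form2 r lim)

lemma form_transpose: "(transpose (W \<omega> - m) *v u) \<bullet> y = form u y \<omega>"
  by (rule transpose_inner)

text \<open>With \<open>w = (W - m)' u\<close> and \<open>C = E w w'\<close>, the inverse is \<open>S S\<close> for some symmetric \<open>S\<close>, so that
  \<open>w' C\<^sup>-\<^sup>1 w\<close> is the sum of squares of the coordinates of \<open>S w\<close>, whose covariance is the identity.\<close>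

lemma mardia_expectation:
  fixes u :: "real^'p" and C :: "real^'q^'q"
  assumes u: "u \<noteq> 0"
    and C: "\<And>y z. y \<bullet> (C *v z) = (u \<bullet> (A *v u)) * (y \<bullet> (B *v z)) + c * (u \<bullet> (D *v y)) * (u \<bullet> (D *v z))"
  defines "\<delta> \<equiv> transpose D *v u"
  shows "sym_posdef C"
    and "expectation (\<lambda>\<omega>. ((transpose (W \<omega> - m) *v u) \<bullet> (matrix_inv C *v (transpose (W \<omega> - m) *v u)))\<^sup>2) =
      (real CARD('q))\<^sup>2 + 2 * real CARD('q) + kurtosis_excess ((\<delta> \<bullet> (matrix_inv B *v \<delta>)) / (u \<bullet> (A *v u)))"
proof -
  define s where "s = u \<bullet> (A *v u)"
  have s: "s > 0" unfolding s_def by (rule sym_posdef_posD[OF A u])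
  have Cd: "y \<bullet> (C *v z) = s * (y \<bullet> (B *v z)) + c * (\<delta> \<bullet> y) * (\<delta> \<bullet> z)" for y z
    unfolding C s_def \<delta>_def transpose_inner ..
  have "x \<bullet> (transpose C *v y) = x \<bullet> (C *v y)" for x y
    using transpose_inner[of C y x] Cd[of x y] Cd[of y x] sym_posdef_inner_sym[OF B, of x y]
    by (simp add: inner_commute)
  then have "transpose C = C"
    by (metis matrix_eq vector_eq_ldot)
  moreover have "y \<bullet> (C *v y) > 0" if "y \<noteq> 0" for y
    using sym_posdef_posD[OF B that] s c unfolding Cd by (auto intro!: add_pos_nonneg simp: mult.assoc)
  ultimately show Cpos: "sym_posdef C" by (simp add: sym_posdef_def)
  define P where "P = matrix_inv C"
  have Ppos: "sym_posdef P" unfolding P_def by (rule sym_posdef_inv[OF Cpos])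
  define S where "S = mat_sqrt P"
  have Spos: "sym_posdef S" and SS: "S ** S = P"
    using mat_sqrt[OF Ppos] by (auto simp: S_def)
  note Ssym = sym_posdef_inner_sym[OF Spos]
  note Cinv = matrix_inv_mult[OF sym_posdef_invertible[OF Cpos], folded P_def]
  note Sinv = matrix_inv_mult[OF sym_posdef_invertible[OF Spos]]
  have SCS: "S ** (C ** S) = mat 1"
  proof -
    have "(S ** (C ** S)) ** S = S"
      by (metis Cinv(1) SS matrix_mul_assoc matrix_mul_rid)
    then show ?thesis
      by (metis Sinv(1) matrix_mul_assoc matrix_mul_rid)
  qed
  \<comment> \<open>As \<open>S\<close> is symmetric, the coordinates of \<open>S w\<close> are the
    inner products of \<open>w\<close> with the columns \<open>b i\<close>, and
    \<open>S C S = I\<close> makes these columns orthonormal for \<open>C\<close>.\<close>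
  define b where "b i = S *v axis i 1" for i
  define g where "g i = u \<bullet> (D *v b i)" for i
  have Cb: "b i \<bullet> (C *v b j) = of_bool (i = j)" for i j
  proof -
    have "b i \<bullet> (C *v b j) = axis i 1 \<bullet> (S *v (C *v (S *v axis j 1)))"
      unfolding b_def by (metis Ssym inner_commute)
    also have "\<dots> = of_bool (i = j)"
      by (simp add: matrix_vector_mul_assoc SCS inner_axis_axis)
    finally show ?thesis .
  qed
  have Bb: "s * (b i \<bullet> (B *v b j)) = of_bool (i = j) - c * g i * g j" for i j
    using Cb[of i j] C[of "b i" "b j"] by (simp add: g_def s_def)
  have sq: "w \<bullet> (P *v w) = (\<Sum>i\<in>UNIV. (w \<bullet> b i) * (w \<bullet> b i))" for w
  proof -
    have "w \<bullet> (P *v w) = (S *v w) \<bullet> (S *v w)"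
      unfolding SS[symmetric] matrix_vector_mul_assoc[symmetric] by (metis Ssym inner_commute)
    also have "\<dots> = (\<Sum>i\<in>UNIV. ((S *v w) \<bullet> axis i 1) * ((S *v w) \<bullet> axis i 1))"
      unfolding inner_axis by (simp add: inner_vec_def)
    also have "\<dots> = (\<Sum>i\<in>UNIV. (w \<bullet> b i) * (w \<bullet> b i))"
      unfolding b_def by (intro sum.cong refl) (metis Ssym inner_commute)
    finally show ?thesis .
  qed
  \<comment> \<open>\<open>Bb\<close> expresses the noise covariance of the whitened coordinates
    through their shifts \<open>g\<close>. After substitution the terms of degree two in
    \<open>g\<close> cancel and those of degree four collect to the coefficient
    \<open>c (1 - 6 c)\<close>.\<close>
  have E4: "expectation (\<lambda>\<omega>. form u (b i) \<omega> * form u (b i) \<omega> * form u (b j) \<omega> * form u (b j) \<omega>) =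
      1 + 2 * of_bool (i = j) + c * (1 - 6 * c) * ((g i * g i) * (g j * g j))" for i j
    unfolding mixed_fourth_moment s_def[symmetric] g_def[symmetric] Bb
    by (cases "i = j") (simp_all add: power2_eq_square algebra_simps)
  have "expectation (\<lambda>\<omega>. ((transpose (W \<omega> - m) *v u) \<bullet> (P *v (transpose (W \<omega> - m) *v u)))\<^sup>2) =
      expectation (\<lambda>\<omega>. \<Sum>i\<in>UNIV. \<Sum>j\<in>UNIV. form u (b i) \<omega> * form u (b i) \<omega> * form u (b j) \<omega> * form u (b j) \<omega>)"
    unfolding sq form_transpose power2_eq_square sum_product by (simp only: mult.assoc)
  also have "\<dots> = (\<Sum>i\<in>UNIV. \<Sum>j\<in>UNIV. 1 + 2 * of_bool (i = j) + c * (1 - 6 * c) * ((g i * g i) * (g j * g j)))"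
    by (subst Bochner_Integration.integral_sum, intro Bochner_Integration.integrable_sum integrable_form4,
        subst Bochner_Integration.integral_sum, intro integrable_form4, simp only: E4)
  also have "\<dots> = (real CARD('q))\<^sup>2 + 2 * real CARD('q) + c * (1 - 6 * c) * (\<Sum>i\<in>UNIV. g i * g i)\<^sup>2"
    by (simp add: sum.distrib power2_eq_square sum_product sum_distrib_left[symmetric] of_bool_def distrib_left)
  also have "(\<Sum>i\<in>UNIV. g i * g i) = \<delta> \<bullet> (P *v \<delta>)"
    unfolding sq g_def \<delta>_def transpose_inner ..
  \<comment> \<open>Sherman-Morrison for \<open>C = s B + c \<delta> \<delta>'\<close>: from
    \<open>C B^{-1} \<delta> = (s + c t) \<delta>\<close> follows
    \<open>C^{-1} \<delta> = B^{-1} \<delta> / (s + c t)\<close>.\<close>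
  also have "\<delta> \<bullet> (P *v \<delta>) = ((\<delta> \<bullet> (matrix_inv B *v \<delta>)) / s) / (1 + c * ((\<delta> \<bullet> (matrix_inv B *v \<delta>)) / s))"
  proof -
    define t where "t = \<delta> \<bullet> (matrix_inv B *v \<delta>)"
    have t: "t \<ge> 0"
      using sym_posdef_posD[OF sym_posdef_inv[OF B], of \<delta>] by (cases "\<delta> = 0") (auto simp: t_def)
    then have pos: "s + c * t > 0" using s c by (simp add: add_pos_nonneg)
    have "B *v (matrix_inv B *v \<delta>) = \<delta>"
      by (simp add: matrix_vector_mul_assoc matrix_inv_mult[OF sym_posdef_invertible[OF B]])
    then have "y \<bullet> (C *v (matrix_inv B *v \<delta>)) = y \<bullet> ((s + c * t) *\<^sub>R \<delta>)" for y
      by (simp add: Cd t_def[symmetric] inner_commute algebra_simps)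
    then have "C *v (matrix_inv B *v \<delta>) = (s + c * t) *\<^sub>R \<delta>"
      by (metis vector_eq_ldot)
    then have "matrix_inv B *v \<delta> = (s + c * t) *\<^sub>R (P *v \<delta>)"
      using arg_cong[of _ _ "\<lambda>y. P *v y"]
      by (metis Cinv(2) matrix_vector_mul_assoc matrix_vector_mul_lid matrix_vector_mult_scaleR)
    then have "t = (s + c * t) * (\<delta> \<bullet> (P *v \<delta>))"
      unfolding t_def by (metis inner_scaleR_right)
    then have "\<delta> \<bullet> (P *v \<delta>) = t / (s + c * t)" using pos by (simp add: field_simps)
    also have "\<dots> = (t / s) / (1 + c * (t / s))" using s pos by (simp add: field_simps)
    finally show ?thesis by (simp add: t_def)
  qed
  finally show "expectation (\<lambda>\<omega>. ((transpose (W \<omega> - m) *v u) \<bullet> (matrix_inv C *v (transpose (W \<omega> - m) *v u)))\<^sup>2) =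
      (real CARD('q))\<^sup>2 + 2 * real CARD('q) + kurtosis_excess ((\<delta> \<bullet> (matrix_inv B *v \<delta>)) / (u \<bullet> (A *v u)))"
    by (simp add: kurtosis_excess_def P_def s_def)
qed

lemma quadratic_form_square:
  "(w \<bullet> (P *v w))\<^sup>2 = (\<Sum>((a, b), c, d)\<in>UNIV. (P $ a $ b * P $ c $ d) *
     ((w \<bullet> axis a 1) * (w \<bullet> axis b 1) * (w \<bullet> axis c 1) * (w \<bullet> axis d 1)))" for P :: "real^'n^'n"
proof -
  have "w \<bullet> (P *v w) = (\<Sum>(a, b)\<in>UNIV. w $ a * P $ a $ b * w $ b)"
    unfolding inner_matrix_sum by (simp only: sum.cartesian_product UNIV_Times_UNIV)
  then show ?thesis
    by (simp only: power2_eq_square sum_product sum.cartesian_product UNIV_Times_UNIV)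
      (simp add: split_def mult_ac inner_axis)
qed

text \<open>The empirical inverse prevents reading \<open>psi\<close> as an average of fixed forms.
  Expanding the squared quadratic form puts the entries of the inverse in front of empirical fourth
  moments; both factors converge, and the limits recombine to the expectation in
  \<open>mardia_expectation\<close>.\<close>

lemma psi_tendsto:
  assumes r: "filterlim r at_top sequentially"
    and lim: "u \<longlonglongrightarrow> a" and nz: "a \<noteq> 0"
  shows "(\<lambda>n. psi (r n) x (u n)) \<longlonglongrightarrow>
    (real CARD('q))\<^sup>2 + 2 * real CARD('q) + kurtosis_excess (shift_ratio_left A B D a)"
proof -
  define C where "C = (\<chi> k l. expectation (\<lambda>\<omega>. form a (axis k 1) \<omega> * form a (axis l 1) \<omega>))"
  have C_entry: "C $ k $ l = (a \<bullet> (A *v a)) * (axis k 1 \<bullet> (B *v axis l 1))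
      + c * (a \<bullet> (D *v axis k 1)) * (a \<bullet> (D *v axis l 1))" for k l
    by (simp add: C_def covariance_right)
  have Dv: "a \<bullet> (D *v y) = (\<Sum>k\<in>UNIV. y $ k * (a \<bullet> (D *v axis k 1)))" for y
  proof -
    have "w \<bullet> y = (\<Sum>k\<in>UNIV. y $ k * (w \<bullet> axis k 1))" for w
      unfolding inner_axis by (simp add: inner_vec_def mult.commute)
    then show ?thesis
      unfolding transpose_inner[symmetric] .
  qed
  have C_form: "y \<bullet> (C *v z) = (a \<bullet> (A *v a)) * (y \<bullet> (B *v z)) + c * (a \<bullet> (D *v y)) * (a \<bullet> (D *v z))" for y z
  proof -
    have "y \<bullet> (C *v z) = (\<Sum>k\<in>UNIV. \<Sum>l\<in>UNIV. (a \<bullet> (A *v a)) * (y $ k * B $ k $ l * z $ l)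
        + c * ((y $ k * (a \<bullet> (D *v axis k 1))) * (z $ l * (a \<bullet> (D *v axis l 1)))))"
      unfolding inner_matrix_sum[of y C z] C_entry inner_axis_matrix
      by (intro sum.cong refl) (simp add: algebra_simps)
    then show ?thesis
      unfolding inner_matrix_sum[of y B z] Dv[of y] Dv[of z]
      by (simp only: sum.distrib sum_distrib_left[symmetric] sum_distrib_right[symmetric])
  qed
  note mardia = mardia_expectation[OF nz C_form]
  define w where "w n i = transpose (centered (r n) x i) *v u n" for n i
  define Cn where "Cn n = (1 / real (r n)) *\<^sub>R (\<Sum>l=1..r n. outer_prod (w n l) (w n l))" for n
  have w_axis: "w n i \<bullet> y = u n \<bullet> (centered (r n) x i *v y)" for n i y
    unfolding w_def by (rule transpose_inner)
  have "Cn \<longlonglongrightarrow> C"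
  proof (intro vec_tendstoI)
    fix k l
    have "(\<lambda>n. (1 / real (r n)) * (\<Sum>i=1..r n. (w n i \<bullet> axis k 1) * (w n i \<bullet> axis l 1))) \<longlonglongrightarrow> C $ k $ l"
      unfolding w_axis C_def vec_lambda_beta by (intro average_form2 r lim tendsto_const)
    then show "(\<lambda>n. Cn n $ k $ l) \<longlonglongrightarrow> C $ k $ l"
      by (simp add: Cn_def outer_prod_def inner_axis)
  qed
  then have P: "(\<lambda>n. matrix_inv (Cn n)) \<longlonglongrightarrow> matrix_inv C"
    by (rule tendsto_matrix_inv) (rule sym_posdef_invertible[OF mardia(1)])
  let ?P = "\<lambda>n ((a, b), c, d). matrix_inv (Cn n) $ a $ b * matrix_inv (Cn n) $ c $ d"
  let ?Plim = "\<lambda>((a, b), c, d). matrix_inv C $ a $ b * matrix_inv C $ c $ d"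
  let ?w = "\<lambda>y ((a, b), c, d). (y \<bullet> axis a 1) * (y \<bullet> axis b 1) * (y \<bullet> axis c 1) * (y \<bullet> axis d 1)"
  have psi_eq: "psi (r n) x (u n) = (\<Sum>E\<in>UNIV. ?P n E * ((1 / real (r n)) * (\<Sum>i=1..r n. ?w (w n i) E)))" for n
  proof -
    have "psi (r n) x (u n) = (1 / real (r n)) * (\<Sum>i=1..r n. (w n i \<bullet> (matrix_inv (Cn n) *v w n i))\<^sup>2)"
      by (simp add: psi_def Let_def w_def Cn_def)
    then show ?thesis
      unfolding quadratic_form_square by (subst (asm) sum.swap) (simp add: sum_distrib_left split_def mult_ac)
  qed
  have "(\<lambda>n. \<Sum>E\<in>UNIV. ?P n E * ((1 / real (r n)) * (\<Sum>i=1..r n. ?w (w n i) E)))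
     \<longlonglongrightarrow> (\<Sum>E\<in>UNIV. ?Plim E * expectation (\<lambda>\<omega>. ?w (transpose (W \<omega> - m) *v a) E))"
  proof (rule tendsto_sum)
    fix E :: "(('q \<times> 'q) \<times> 'q \<times> 'q)"
    obtain k1 k2 k3 k4 where E: "E = ((k1, k2), k3, k4)" by (metis surj_pair)
    show "(\<lambda>n. ?P n E * ((1 / real (r n)) * (\<Sum>i=1..r n. ?w (w n i) E)))
        \<longlonglongrightarrow> ?Plim E * expectation (\<lambda>\<omega>. ?w (transpose (W \<omega> - m) *v a) E)"
      unfolding E split w_axis form_transpose
      by (intro tendsto_mult average_form4 r lim tendsto_const tendsto_vec_nth P)
  qed
  also have "(\<Sum>E\<in>UNIV. ?Plim E * expectation (\<lambda>\<omega>. ?w (transpose (W \<omega> - m) *v a) E)) =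
      expectation (\<lambda>\<omega>. \<Sum>E\<in>UNIV. ?Plim E * ?w (transpose (W \<omega> - m) *v a) E)"
    unfolding split_def form_transpose
    by (subst Bochner_Integration.integral_sum) (auto intro!: integrable_mult_right integrable_form4)
  also have "\<dots> = expectation (\<lambda>\<omega>. ((transpose (W \<omega> - m) *v a) \<bullet> (matrix_inv C *v (transpose (W \<omega> - m) *v a)))\<^sup>2)"
    unfolding quadratic_form_square by (simp add: split_def)
  finally show ?thesis
    unfolding psi_eq mardia(2) shift_ratio_left_def .
qed

end

section \<open>Convergence of the maximizers\<close>

text \<open>Otherwise the infinitely many indices outside some ball around \<open>l\<close>,
  enumerated increasingly, give a subsequence none of whose subsequences tends to
  \<open>l\<close>.\<close>

lemma tendsto_if_subsequences:
  fixes f :: "nat \<Rightarrow> 'b::metric_space"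
  assumes "\<And>r. strict_mono r \<Longrightarrow> \<exists>s. strict_mono (s :: nat \<Rightarrow> nat) \<and> (\<lambda>n. f (r (s n))) \<longlonglongrightarrow> l"
  shows "f \<longlonglongrightarrow> l"
proof (rule ccontr)
  assume "\<not> f \<longlonglongrightarrow> l"
  then obtain e where e: "e > 0" and ne: "\<not> (\<forall>\<^sub>F n in sequentially. dist (f n) l < e)"
    unfolding tendsto_iff by blast
  then have inf: "infinite {n. \<not> dist (f n) l < e}"
    by (simp add: frequently_cofinite[symmetric] cofinite_eq_sequentially frequently_def)
  define r where "r = enumerate {n. \<not> dist (f n) l < e}"
  have "strict_mono r"
    unfolding r_def using inf by (rule strict_mono_enumerate)
  from assms[OF this] obtain s where "(\<lambda>n. f (r (s n))) \<longlonglongrightarrow> l" by blast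
  then have "\<forall>\<^sub>F n in sequentially. dist (f (r (s n))) l < e"
    using e by (rule tendstoD)
  then obtain n where "dist (f (r (s n))) l < e"
    by (auto simp: eventually_sequentially)
  moreover have "r (s n) \<in> {n. \<not> dist (f n) l < e}"
    unfolding r_def using inf by (rule enumerate_in_set)
  ultimately show False by simp
qed

text \<open>Since \<open>e\<close> is dual to \<open>c\<close>, a point of the limiting subspace can be corrected along the \<open>e k\<close>.\<close>

lemma orthogonal_approximation:
  fixes C :: "'k \<Rightarrow> nat \<Rightarrow> 'b::real_inner"
  assumes "finite K" and "\<And>k. k \<in> K \<Longrightarrow> C k \<longlonglongrightarrow> c k"
    and "\<And>k. k \<in> K \<Longrightarrow> e k \<bullet> c k \<noteq> 0"
    and "\<And>k l. k \<in> K \<Longrightarrow> l \<in> K \<Longrightarrow> k \<noteq> l \<Longrightarrow> e k \<bullet> c l = 0"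
    and "\<And>k. k \<in> K \<Longrightarrow> y \<bullet> c k = 0"
  shows "\<exists>z. z \<longlonglongrightarrow> y \<and> (\<forall>\<^sub>F n in sequentially. \<forall>k\<in>K. z n \<bullet> C k n = 0)"
  using assms
proof (induction K arbitrary: y rule: finite_induct)
  case empty
  show ?case by (intro exI[of _ "\<lambda>_. y"]) simp
next
  case (insert k0 K)
  have C: "C k0 \<longlonglongrightarrow> c k0" using insert.prems(1) by simp
  have ex: "\<exists>z. z \<longlonglongrightarrow> y' \<and> (\<forall>\<^sub>F n in sequentially. \<forall>k\<in>K. z n \<bullet> C k n = 0)"
    if "\<And>k. k \<in> K \<Longrightarrow> y' \<bullet> c k = 0" for y'
    by (rule insert.IH) (use insert.prems that in auto)
  obtain z where z: "z \<longlonglongrightarrow> y" "\<forall>\<^sub>F n in sequentially. \<forall>k\<in>K. z n \<bullet> C k n = 0"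
    using ex[of y] insert.prems(4) by auto
  obtain w where w: "w \<longlonglongrightarrow> e k0" "\<forall>\<^sub>F n in sequentially. \<forall>k\<in>K. w n \<bullet> C k n = 0"
  proof -
    have "e k0 \<bullet> c k = 0" if "k \<in> K" for k
      by (rule insert.prems(3)) (use that insert.hyps(2) in auto)
    from ex[OF this] that show thesis by blast
  qed
  \<comment> \<open>Both \<open>z\<close> and \<open>w\<close> eventually satisfy the constraints in
    \<open>K\<close>, hence so does this combination. The coefficient of \<open>w\<close> enforces
    the new constraint, and it tends to 0 because \<open>y\<close> is orthogonal to
    \<open>c k0\<close>.\<close>
  define z' where "z' n = z n - ((z n \<bullet> C k0 n) / (w n \<bullet> C k0 n)) *\<^sub>R w n" for n
  have nz: "e k0 \<bullet> c k0 \<noteq> 0" using insert.prems(2) by simp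
  have wc: "(\<lambda>n. w n \<bullet> C k0 n) \<longlonglongrightarrow> e k0 \<bullet> c k0"
    by (intro tendsto_intros w C)
  have "z' \<longlonglongrightarrow> y - ((y \<bullet> c k0) / (e k0 \<bullet> c k0)) *\<^sub>R e k0"
    unfolding z'_def by (intro tendsto_intros z w C nz)
  then have "z' \<longlonglongrightarrow> y"
    using insert.prems(4)[of k0] by simp
  moreover have "\<forall>\<^sub>F n in sequentially. w n \<bullet> C k0 n \<noteq> 0"
    by (rule tendsto_imp_eventually_ne[OF wc nz])
  with z(2) w(2) have "\<forall>\<^sub>F n in sequentially. \<forall>k\<in>insert k0 K. z' n \<bullet> C k n = 0"
    by eventually_elim (auto simp: z'_def inner_diff_left)
  ultimately show ?case by blast
qed

text \<open>The tie goes to 1, so the value is a sign even where \<open>y\<close> is orthogonal to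
  \<open>a\<close>.\<close>

definition align :: "'b::real_inner \<Rightarrow> 'b \<Rightarrow> real" where
  "align a y = (if y \<bullet> a \<ge> 0 then 1 else -1)"

lemma align_cases: "align a y \<in> {-1, 1}"
  by (auto simp: align_def)

text \<open>The inner products with \<open>a\<close> tend to 1 or to -1, so the sign is eventually
  constant and equals that of \<open>b\<close> relative to \<open>a\<close>.\<close>

lemma align_tendsto:
  assumes y: "y \<longlonglongrightarrow> b" and a: "norm a = 1" and b: "b = a \<or> b = - a"
  shows "(\<lambda>n. align a (y n) *\<^sub>R y n) \<longlonglongrightarrow> a"
proof -
  have aa: "a \<bullet> a = 1" using a by (simp add: norm_eq_1)
  have lim: "(\<lambda>n. y n \<bullet> a) \<longlonglongrightarrow> b \<bullet> a" by (intro tendsto_intros y)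
  show ?thesis
  proof (cases "b = a")
    case True
    then have "\<forall>\<^sub>F n in sequentially. y n = align a (y n) *\<^sub>R y n"
      using order_tendstoD(1)[OF lim, of 0] aa by (auto simp: align_def elim!: eventually_mono)
    with y True show ?thesis by (auto intro: Lim_transform_eventually)
  next
    case False
    then have ba: "b = - a" using b by blast
    have "\<forall>\<^sub>F n in sequentially. - y n = align a (y n) *\<^sub>R y n"
      using order_tendstoD(2)[OF lim, of 0] aa ba by (auto simp: align_def elim!: eventually_mono)
    with tendsto_minus[OF y] ba show ?thesis by (auto intro: Lim_transform_eventually)
  qed
qed

definition aligned :: "'b::real_inner \<Rightarrow> (nat \<Rightarrow> 'b) \<Rightarrow> bool" where
  "aligned a y \<longleftrightarrow> (\<lambda>n. align a (y n) *\<^sub>R y n) \<longlonglongrightarrow> a"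

definition aligned_pair ::
    "(nat \<Rightarrow> 'b::real_inner) \<Rightarrow> (nat \<Rightarrow> 'c::real_inner) \<Rightarrow> nat \<Rightarrow> (nat \<Rightarrow> nat \<Rightarrow> 'b) \<Rightarrow> (nat \<Rightarrow> nat \<Rightarrow> 'c) \<Rightarrow> bool" where
  "aligned_pair a b k u v \<longleftrightarrow> aligned (a k) (\<lambda>n. u n k) \<and> aligned (b k) (\<lambda>n. v n k)"

lemma aligned_pair_swap: "aligned_pair a b k u v \<Longrightarrow> aligned_pair b a k v u"
  by (auto simp: aligned_pair_def)

definition whitened_direction :: "real^'n^'n \<Rightarrow> (nat \<Rightarrow> real^'n) \<Rightarrow> nat \<Rightarrow> real^'n" where
  "whitened_direction A w j = (mat_inv_sqrt A *v w j) /\<^sub>R norm (mat_inv_sqrt A *v w j)"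

lemma centered_transpose: "centered n (\<lambda>i. transpose (x i)) i = transpose (centered n x i)"
  by (simp add: centered_def transpose_def vec_eq_iff)

lemma G2_eq_G1: "G2 n x u = G1 n (\<lambda>i. transpose (x i)) u"
  by (simp add: G1_def G2_def centered_transpose)

lemma entry_transpose: "entry (transpose y) e = entry y (map_option prod.swap e)"
  by (cases e) (auto simp: transpose_def)

context moment_sample
begin

text \<open>Transposition exchanges left and right directions together with \<open>A\<close> and
  \<open>B\<close>, so each fact about \<open>u\<close> yields the one about
  \<open>v\<close>.\<close>

lemma transposed:
  "moment_sample M (\<lambda>\<omega>. transpose (W \<omega>)) (\<lambda>i. transpose (x i)) B A (transpose D) c (transpose m)"
proof (intro moment_sample.intro prob_space_axioms moment_sample_axioms.intro)
  have form: "u \<bullet> ((transpose (W \<omega>) - transpose m) *v v) = form v u \<omega>" for u v \<omega>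
  proof -
    have "transpose (W \<omega>) - transpose m = transpose (W \<omega> - m)"
      by (simp add: transpose_def vec_eq_iff)
    then show ?thesis
      using transpose_inner[of "W \<omega> - m" v u] by (simp only: inner_commute)
  qed
  have Dt: "u \<bullet> (transpose D *v v) = v \<bullet> (D *v u)" for u v
    using transpose_inner[of D v u] by (simp only: inner_commute)
  show "expectation (\<lambda>\<omega>. (u \<bullet> ((transpose (W \<omega>) - transpose m) *v v))\<^sup>2) =
      (u \<bullet> (B *v u)) * (v \<bullet> (A *v v)) + c * (u \<bullet> (transpose D *v v))\<^sup>2" for u v
    unfolding form Dt second_moment by simp
  show "expectation (\<lambda>\<omega>. (u \<bullet> ((transpose (W \<omega>) - transpose m) *v v)) ^ 4) =
      3 * ((u \<bullet> (B *v u)) * (v \<bullet> (A *v v)))\<^sup>2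
      + 6 * c * ((u \<bullet> (B *v u)) * (v \<bullet> (A *v v))) * (u \<bullet> (transpose D *v v))\<^sup>2
      + c * (1 - 3 * c) * (u \<bullet> (transpose D *v v)) ^ 4" for u v
    unfolding form Dt fourth_moment by (simp only: mult.commute)
  show "expectation (\<lambda>\<omega>. transpose (W \<omega>) $ i $ j) = transpose m $ i $ j" for i j
    by (simp add: transpose_def mean)
qed (unfold entry_transpose, (rule integrable_entries lln A B c)+)

end

section \<open>Whitened coordinates and uniqueness of the limit directions\<close>

locale shift_svd = moment_sample M W x A B D c m
  for M :: "'a measure" and W :: "'a \<Rightarrow> real^'q^'p" and x A B D c m +
  fixes R :: "real^'q^'p" and d :: nat and \<sigma> :: "nat \<Rightarrow> real"
    and u0 :: "nat \<Rightarrow> real^'p" and v0 :: "nat \<Rightarrow> real^'q"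
  assumes R: "R = mat_inv_sqrt A ** D ** mat_inv_sqrt B"
    and rank: "rank R = d"
    and pairs: "\<And>j. j \<in> {1..d} \<Longrightarrow> \<sigma> j > 0 \<and> singular_pair R (\<sigma> j) (u0 j) (v0 j)"
    and decreasing: "\<And>i j. i \<in> {1..d} \<Longrightarrow> j \<in> {1..d} \<Longrightarrow> i < j \<Longrightarrow> \<sigma> j < \<sigma> i"
begin

lemma transposed_svd:
  "shift_svd M (\<lambda>\<omega>. transpose (W \<omega>)) (\<lambda>i. transpose (x i)) B A (transpose D) c (transpose m)
     (transpose R) d \<sigma> v0 u0"
proof (intro shift_svd.intro transposed shift_svd_axioms.intro decreasing)
  have t: "transpose (mat_inv_sqrt Q) = mat_inv_sqrt Q" if "sym_posdef Q" for Q :: "real^'n^'n"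
    unfolding mat_inv_sqrt_def using that by (intro sym_posdef_symD sym_posdef_inv mat_sqrt)
  show "transpose R = mat_inv_sqrt B ** transpose D ** mat_inv_sqrt A"
    by (simp add: R matrix_transpose_mul t A B matrix_mul_assoc)
  show "rank (transpose R) = d" by (simp add: rank_transpose rank)
  show "\<sigma> j > 0 \<and> singular_pair (transpose R) (\<sigma> j) (v0 j) (u0 j)" if "j \<in> {1..d}" for j
    using pairs[OF that] singular_pair_transpose by blast
qed

abbreviation "SA \<equiv> mat_sqrt A"
abbreviation "SB \<equiv> mat_sqrt B"

abbreviation "u_limit \<equiv> whitened_direction A u0"
abbreviation "v_limit \<equiv> whitened_direction B v0"

abbreviation "aligned_limits \<equiv> aligned_pair u_limit v_limit"

lemma sqrt_facts:
  "sym_posdef SA" "SA ** SA = A" "SA ** mat_inv_sqrt A = mat 1" "mat_inv_sqrt A ** SA = mat 1"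
  "sym_posdef SB" "SB ** SB = B" "SB ** mat_inv_sqrt B = mat 1" "mat_inv_sqrt B ** SB = mat 1"
  unfolding mat_inv_sqrt_def
  by (intro mat_sqrt A B matrix_inv_mult sym_posdef_invertible)+

lemma D_eq: "D = SA ** R ** SB"
  unfolding R by (metis matrix_mul_assoc matrix_mul_lid matrix_mul_rid sqrt_facts(3,8))

lemma SA_inner: "(SA *v y) \<bullet> z = y \<bullet> (SA *v z)" and SB_inner: "(SB *v y') \<bullet> z' = y' \<bullet> (SB *v z')"
  using sym_posdef_inner_sym[OF sqrt_facts(1)] sym_posdef_inner_sym[OF sqrt_facts(5)]
  by (metis inner_commute)+

lemma A_form: "y \<bullet> (A *v z) = (SA *v y) \<bullet> (SA *v z)"
  by (simp add: SA_inner matrix_vector_mul_assoc sqrt_facts)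

lemma B_form: "y \<bullet> (B *v z) = (SB *v y) \<bullet> (SB *v z)"
  by (simp add: SB_inner matrix_vector_mul_assoc sqrt_facts)

lemma D_form: "y \<bullet> (D *v z) = (SA *v y) \<bullet> (R *v (SB *v z))"
  by (simp add: SA_inner matrix_vector_mul_assoc D_eq matrix_mul_assoc)

lemma SA_nonzero: "y \<noteq> 0 \<Longrightarrow> SA *v y \<noteq> 0" and SB_nonzero: "z \<noteq> 0 \<Longrightarrow> SB *v z \<noteq> 0"
  using sym_posdef_posD[OF sqrt_facts(1), of y] sym_posdef_posD[OF sqrt_facts(5), of z] by force+

lemma u_limit:
  assumes "j \<in> {1..d}"
  shows "norm (u_limit j) = 1"
    and "SA *v u_limit j = (1 / norm (mat_inv_sqrt A *v u0 j)) *\<^sub>R u0 j"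
    and "0 < 1 / norm (mat_inv_sqrt A *v u0 j)"
proof -
  have "SA *v (mat_inv_sqrt A *v u0 j) = u0 j"
    by (simp add: matrix_vector_mul_assoc sqrt_facts)
  moreover have "u0 j \<noteq> 0" using pairs[OF assms] by (auto simp: singular_pair_def)
  moreover from calculation have "mat_inv_sqrt A *v u0 j \<noteq> 0" by auto
  ultimately show "norm (u_limit j) = 1"
    and "SA *v u_limit j = (1 / norm (mat_inv_sqrt A *v u0 j)) *\<^sub>R u0 j"
    and "0 < 1 / norm (mat_inv_sqrt A *v u0 j)"
    by (auto simp: whitened_direction_def matrix_vector_mult_scaleR divide_inverse)
qed

lemmas v_limit = shift_svd.u_limit[OF transposed_svd]

lemma u0_orthogonal:
  assumes "k \<in> {1..d}" "l \<in> {1..d}" "k \<noteq> l"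
  shows "u0 k \<bullet> u0 l = 0"
proof (rule singular_vectors_orthogonal)
  show "singular_pair (transpose R) (\<sigma> k) (v0 k) (u0 k)" "singular_pair (transpose R) (\<sigma> l) (v0 l) (u0 l)"
    using pairs assms singular_pair_transpose by blast+
  show "\<sigma> k \<noteq> \<sigma> l"
    using decreasing[of k l] decreasing[of l k] assms by (cases k l rule: linorder_cases) auto
qed (use pairs assms in \<open>auto intro: less_imp_le\<close>)

lemma R_v0: "j \<in> {1..d} \<Longrightarrow> R *v v0 j = \<sigma> j *\<^sub>R u0 j"
  and u0_unit: "j \<in> {1..d} \<Longrightarrow> u0 j \<bullet> u0 j = 1"
  using pairs[of j] by (auto simp: singular_pair_def norm_eq_1)

text \<open>Since \<open>D' y = B^{1/2} R' A^{1/2} y\<close>, the two factors \<open>B^{1/2}\<close>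
  cancel against \<open>B^{-1}\<close>.\<close>

lemma shift_ratio_left_eq:
  "shift_ratio_left A B D y = (norm (transpose R *v (SA *v y)))\<^sup>2 / (norm (SA *v y))\<^sup>2"
proof -
  define z where "z = transpose R *v (SA *v y)"
  have "transpose D = SB ** transpose R ** SA"
    using sqrt_facts(1,5) by (simp add: D_eq matrix_transpose_mul sym_posdef_symD matrix_mul_assoc)
  then have \<delta>: "transpose D *v y = SB *v z"
    by (simp only: z_def matrix_vector_mul_assoc matrix_mul_assoc)
  have "B *v (mat_inv_sqrt B *v z) = SB *v z"
    unfolding matrix_vector_mul_assoc by (metis sqrt_facts(6,7) matrix_mul_assoc matrix_mul_rid)
  then have "matrix_inv B *v (SB *v z) = mat_inv_sqrt B *v z"
    using matrix_inv_mult(2)[OF sym_posdef_invertible[OF B]]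
    by (metis matrix_vector_mul_assoc matrix_vector_mul_lid)
  then have "(SB *v z) \<bullet> (matrix_inv B *v (SB *v z)) = z \<bullet> z"
    by (simp add: SB_inner matrix_vector_mul_assoc sqrt_facts)
  then show ?thesis
    unfolding shift_ratio_left_def \<delta> A_form power2_norm_eq_inner z_def by simp
qed

text \<open>Cauchy-Schwarz in whitened coordinates. It reduces the joint index to one side at a
  time: a pair with ratio at least \<open>\<sigma>_j^2\<close> has one-sided ratios at least that
  large.\<close>

lemma shift_ratio_le: "shift_ratio A B D y z \<le> shift_ratio_left A B D y"
proof -
  define a b where "a = SA *v y" and "b = SB *v z"
  have "(a \<bullet> (R *v b))\<^sup>2 = ((transpose R *v a) \<bullet> b)\<^sup>2"
    by (simp only: transpose_inner)
  also have "\<dots> \<le> (norm (transpose R *v a))\<^sup>2 * (norm b)\<^sup>2"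
    unfolding power2_norm_eq_inner by (rule Cauchy_Schwarz_ineq)
  finally have le: "(a \<bullet> (R *v b))\<^sup>2 \<le> (norm (transpose R *v a))\<^sup>2 * (norm b)\<^sup>2" .
  have eq: "shift_ratio A B D y z = (a \<bullet> (R *v b))\<^sup>2 / ((norm a)\<^sup>2 * (norm b)\<^sup>2)"
    unfolding shift_ratio_def A_form B_form D_form a_def b_def power2_norm_eq_inner ..
  show ?thesis
  proof (cases "b = 0")
    case False
    have "shift_ratio A B D y z \<le> ((norm (transpose R *v a))\<^sup>2 * (norm b)\<^sup>2) / ((norm a)\<^sup>2 * (norm b)\<^sup>2)"
      unfolding eq using le by (rule divide_right_mono) simp
    then show ?thesis using False unfolding shift_ratio_left_eq a_def by simp
  qed (simp add: eq shift_ratio_left_eq)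
qed

lemma shift_ratio_transpose: "shift_ratio B A (transpose D) z y = shift_ratio A B D y z"
proof -
  have "z \<bullet> (transpose D *v y) = y \<bullet> (D *v z)"
    using transpose_inner[of D y z] by (simp only: inner_commute)
  then show ?thesis by (simp only: shift_ratio_def mult.commute)
qed

lemma shift_ratio_limit:
  assumes j: "j \<in> {1..d}"
  shows "shift_ratio A B D (u_limit j) (v_limit j) = (\<sigma> j)\<^sup>2"
proof -
  define a b where "a = 1 / norm (mat_inv_sqrt A *v u0 j)" and "b = 1 / norm (mat_inv_sqrt B *v v0 j)"
  have pos: "a > 0" "b > 0" using u_limit(3)[OF j] v_limit(3)[OF j] by (auto simp: a_def b_def)
  show ?thesis
    unfolding shift_ratio_def A_form B_form D_form u_limit(2)[OF j] v_limit(2)[OF j] a_def[symmetric] b_def[symmetric]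
    using pos u0_unit[OF j] pairs[OF j]
    by (simp add: matrix_vector_mult_scaleR R_v0[OF j] singular_pair_def norm_eq_1 field_simps power2_eq_square)
qed

text \<open>Apply \<open>singular_vector_attained\<close> to \<open>R'\<close> and the normalized
  vector \<open>A^{1/2} y\<close>. Mapping back by \<open>A^{-1/2}\<close>, the unit norm fixes the
  scalar up to sign.\<close>

lemma limit_unique:
  assumes j: "j \<in> {1..d}" and y: "norm y = 1"
    and orth: "\<And>k. k \<in> {1..<j} \<Longrightarrow> u0 k \<bullet> (SA *v y) = 0"
    and ge: "(\<sigma> j)\<^sup>2 \<le> shift_ratio_left A B D y"
  shows "y = u_limit j \<or> y = - u_limit j"
proof -
  have "y \<noteq> 0" using y by auto
  then have nz: "norm (SA *v y) > 0" using SA_nonzero by simp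
  define b where "b = (SA *v y) /\<^sub>R norm (SA *v y)"
  have "b = u0 j \<or> b = - u0 j"
  proof (rule singular_vector_attained[OF shift_svd.rank[OF transposed_svd] shift_svd.pairs[OF transposed_svd] decreasing j])
    show "norm b = 1" using nz by (simp add: b_def)
    show "u0 k \<bullet> b = 0" if "k \<in> {1..<j}" for k using orth[OF that] by (simp add: b_def)
    show "(\<sigma> j)\<^sup>2 \<le> (norm (transpose R *v b))\<^sup>2"
      using ge nz unfolding shift_ratio_left_eq b_def matrix_vector_mult_scaleR norm_scaleR power_mult_distrib
      by (simp add: divide_inverse mult.commute power_inverse)
  qed auto
  moreover have "y = norm (SA *v y) *\<^sub>R (mat_inv_sqrt A *v b)"
    using nz by (simp add: b_def matrix_vector_mult_scaleR matrix_vector_mul_assoc sqrt_facts)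
  ultimately obtain t where t: "y = t *\<^sub>R (mat_inv_sqrt A *v u0 j)"
    by (metis matrix_vector_mult_scaleR scaleR_minus1_left scaleR_scaleR)
  then have "\<bar>t\<bar> * norm (mat_inv_sqrt A *v u0 j) = 1" using y by simp
  then have "\<bar>t\<bar> = inverse (norm (mat_inv_sqrt A *v u0 j))"
    by (metis inverse_unique mult.commute)
  then have "t = inverse (norm (mat_inv_sqrt A *v u0 j)) \<or> t = - inverse (norm (mat_inv_sqrt A *v u0 j))"
    by linarith
  then show ?thesis
    unfolding whitened_direction_def t by (elim disjE) (simp_all only: scaleR_minus_left simp_thms)
qed

section \<open>Limits of the orthogonality constraints\<close>

definition constraint_scale :: "nat \<Rightarrow> real" where
  "constraint_scale k = (1 / norm (mat_inv_sqrt A *v u0 k)) * (v_limit k \<bullet> (B *v v_limit k))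
     + c * (u_limit k \<bullet> (D *v v_limit k)) * (\<sigma> k / norm (mat_inv_sqrt B *v v0 k))"

lemma constraint_scale_pos:
  assumes k: "k \<in> {1..d}"
  shows "constraint_scale k > 0"
proof -
  have "v_limit k \<noteq> 0" using v_limit(1)[OF k] by auto
  then have "v_limit k \<bullet> (B *v v_limit k) > 0" by (rule sym_posdef_posD[OF B])
  moreover have "u_limit k \<bullet> (D *v v_limit k) \<ge> 0"
    unfolding D_form u_limit(2)[OF k] v_limit(2)[OF k]
    using pairs[OF k] u0_unit[OF k] by (simp add: matrix_vector_mult_scaleR R_v0[OF k])
  ultimately show ?thesis
    using u_limit(3)[OF k] v_limit(3)[OF k] c pairs[OF k]
    unfolding constraint_scale_def by (intro add_pos_nonneg mult_pos_pos mult_nonneg_nonneg) auto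
qed

text \<open>The noise contributes \<open>A u_limit k\<close> and the shift contributes
  \<open>D v_limit k\<close>; both are multiples of \<open>A^{1/2} u0_k\<close>, the latter because
  \<open>R v0_k = \<sigma>_k u0_k\<close>. The two summands of \<open>constraint_scale\<close> are
  these contributions.\<close>

lemma constraint_form:
  assumes k: "k \<in> {1..d}"
  shows "(y \<bullet> (A *v u_limit k)) * (v_limit k \<bullet> (B *v v_limit k))
      + c * (y \<bullet> (D *v v_limit k)) * (u_limit k \<bullet> (D *v v_limit k))
    = y \<bullet> (constraint_scale k *\<^sub>R (SA *v u0 k))"
proof -
  have "y \<bullet> (A *v u_limit k) = (1 / norm (mat_inv_sqrt A *v u0 k)) * (y \<bullet> (SA *v u0 k))"
    unfolding A_form u_limit(2)[OF k] by (simp add: SA_inner)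
  moreover have "y \<bullet> (D *v v_limit k) = (\<sigma> k / norm (mat_inv_sqrt B *v v0 k)) * (y \<bullet> (SA *v u0 k))"
    unfolding D_form v_limit(2)[OF k] by (simp add: SA_inner matrix_vector_mult_scaleR R_v0[OF k])
  ultimately show ?thesis
    unfolding constraint_scale_def by (simp add: algebra_simps)
qed

text \<open>\<open>G1\<close> is even and quadratic in \<open>v\<close> and acts linearly on
  \<open>u\<close>, so aligning the maximizers changes a constraint vector only by a sign, which an
  orthogonality condition does not see.\<close>

lemma G1_aligned:
  "G1 n x (align b v *\<^sub>R v) *v (align a u *\<^sub>R u) = align a u *\<^sub>R (G1 n x v *v u)"
proof -
  have "align b v * align b v = 1" by (simp add: align_def)
  then have "z \<bullet> (G1 n x (align b v *\<^sub>R v) *v (align a u *\<^sub>R u)) = z \<bullet> (align a u *\<^sub>R (G1 n x v *v u))" for z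
    unfolding inner_scaleR_right G1_form
    by (simp add: matrix_vector_mult_scaleR sum_distrib_left mult_ac) (simp add: mult.assoc[symmetric])
  then show ?thesis by (metis vector_eq_ldot)
qed

lemma constraint_vector_tendsto:
  assumes k: "k \<in> {1..d}" and al: "aligned_limits k u v"
  shows "(\<lambda>n. align (u_limit k) (u n k) *\<^sub>R (G1 n x (v n k) *v u n k)) \<longlonglongrightarrow> constraint_scale k *\<^sub>R (SA *v u0 k)"
proof (rule vec_tendstoI)
  fix i
  have "(\<lambda>n. axis i 1 \<bullet> (G1 n x (align (v_limit k) (v n k) *\<^sub>R v n k) *v (align (u_limit k) (u n k) *\<^sub>R u n k)))
      \<longlonglongrightarrow> axis i 1 \<bullet> (constraint_scale k *\<^sub>R (SA *v u0 k))"
    unfolding constraint_form[OF k, symmetric]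
    using al by (intro G1_tendsto filterlim_ident tendsto_const) (auto simp: aligned_def aligned_pair_def)
  then show "(\<lambda>n. (align (u_limit k) (u n k) *\<^sub>R (G1 n x (v n k) *v u n k)) $ i)
      \<longlonglongrightarrow> (constraint_scale k *\<^sub>R (SA *v u0 k)) $ i"
    unfolding G1_aligned by (simp only: inner_axis' real_inner_1_left)
qed

lemma align_nonzero: "align a y \<noteq> 0"
  by (simp add: align_def)

text \<open>\<open>u_limit j\<close> meets only the limiting constraints. It is corrected along the
  earlier \<open>u_limit k\<close>, which up to positive factors are dual to the limiting constraint
  vectors by orthonormality of the \<open>u0_k\<close>; normalizing afterwards respects the
  homogeneous constraints.\<close>

lemma feasible_approximation:
  assumes j: "j \<in> {1..d}" and al: "\<And>k. k \<in> {1..<j} \<Longrightarrow> aligned_limits k u v"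
  shows "\<exists>z. z \<longlonglongrightarrow> u_limit j \<and> (\<forall>\<^sub>F n in sequentially. norm (z n) = 1 \<and>
    (\<forall>k\<in>{1..<j}. z n \<bullet> (G1 n x (v n k) *v u n k) = 0))"
proof -
  let ?C = "\<lambda>k n. align (u_limit k) (u n k) *\<^sub>R (G1 n x (v n k) *v u n k)"
  have dual: "u_limit k \<bullet> (constraint_scale l *\<^sub>R (SA *v u0 l)) =
      constraint_scale l * (1 / norm (mat_inv_sqrt A *v u0 k)) * (u0 k \<bullet> u0 l)" if "k \<in> {1..d}" for k l
    unfolding inner_scaleR_right SA_inner[symmetric] u_limit(2)[OF that] inner_scaleR_left by simp
  have "\<exists>z. z \<longlonglongrightarrow> u_limit j \<and> (\<forall>\<^sub>F n in sequentially. \<forall>k\<in>{1..<j}. z n \<bullet> ?C k n = 0)"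
  proof (rule orthogonal_approximation[where c = "\<lambda>k. constraint_scale k *\<^sub>R (SA *v u0 k)" and e = u_limit])
    fix k assume k: "k \<in> {1..<j}"
    then have kd: "k \<in> {1..d}" and kj: "k \<noteq> j" using j by auto
    show "?C k \<longlonglongrightarrow> constraint_scale k *\<^sub>R (SA *v u0 k)"
      by (rule constraint_vector_tendsto[OF kd al[OF k]])
    show "u_limit k \<bullet> (constraint_scale k *\<^sub>R (SA *v u0 k)) \<noteq> 0"
      unfolding dual[OF kd] using constraint_scale_pos[OF kd] u_limit(3)[OF kd] u0_unit[OF kd] by simp
    show "u_limit j \<bullet> (constraint_scale k *\<^sub>R (SA *v u0 k)) = 0"
      unfolding dual[OF j] using u0_orthogonal[OF j kd] kj by simp
    show "u_limit k \<bullet> (constraint_scale l *\<^sub>R (SA *v u0 l)) = 0" if "l \<in> {1..<j}" "k \<noteq> l" for l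
      unfolding dual[OF kd] using u0_orthogonal[OF kd, of l] that j by simp
  qed simp
  then obtain z where z: "z \<longlonglongrightarrow> u_limit j"
    and zC: "\<forall>\<^sub>F n in sequentially. \<forall>k\<in>{1..<j}. z n \<bullet> ?C k n = 0" by blast
  have lim: "(\<lambda>n. z n /\<^sub>R norm (z n)) \<longlonglongrightarrow> u_limit j /\<^sub>R norm (u_limit j)"
    using u_limit(1)[OF j] by (intro tendsto_intros z) auto
  have "\<forall>\<^sub>F n in sequentially. z n \<noteq> 0"
    using z by (rule tendsto_imp_eventually_ne) (use u_limit(1)[OF j] in auto)
  with zC have "\<forall>\<^sub>F n in sequentially. norm (z n /\<^sub>R norm (z n)) = 1 \<and>
    (\<forall>k\<in>{1..<j}. (z n /\<^sub>R norm (z n)) \<bullet> (G1 n x (v n k) *v u n k) = 0)"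
    by eventually_elim (auto simp: align_nonzero)
  with lim show ?thesis
    unfolding u_limit(1)[OF j] by (intro exI[of _ "\<lambda>n. z n /\<^sub>R norm (z n)"]) simp
qed

lemma limit_constraint:
  assumes k: "k \<in> {1..d}" and al: "aligned_limits k u v"
    and r: "filterlim r at_top sequentially" and y: "y \<longlonglongrightarrow> y0"
    and orth: "\<And>n. y n \<bullet> (G1 (r n) x (v (r n) k) *v u (r n) k) = 0"
  shows "u0 k \<bullet> (SA *v y0) = 0"
proof -
  have "(\<lambda>n. y n \<bullet> (align (u_limit k) (u (r n) k) *\<^sub>R (G1 (r n) x (v (r n) k) *v u (r n) k)))
      \<longlonglongrightarrow> y0 \<bullet> (constraint_scale k *\<^sub>R (SA *v u0 k))"
    by (intro tendsto_inner y filterlim_compose[OF constraint_vector_tendsto[OF k al] r])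
  then have "y0 \<bullet> (constraint_scale k *\<^sub>R (SA *v u0 k)) = 0"
    using orth by (simp add: LIMSEQ_const_iff)
  then show ?thesis
    using constraint_scale_pos[OF k] SA_inner[of y0 "u0 k"] by (simp add: inner_commute)
qed

section \<open>The inductive step for the two indices\<close>

lemma psi_step:
  assumes j: "j \<in> {1..d}" and al: "\<And>k. k \<in> {1..<j} \<Longrightarrow> aligned_limits k u v"
    and mx: "\<And>n. n > N \<Longrightarrow> is_arg_max (psi n x)
      (\<lambda>y. y \<in> sphere 0 1 \<and> (\<forall>k\<in>{1..<j}. y \<bullet> (G1 n x (v n k) *v u n k) = 0)) (u n j)"
  shows "aligned (u_limit j) (\<lambda>n. u n j)"
  unfolding aligned_def
proof (rule tendsto_if_subsequences)
  fix r :: "nat \<Rightarrow> nat" assume r: "strict_mono r"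
  note mx' = mx[unfolded is_arg_max_linorder]
  obtain z where z: "z \<longlonglongrightarrow> u_limit j" and feas: "\<forall>\<^sub>F n in sequentially. norm (z n) = 1 \<and>
    (\<forall>k\<in>{1..<j}. z n \<bullet> (G1 n x (v n k) *v u n k) = 0)"
    using feasible_approximation[OF j al] by blast
  \<comment> \<open>The shift by \<open>Suc N\<close> keeps all indices beyond \<open>N\<close>,
    where the maximizing property is available.\<close>
  have gt: "r (n + Suc N) > N" for n
    using seq_suble[OF r, of "n + Suc N"] by linarith
  have "\<forall>n. u (r (n + Suc N)) j \<in> sphere 0 1"
    using mx'[OF gt] by blast
  then obtain y0 s where y0: "y0 \<in> sphere 0 1" and s: "strict_mono s"
    and lim: "((\<lambda>n. u (r (n + Suc N)) j) \<circ> s) \<longlonglongrightarrow> y0"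
    using compact_sphere[of "0::real^'p" 1] unfolding compact_def by meson
  define q where "q n = r (s n + Suc N)" for n
  have s': "strict_mono (\<lambda>n. s n + Suc N)" using s by (simp add: strict_mono_def)
  have q: "filterlim q at_top sequentially"
    unfolding q_def using filterlim_subseq[OF strict_mono_o[OF r s']] by (simp add: o_def)
  have qN: "q n > N" for n unfolding q_def by (rule gt)
  have lim: "(\<lambda>n. u (q n) j) \<longlonglongrightarrow> y0" using lim by (simp add: o_def q_def)
  have y1: "norm y0 = 1" using y0 by simp
  have "\<forall>\<^sub>F n in sequentially. psi (q n) x (z (q n)) \<le> psi (q n) x (u (q n) j)"
    using eventually_compose_filterlim[OF feas q]
    by eventually_elim (use mx'[OF qN] in auto)
  moreover have "(\<lambda>n. psi (q n) x (u (q n) j)) \<longlonglongrightarrow>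
      (real CARD('q))\<^sup>2 + 2 * real CARD('q) + kurtosis_excess (shift_ratio_left A B D y0)"
    using y1 by (intro psi_tendsto q lim) auto
  moreover have "(\<lambda>n. psi (q n) x (z (q n))) \<longlonglongrightarrow>
      (real CARD('q))\<^sup>2 + 2 * real CARD('q) + kurtosis_excess (shift_ratio_left A B D (u_limit j))"
    using u_limit(1)[OF j] by (intro psi_tendsto q filterlim_compose[OF z q]) auto
  \<comment> \<open>The maximizers do at least as well as the feasible approximations of
    \<open>u_limit j\<close>; in the limit the common additive constant drops out.\<close>
  ultimately have "kurtosis_excess (shift_ratio_left A B D (u_limit j)) \<le> kurtosis_excess (shift_ratio_left A B D y0)"
    using tendsto_le[OF sequentially_bot] by fastforce
  then have "shift_ratio_left A B D (u_limit j) \<le> shift_ratio_left A B D y0"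
    by (subst (asm) kurtosis_excess_le_iff) (simp_all add: shift_ratio_left_eq)
  \<comment> \<open>A lower bound at \<open>u_limit j\<close> suffices, and the joint ratio with the
    partner \<open>v_limit j\<close> supplies it.\<close>
  then have "(\<sigma> j)\<^sup>2 \<le> shift_ratio_left A B D y0"
    using shift_ratio_le[of "u_limit j" "v_limit j"] shift_ratio_limit[OF j] by linarith
  moreover have "u0 k \<bullet> (SA *v y0) = 0" if k: "k \<in> {1..<j}" for k
  proof (rule limit_constraint[OF _ al[OF k] q lim])
    show "k \<in> {1..d}" using k j by auto
    show "u (q n) j \<bullet> (G1 (q n) x (v (q n) k) *v u (q n) k) = 0" for n
      using mx'[OF qN, of n] k by blast
  qed
  ultimately have "y0 = u_limit j \<or> y0 = - u_limit j"
    using limit_unique[OF j y1] by blast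
  from align_tendsto[OF lim u_limit(1)[OF j] this]
  show "\<exists>s. strict_mono s \<and> (\<lambda>n. align (u_limit j) (u (r (s n)) j) *\<^sub>R u (r (s n)) j) \<longlonglongrightarrow> u_limit j"
    using s' unfolding q_def by blast
qed

text \<open>One subsequence has to serve both sides, so compactness is taken in the product of the
  spheres. The two limits are then identified separately through the one-sided ratios, the right one
  by way of the transposed sample.\<close>

lemma kappa_step:
  assumes j: "j \<in> {1..d}" and al: "\<And>k. k \<in> {1..<j} \<Longrightarrow> aligned_limits k u v"
    and mx: "\<And>n. n > N \<Longrightarrow> is_arg_max (\<lambda>(y, z). kappa n x y z)
      (\<lambda>(y, z). y \<in> sphere 0 1 \<and> z \<in> sphere 0 1 \<and>
         (\<forall>k\<in>{1..<j}. y \<bullet> (G1 n x (v n k) *v u n k) = 0 \<and> z \<bullet> (G2 n x (u n k) *v v n k) = 0))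
      (u n j, v n j)"
  shows "aligned_limits j u v"
proof -
  note mx' = mx[unfolded is_arg_max_linorder split_paired_All split]
  note tr = transposed_svd
  have tr_al: "aligned_pair v_limit u_limit k v u" if "k \<in> {1..<j}" for k
    by (rule aligned_pair_swap[OF al[OF that]])
  obtain z where z: "z \<longlonglongrightarrow> u_limit j" and feas: "\<forall>\<^sub>F n in sequentially. norm (z n) = 1 \<and>
    (\<forall>k\<in>{1..<j}. z n \<bullet> (G1 n x (v n k) *v u n k) = 0)"
    using feasible_approximation[OF j al] by blast
  obtain w where w: "w \<longlonglongrightarrow> v_limit j" and feas': "\<forall>\<^sub>F n in sequentially. norm (w n) = 1 \<and>
    (\<forall>k\<in>{1..<j}. w n \<bullet> (G2 n x (u n k) *v v n k) = 0)"
    using shift_svd.feasible_approximation[OF tr j tr_al] unfolding G2_eq_G1[symmetric] by blast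
  have main: "\<exists>s. strict_mono s
      \<and> (\<lambda>n. align (u_limit j) (u (r (s n)) j) *\<^sub>R u (r (s n)) j) \<longlonglongrightarrow> u_limit j
      \<and> (\<lambda>n. align (v_limit j) (v (r (s n)) j) *\<^sub>R v (r (s n)) j) \<longlonglongrightarrow> v_limit j"
    if r: "strict_mono r" for r :: "nat \<Rightarrow> nat"
  proof -
    have gt: "r (n + Suc N) > N" for n
      using seq_suble[OF r, of "n + Suc N"] by linarith
    have "\<forall>n. (u (r (n + Suc N)) j, v (r (n + Suc N)) j) \<in> sphere 0 1 \<times> sphere 0 1"
      using mx'[OF gt] by blast
    then obtain yz s where yz: "yz \<in> sphere 0 1 \<times> sphere 0 1" and s: "strict_mono s"
      and lim: "((\<lambda>n. (u (r (n + Suc N)) j, v (r (n + Suc N)) j)) \<circ> s) \<longlonglongrightarrow> yz"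
      using compact_Times[OF compact_sphere[of "0::real^'p" 1] compact_sphere[of "0::real^'q" 1]]
      unfolding compact_def by meson
    obtain y0 z0 where yz0: "yz = (y0, z0)" by (cases yz)
    define q where "q n = r (s n + Suc N)" for n
    have s': "strict_mono (\<lambda>n. s n + Suc N)" using s by (simp add: strict_mono_def)
    have q: "filterlim q at_top sequentially"
      unfolding q_def using filterlim_subseq[OF strict_mono_o[OF r s']] by (simp add: o_def)
    have qN: "q n > N" for n unfolding q_def by (rule gt)
    have limu: "(\<lambda>n. u (q n) j) \<longlonglongrightarrow> y0" and limv: "(\<lambda>n. v (q n) j) \<longlonglongrightarrow> z0"
      using tendsto_fst[OF lim] tendsto_snd[OF lim] by (simp_all add: o_def q_def yz0)
    have y1: "norm y0 = 1" "norm z0 = 1" using yz by (simp_all add: yz0)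
    have "\<forall>\<^sub>F n in sequentially. kappa (q n) x (z (q n)) (w (q n)) \<le> kappa (q n) x (u (q n) j) (v (q n) j)"
      using eventually_compose_filterlim[OF feas q] eventually_compose_filterlim[OF feas' q]
      by eventually_elim (use mx'[OF qN] in auto)
    moreover have "(\<lambda>n. kappa (q n) x (u (q n) j) (v (q n) j)) \<longlonglongrightarrow> 3 + kurtosis_excess (shift_ratio A B D y0 z0)"
      using y1 by (intro kappa_tendsto q limu limv) auto
    moreover have "(\<lambda>n. kappa (q n) x (z (q n)) (w (q n))) \<longlonglongrightarrow> 3 + kurtosis_excess (shift_ratio A B D (u_limit j) (v_limit j))"
      using u_limit(1)[OF j] v_limit(1)[OF j]
      by (intro kappa_tendsto q filterlim_compose[OF z q] filterlim_compose[OF w q]) auto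
    ultimately have "kurtosis_excess (shift_ratio A B D (u_limit j) (v_limit j)) \<le> kurtosis_excess (shift_ratio A B D y0 z0)"
      using tendsto_le[OF sequentially_bot] by fastforce
    then have "(\<sigma> j)\<^sup>2 \<le> shift_ratio A B D y0 z0"
      by (simp add: kurtosis_excess_le_iff shift_ratio_nonneg shift_ratio_limit[OF j])
    then have ge: "(\<sigma> j)\<^sup>2 \<le> shift_ratio_left A B D y0" "(\<sigma> j)\<^sup>2 \<le> shift_ratio_left B A (transpose D) z0"
      using shift_ratio_le[of y0 z0] shift_svd.shift_ratio_le[OF tr, of z0 y0] unfolding shift_ratio_transpose by linarith+
    have "u0 k \<bullet> (SA *v y0) = 0" if k: "k \<in> {1..<j}" for k
    proof (rule limit_constraint[OF _ al[OF k] q limu])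
      show "k \<in> {1..d}" using k j by auto
      show "u (q n) j \<bullet> (G1 (q n) x (v (q n) k) *v u (q n) k) = 0" for n
        using mx'[OF qN, of n] k by blast
    qed
    then have u_lim: "y0 = u_limit j \<or> y0 = - u_limit j"
      using limit_unique[OF j y1(1) _ ge(1)] by blast
    have "v0 k \<bullet> (SB *v z0) = 0" if k: "k \<in> {1..<j}" for k
    proof (rule shift_svd.limit_constraint[OF tr _ tr_al[OF k] q limv])
      show "k \<in> {1..d}" using k j by auto
      show "v (q n) j \<bullet> (G1 (q n) (\<lambda>i. transpose (x i)) (u (q n) k) *v v (q n) k) = 0" for n
        using mx'[OF qN, of n] k unfolding G2_eq_G1 by blast
    qed
    then have v_lim: "z0 = v_limit j \<or> z0 = - v_limit j"
      using shift_svd.limit_unique[OF tr j y1(2) _ ge(2)] by blast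
    show ?thesis
      using align_tendsto[OF limu u_limit(1)[OF j] u_lim] align_tendsto[OF limv v_limit(1)[OF j] v_lim] s'
      unfolding q_def by blast
  qed
  have "(\<lambda>n. align (u_limit j) (u n j) *\<^sub>R u n j) \<longlonglongrightarrow> u_limit j"
    by (rule tendsto_if_subsequences) (use main in blast)
  moreover have "(\<lambda>n. align (v_limit j) (v n j) *\<^sub>R v n j) \<longlonglongrightarrow> v_limit j"
    by (rule tendsto_if_subsequences) (use main in blast)
  ultimately show ?thesis unfolding aligned_def aligned_pair_def by blast
qed

lemma kappa_maximizers_aligned:
  assumes mx: "\<And>n. n > N \<Longrightarrow> kappa_maximizers d n x (u n) (v n)"
    and j: "j \<in> {1..d}"
  shows "aligned_limits j u v"
  using j
proof (induction j rule: less_induct)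
  case (less j)
  show ?case
  proof (rule kappa_step[OF less.prems])
    show "aligned_limits k u v" if "k \<in> {1..<j}" for k
      using less.IH[of k] less.prems that by auto
    fix n assume "n > N"
    from mx[OF this] less.prems
    show "is_arg_max (\<lambda>(y, z). kappa n x y z)
      (\<lambda>(y, z). y \<in> sphere 0 1 \<and> z \<in> sphere 0 1 \<and>
         (\<forall>k\<in>{1..<j}. y \<bullet> (G1 n x (v n k) *v u n k) = 0 \<and> z \<bullet> (G2 n x (u n k) *v v n k) = 0))
      (u n j, v n j)"
      unfolding kappa_maximizers_def joint_maximizers_def by blast
  qed
qed

lemma psi_maximizers_aligned:
  assumes mx: "\<And>n. n > N \<Longrightarrow> psi_maximizers d n x (u n) (v n)"
    and j: "j \<in> {1..d}"
  shows "aligned_limits j u v"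
  using j
proof (induction j rule: less_induct)
  case (less j)
  have al: "aligned_limits k u v" if "k \<in> {1..<j}" for k
    using less.IH[of k] less.prems that by auto
  have "aligned (u_limit j) (\<lambda>n. u n j)"
  proof (rule psi_step[OF less.prems al])
    fix n assume "n > N"
    from mx[OF this] less.prems
    show "is_arg_max (psi n x)
      (\<lambda>y. y \<in> sphere 0 1 \<and> (\<forall>k\<in>{1..<j}. y \<bullet> (G1 n x (v n k) *v u n k) = 0)) (u n j)"
      unfolding psi_maximizers_def separate_maximizers_def by blast
  qed
  moreover have "aligned (v_limit j) (\<lambda>n. v n j)"
  proof (rule shift_svd.psi_step[OF transposed_svd less.prems])
    show "aligned_pair v_limit u_limit k v u" if "k \<in> {1..<j}" for k
      by (rule aligned_pair_swap[OF al[OF that]])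
    fix n assume "n > N"
    from mx[OF this] less.prems
    show "is_arg_max (psi n (\<lambda>i. transpose (x i)))
      (\<lambda>y. y \<in> sphere 0 1 \<and> (\<forall>k\<in>{1..<j}. y \<bullet> (G1 n (\<lambda>i. transpose (x i)) (u n k) *v v n k) = 0)) (v n j)"
      unfolding psi_maximizers_def separate_maximizers_def G2_eq_G1 by blast
  qed
  ultimately show ?case unfolding aligned_pair_def by blast
qed

end

section \<open>Moments of the normal mixture\<close>

text \<open>All orders are demanded at once to obtain closure under products: the bound
  \<open>|a b|^k <= |a|^(2 k) + |b|^(2 k)\<close> doubles the order.\<close>

definition has_moments :: "'a measure \<Rightarrow> ('a \<Rightarrow> real) \<Rightarrow> bool" where
  "has_moments M f \<longleftrightarrow> f \<in> borel_measurable M \<and> (\<forall>k. integrable M (\<lambda>x. \<bar>f x\<bar> ^ k))"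

lemma has_moments_integrable_power:
  assumes "has_moments M f"
  shows "integrable M (\<lambda>x. f x ^ k)"
proof (rule Bochner_Integration.integrable_bound)
  show "integrable M (\<lambda>x. \<bar>f x\<bar> ^ k)" using assms by (simp add: has_moments_def)
  show "(\<lambda>x. f x ^ k) \<in> borel_measurable M" using assms by (auto simp: has_moments_def)
qed (simp add: power_abs)

lemma has_moments_integrable: "has_moments M f \<Longrightarrow> integrable M f"
  using has_moments_integrable_power[of M f 1] by simp

lemma has_moments_const: "prob_space M \<Longrightarrow> has_moments M (\<lambda>_. a)"
  by (simp add: has_moments_def finite_measure.integrable_const prob_space_def)

lemma has_moments_add:
  assumes f: "has_moments M f" and g: "has_moments M g"
  shows "has_moments M (\<lambda>x. f x + g x)"
  unfolding has_moments_def
proof (intro conjI allI)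
  have [measurable]: "f \<in> borel_measurable M" "g \<in> borel_measurable M"
    using f g by (auto simp: has_moments_def)
  show "(\<lambda>x. f x + g x) \<in> borel_measurable M" by measurable
  fix k
  have "\<bar>a + b\<bar> ^ k \<le> 2 ^ k * (\<bar>a\<bar> ^ k + \<bar>b\<bar> ^ k)" for a b :: real
  proof -
    have "\<bar>a + b\<bar> ^ k \<le> (2 * max \<bar>a\<bar> \<bar>b\<bar>) ^ k" by (intro power_mono) auto
    also have "\<dots> \<le> 2 ^ k * (\<bar>a\<bar> ^ k + \<bar>b\<bar> ^ k)"
      by (auto simp: power_mult_distrib max_def)
    finally show ?thesis .
  qed
  then have "norm (\<bar>f x + g x\<bar> ^ k) \<le> norm (2 ^ k * (\<bar>f x\<bar> ^ k + \<bar>g x\<bar> ^ k))" for x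
    by (simp add: abs_of_nonneg)
  moreover have "integrable M (\<lambda>x. 2 ^ k * (\<bar>f x\<bar> ^ k + \<bar>g x\<bar> ^ k))"
    using f g by (simp add: has_moments_def)
  moreover have "(\<lambda>x. \<bar>f x + g x\<bar> ^ k) \<in> borel_measurable M" by measurable
  ultimately show "integrable M (\<lambda>x. \<bar>f x + g x\<bar> ^ k)"
    by (blast intro: Bochner_Integration.integrable_bound)
qed

lemma has_moments_mult:
  assumes f: "has_moments M f" and g: "has_moments M g"
  shows "has_moments M (\<lambda>x. f x * g x)"
  unfolding has_moments_def
proof (intro conjI allI)
  have [measurable]: "f \<in> borel_measurable M" "g \<in> borel_measurable M"
    using f g by (auto simp: has_moments_def)
  show "(\<lambda>x. f x * g x) \<in> borel_measurable M" by measurable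
  fix k
  have "\<bar>a * b\<bar> ^ k \<le> \<bar>a\<bar> ^ (2 * k) + \<bar>b\<bar> ^ (2 * k)" for a b :: real
  proof -
    have *: "x * y \<le> x\<^sup>2 + y\<^sup>2" if "0 \<le> x" "0 \<le> y" for x y :: real
      using sum_squares_bound[of x y] mult_nonneg_nonneg[OF that] by linarith
    show ?thesis
      using *[of "\<bar>a\<bar> ^ k" "\<bar>b\<bar> ^ k"] by (simp add: abs_mult power_mult_distrib power_mult[symmetric] mult.commute)
  qed
  then have "norm (\<bar>f x * g x\<bar> ^ k) \<le> norm (\<bar>f x\<bar> ^ (2 * k) + \<bar>g x\<bar> ^ (2 * k))" for x
    by (simp add: abs_of_nonneg)
  moreover have "integrable M (\<lambda>x. \<bar>f x\<bar> ^ (2 * k) + \<bar>g x\<bar> ^ (2 * k))"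
    using f g by (simp add: has_moments_def del: power_even_abs)
  moreover have "(\<lambda>x. \<bar>f x * g x\<bar> ^ k) \<in> borel_measurable M" by measurable
  ultimately show "integrable M (\<lambda>x. \<bar>f x * g x\<bar> ^ k)"
    by (blast intro: Bochner_Integration.integrable_bound)
qed

lemma has_moments_sum:
  assumes "prob_space M" and "\<And>i. i \<in> I \<Longrightarrow> has_moments M (f i)"
  shows "has_moments M (\<lambda>x. \<Sum>i\<in>I. f i x)"
  using assms(2)
  by (induction I rule: infinite_finite_induct)
    (auto intro: has_moments_add simp: has_moments_const[OF assms(1)])

lemma has_moments_distr:
  assumes "g \<in> measurable M N" and "f \<in> borel_measurable N"
  shows "has_moments (distr M N g) f \<longleftrightarrow> has_moments M (\<lambda>x. f (g x))"
  using assms by (auto simp: has_moments_def integrable_distr_eq)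

section \<open>Integration against a mixture\<close>

lemma sets_mixture[simp]: "sets (mixture a1 M1 a2 M2) = sets M1"
  and space_mixture[simp]: "space (mixture a1 M1 a2 M2) = space M1"
  by (simp_all add: mixture_def)

lemma borel_measurable_mixture:
  "f \<in> borel_measurable (mixture a1 M1 a2 M2) \<longleftrightarrow> f \<in> borel_measurable M1"
  by (simp cong: measurable_cong_sets)

lemma nn_integral_mixture:
  assumes sets: "sets M2 = sets M1" and f: "f \<in> borel_measurable M1"
  shows "(\<integral>\<^sup>+x. f x \<partial>mixture a1 M1 a2 M2) =
    ennreal a1 * (\<integral>\<^sup>+x. f x \<partial>M1) + ennreal a2 * (\<integral>\<^sup>+x. f x \<partial>M2)"
  using f
proof (induction rule: borel_measurable_induct)
  have m2: "g \<in> borel_measurable M2 \<longleftrightarrow> g \<in> borel_measurable M1"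
    "g \<in> borel_measurable (mixture a1 M1 a2 M2) \<longleftrightarrow> g \<in> borel_measurable M1" for g :: "'a \<Rightarrow> ennreal"
    by (simp_all only: measurable_cong_sets[OF sets refl] borel_measurable_mixture)
  note sp = sets_eq_imp_space_eq[OF sets]
  {
    case (cong f g)
    then show ?case
      using nn_integral_cong[of M1 f g] nn_integral_cong[of M2 f g] nn_integral_cong[of "mixture a1 M1 a2 M2" f g]
      by (simp add: sp)
  next
    case (set S)
    then show ?case by (simp add: sets emeasure_mixture)
  next
    case (mult u c)
    then show ?case
      by (simp add: nn_integral_cmult m2 distrib_left mult_ac)
  next
    case (add u v)
    then show ?case
      by (simp add: nn_integral_add m2 distrib_left add_ac)
  next
    case (seq U)
    have inc: "incseq U" by fact
    have U[measurable]: "U i \<in> borel_measurable M1" for i by fact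
    have IH: "(\<integral>\<^sup>+x. U i x \<partial>mixture a1 M1 a2 M2) =
        ennreal a1 * (\<integral>\<^sup>+x. U i x \<partial>M1) + ennreal a2 * (\<integral>\<^sup>+x. U i x \<partial>M2)" for i by fact
    \<comment> \<open>Monotonicity of both sequences turns the sum of the two suprema into the
      supremum of the sums.\<close>
    have mono: "incseq (\<lambda>i. ennreal a * integral\<^sup>N N (U i))" for a :: real and N
      using inc by (intro incseq_SucI mult_left_mono nn_integral_mono) (auto simp: incseq_Suc_iff le_fun_def)
    note S = nn_integral_monotone_convergence_SUP[OF inc]
    show ?case
      unfolding SUP_apply by (simp add: S m2 U IH SUP_mult_left_ennreal ennreal_SUP_add[OF mono mono])
  }
qed

lemma integral_mixture:
  fixes f :: "'a \<Rightarrow> real"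
  assumes sets: "sets M2 = sets M1" and a: "0 \<le> a1" "0 \<le> a2"
    and f1: "integrable M1 f" and f2: "integrable M2 f"
  shows "has_bochner_integral (mixture a1 M1 a2 M2) f (a1 * (LINT x|M1. f x) + a2 * (LINT x|M2. f x))"
proof -
  let ?N = "mixture a1 M1 a2 M2"
  have [measurable]: "f \<in> borel_measurable M1" "f \<in> borel_measurable M2" using f1 f2 by auto
  \<comment> \<open>Non-negative functions come from \<open>nn_integral_mixture\<close>, with finite
    value by integrability; the general case is the difference of positive and negative
    part.\<close>
  have pos: "has_bochner_integral ?N g (a1 * (LINT x|M1. g x) + a2 * (LINT x|M2. g x))"
    if i: "integrable M1 g" "integrable M2 g" and nn: "\<And>x. 0 \<le> g x" for g :: "'a \<Rightarrow> real"
  proof (rule has_bochner_integral_nn_integral)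
    have [measurable]: "g \<in> borel_measurable M1" using i by auto
    then show "g \<in> borel_measurable ?N"
      by (simp add: borel_measurable_mixture)
    show "0 \<le> a1 * (LINT x|M1. g x) + a2 * (LINT x|M2. g x)"
      using a nn by (intro add_nonneg_nonneg mult_nonneg_nonneg integral_nonneg_AE) auto
    have "(\<integral>\<^sup>+x. ennreal (g x) \<partial>?N) = ennreal a1 * (\<integral>\<^sup>+x. ennreal (g x) \<partial>M1) + ennreal a2 * (\<integral>\<^sup>+x. ennreal (g x) \<partial>M2)"
      by (rule nn_integral_mixture[OF sets]) measurable
    also have "\<dots> = ennreal (a1 * (LINT x|M1. g x) + a2 * (LINT x|M2. g x))"
      using nn a by (simp add: nn_integral_eq_integral i ennreal_mult' ennreal_plus integral_nonneg_AE)
    finally show "(\<integral>\<^sup>+x. ennreal (g x) \<partial>?N) = ennreal (a1 * (LINT x|M1. g x) + a2 * (LINT x|M2. g x))" .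
  qed (use nn in simp)
  have i: "integrable M1 (\<lambda>x. max 0 (f x))" "integrable M2 (\<lambda>x. max 0 (f x))"
    "integrable M1 (\<lambda>x. max 0 (- f x))" "integrable M2 (\<lambda>x. max 0 (- f x))"
    using f1 f2 by auto
  have eq: "(\<lambda>x. max 0 (f x) - max 0 (- f x)) = f" by auto
  have "has_bochner_integral ?N (\<lambda>x. max 0 (f x) - max 0 (- f x))
     ((a1 * (LINT x|M1. max 0 (f x)) + a2 * (LINT x|M2. max 0 (f x)))
      - (a1 * (LINT x|M1. max 0 (- f x)) + a2 * (LINT x|M2. max 0 (- f x))))"
    by (intro has_bochner_integral_diff pos i) auto
  also have "(a1 * (LINT x|M1. max 0 (f x)) + a2 * (LINT x|M2. max 0 (f x)))
      - (a1 * (LINT x|M1. max 0 (- f x)) + a2 * (LINT x|M2. max 0 (- f x))) =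
    a1 * (LINT x|M1. max 0 (f x) - max 0 (- f x)) + a2 * (LINT x|M2. max 0 (f x) - max 0 (- f x))"
    by (simp add: i algebra_simps)
  finally show ?thesis unfolding eq .
qed

lemma has_moments_mixture:
  assumes sets: "sets M2 = sets M1" and a: "0 \<le> a1" "0 \<le> a2"
    and f: "has_moments M1 f" "has_moments M2 f"
  shows "has_moments (mixture a1 M1 a2 M2) f"
  unfolding has_moments_def
proof (intro conjI allI)
  show "f \<in> borel_measurable (mixture a1 M1 a2 M2)"
    using f by (simp add: borel_measurable_mixture has_moments_def)
  fix k
  have "integrable M1 (\<lambda>x. \<bar>f x\<bar> ^ k)" "integrable M2 (\<lambda>x. \<bar>f x\<bar> ^ k)"
    using f by (simp_all add: has_moments_def)
  from integral_mixture[OF sets a this] show "integrable (mixture a1 M1 a2 M2) (\<lambda>x. \<bar>f x\<bar> ^ k)"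
    by (simp add: has_bochner_integral_iff)
qed

section \<open>Standard normal matrices and the matrix normal law\<close>

abbreviation std_normal :: "real measure" where
  "std_normal \<equiv> density lborel std_normal_density"

abbreviation std_normal_coordinates :: "('i::finite \<Rightarrow> real) measure" where
  "std_normal_coordinates \<equiv> PiM UNIV (\<lambda>_. std_normal)"

lemma prob_space_std_normal: "prob_space std_normal"
  by (rule prob_space_normal_density) simp

lemma prob_space_std_normal_coordinates: "prob_space (std_normal_coordinates :: ('i::finite \<Rightarrow> real) measure)"
  by (intro prob_space_PiM prob_space_std_normal)

lemma std_normal_coordinate_measurable[measurable]:
  "(\<lambda>z. z e) \<in> borel_measurable (std_normal_coordinates :: ('i::finite \<Rightarrow> real) measure)"
proof -
  have "(\<lambda>z. z e) \<in> measurable std_normal_coordinates std_normal" by (rule measurable_component_singleton) simp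
  then show ?thesis by simp
qed

lemma distr_std_normal_coordinate:
  "distr (std_normal_coordinates :: ('i::finite \<Rightarrow> real) measure) borel (\<lambda>z. z e) = std_normal"
proof -
  have "distr std_normal_coordinates std_normal (\<lambda>z :: 'i \<Rightarrow> real. z e) = std_normal"
    by (rule distr_PiM_component) (auto intro: prob_space_std_normal)
  then show ?thesis
    by (subst (asm) distr_cong[of _ _ std_normal borel "\<lambda>z. z e" "\<lambda>z. z e"]) auto
qed

lemma indep_vars_std_normal_coordinates:
  "prob_space.indep_vars (std_normal_coordinates :: ('i::finite \<Rightarrow> real) measure) (\<lambda>_. borel) (\<lambda>e z. z e) UNIV"
proof -
  interpret P: prob_space "std_normal_coordinates :: ('i \<Rightarrow> real) measure"
    by (rule prob_space_std_normal_coordinates)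
  have "distr std_normal_coordinates (\<Pi>\<^sub>M i\<in>UNIV. borel) (\<lambda>z. \<lambda>i\<in>UNIV. z i) = (std_normal_coordinates :: ('i \<Rightarrow> real) measure)"
  proof -
    have "distr std_normal_coordinates (\<Pi>\<^sub>M i\<in>UNIV. borel) (\<lambda>z. \<lambda>i\<in>UNIV. z i) =
      distr std_normal_coordinates (std_normal_coordinates :: ('i \<Rightarrow> real) measure) (\<lambda>z. z)"
      by (rule distr_cong) (auto intro!: sets_PiM_cong)
    then show ?thesis by simp
  qed
  then show ?thesis
    by (subst P.indep_vars_iff_distr_eq_PiM') (simp_all add: distr_std_normal_coordinate)
qed

lemma std_normal_coordinate_moments:
  fixes e :: "'i::finite"
  shows "has_moments std_normal_coordinates (\<lambda>z. z e)"
    and "(LINT z|std_normal_coordinates. z e) = 0"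
    and "(LINT z|std_normal_coordinates. (z e)\<^sup>2) = 1"
    and "(LINT z|std_normal_coordinates. z e ^ 4) = 3"
proof -
  have tr: "(LINT z|std_normal_coordinates. h (z e)) = (LINT x|lborel. std_normal_density x * h x)"
    if [measurable]: "h \<in> borel_measurable borel" for h :: "real \<Rightarrow> real"
  proof -
    have "(LINT z|std_normal_coordinates. h (z e)) = (LINT x|std_normal. h x)"
      by (subst distr_std_normal_coordinate[of e, symmetric], subst integral_distr) auto
    then show ?thesis by (subst (asm) integral_density) auto
  qed
  have "integrable std_normal (\<lambda>x. \<bar>x\<bar> ^ k)" for k
    by (subst integrable_density) (auto intro: integrable_std_normal_moment_abs)
  then have "has_moments std_normal (\<lambda>x. x)" by (simp add: has_moments_def)
  then have "has_moments (distr std_normal_coordinates borel (\<lambda>z. z e)) (\<lambda>x. x)"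
    by (simp only: distr_std_normal_coordinate)
  then show "has_moments std_normal_coordinates (\<lambda>z. z e)"
    by (subst (asm) has_moments_distr) (rule std_normal_coordinate_measurable, simp_all)
  show "(LINT z|std_normal_coordinates. z e) = 0"
    using tr[of "\<lambda>x. x"] integral_std_normal_moment_odd[of 0] by simp
  show "(LINT z|std_normal_coordinates. (z e)\<^sup>2) = 1"
    using tr[of "\<lambda>x. x\<^sup>2"] integral_std_normal_moment_even[of 1] by simp
  show "(LINT z|std_normal_coordinates. z e ^ 4) = 3"
    using tr[of "\<lambda>x. x ^ 4"] integral_std_normal_moment_even[of 2] by (simp add: fact_numeral)
qed

text \<open>The matrix is a finite sum of measurable scalar coordinates times fixed matrix
  units.\<close>

lemma matrix_of_coordinates_measurable[measurable]:
  "(\<lambda>z. \<chi> i j. z (i, j)) \<in> measurable (std_normal_coordinates :: ('p::finite \<times> 'q::finite \<Rightarrow> real) measure)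
    (borel :: (real^'q^'p) measure)"
proof -
  have "(\<chi> i j. z (i, j)) = (\<Sum>i\<in>UNIV. \<Sum>j\<in>UNIV. z (i, j) *\<^sub>R (axis i (axis j 1) :: real^'q^'p))" for z
  proof -
    have "(\<Sum>i\<in>UNIV. \<Sum>j\<in>UNIV. z (i, j) *\<^sub>R (axis i (axis j 1) :: real^'q^'p)) $ k $ l = z (k, l)" for k l
    proof -
      have "(\<Sum>i\<in>UNIV. \<Sum>j\<in>UNIV. z (i, j) *\<^sub>R (axis i (axis j 1) :: real^'q^'p)) $ k $ l =
        (\<Sum>i\<in>UNIV. \<Sum>j\<in>UNIV. if i = k then (if j = l then z (i, j) else 0) else 0)"
        unfolding sum_component by (intro sum.cong refl) (auto simp: axis_def)
      also have "\<dots> = (\<Sum>i\<in>UNIV. if i = k then z (i, l) else 0)"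
        by (intro sum.cong refl) simp
      finally show ?thesis by simp
    qed
    then show ?thesis by (simp add: vec_eq_iff)
  qed
  then show ?thesis by simp
qed

lemma prob_space_std_normal_matrix: "prob_space (std_normal_matrix :: (real^'q^'p) measure)"
  unfolding std_normal_matrix_def
  by (intro prob_space.prob_space_distr prob_space_std_normal_coordinates matrix_of_coordinates_measurable)

lemma sets_std_normal_matrix[simp]: "sets std_normal_matrix = sets borel"
  and space_std_normal_matrix[simp]: "space std_normal_matrix = UNIV"
  by (simp_all add: std_normal_matrix_def)

lemma entry_borel[measurable]: "(\<lambda>y :: real^'q^'p. y $ i $ j) \<in> borel_measurable borel"
  by (intro borel_measurable_continuous_onI continuous_intros)

lemma bilinear_borel[measurable]: "(\<lambda>y :: real^'q^'p. a \<bullet> ((y - m) *v b)) \<in> borel_measurable borel"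
  unfolding inner_matrix_sum by simp

lemma std_normal_matrix_entry_moments: "has_moments std_normal_matrix (\<lambda>Z. Z $ i $ j)"
  unfolding std_normal_matrix_def
  by (subst has_moments_distr) (auto simp: std_normal_coordinate_moments)

text \<open>The form is a sum of independent terms \<open>a_i b_j z_(i,j)\<close>. Each has fourth
  cumulant zero, since a standard normal coordinate has fourth moment 3 and variance 1; additivity
  leaves three times the squared variance, without identifying the law of the sum.\<close>

lemma std_normal_matrix_form_moments:
  fixes a :: "real^'p" and b :: "real^'q"
  shows "(LINT Z|std_normal_matrix. a \<bullet> (Z *v b)) = 0"
    and "(LINT Z|std_normal_matrix. (a \<bullet> (Z *v b))\<^sup>2) = (a \<bullet> a) * (b \<bullet> b)"
    and "(LINT Z|std_normal_matrix. (a \<bullet> (Z *v b)) ^ 4) = 3 * ((a \<bullet> a) * (b \<bullet> b))\<^sup>2"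
proof -
  interpret P: prob_space "std_normal_coordinates :: ('p \<times> 'q \<Rightarrow> real) measure"
    by (rule prob_space_std_normal_coordinates)
  let ?c = "\<lambda>(i, j). a $ i * b $ j"
  have form: "a \<bullet> ((\<chi> i j. z (i, j)) *v b) = (\<Sum>e\<in>UNIV. ?c e * z e)" for z
    unfolding inner_matrix_sum vec_lambda_beta sum.cartesian_product UNIV_Times_UNIV
    by (intro sum.cong refl) auto
  have c2: "(\<Sum>e\<in>UNIV. (?c e)\<^sup>2) = (a \<bullet> a) * (b \<bullet> b)"
    unfolding inner_vec_def sum_product sum.cartesian_product UNIV_Times_UNIV
    by (intro sum.cong refl) (auto simp: power2_eq_square)
  have [measurable]: "(\<lambda>Z :: real^'q^'p. a \<bullet> (Z *v b)) \<in> borel_measurable borel"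
    using bilinear_borel[of a 0 b] by simp
  have tr: "(LINT Z|std_normal_matrix. h (a \<bullet> (Z *v b))) = P.expectation (\<lambda>z. h (\<Sum>e\<in>UNIV. ?c e * z e))"
    if [measurable]: "h \<in> borel_measurable borel" for h :: "real \<Rightarrow> real"
    unfolding std_normal_matrix_def form[symmetric] by (rule integral_distr) measurable
  note mom = std_normal_coordinate_moments
  have "P.indep_vars (\<lambda>_. borel) (\<lambda>e z. ?c e * z e) UNIV"
    by (rule P.indep_vars_compose2[OF indep_vars_std_normal_coordinates]) measurable
  from indep_vars_sum_moments[OF prob_space_std_normal_coordinates finite this]
  have S: "P.expectation (\<lambda>z. \<Sum>e\<in>UNIV. ?c e * z e) = 0 \<and>
    P.expectation (\<lambda>z. (\<Sum>e\<in>UNIV. ?c e * z e)\<^sup>2) = (a \<bullet> a) * (b \<bullet> b) \<and>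
    has_bochner_integral std_normal_coordinates (\<lambda>z. (\<Sum>e\<in>UNIV. ?c e * z e) ^ 4) (3 * ((a \<bullet> a) * (b \<bullet> b))\<^sup>2)"
    by (simp add: power_mult_distrib mom has_moments_integrable_power[OF mom(1)] c2 mult.commute)
  show "(LINT Z|std_normal_matrix. a \<bullet> (Z *v b)) = 0"
    using tr[of "\<lambda>x. x"] S by simp
  show "(LINT Z|std_normal_matrix. (a \<bullet> (Z *v b))\<^sup>2) = (a \<bullet> a) * (b \<bullet> b)"
    using tr[of "\<lambda>x. x\<^sup>2"] S by simp
  show "(LINT Z|std_normal_matrix. (a \<bullet> (Z *v b)) ^ 4) = 3 * ((a \<bullet> a) * (b \<bullet> b))\<^sup>2"
    using tr[of "\<lambda>x. x ^ 4"] S by (simp add: has_bochner_integral_integral_eq)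
qed

lemma continuous_sandwich: "continuous_on UNIV (\<lambda>Z :: real^'q^'p. T + S ** Z ** S')"
  unfolding matrix_matrix_mult_def by (intro continuous_intros continuous_on_vec_lambda)

lemma sandwich_borel[measurable]: "(\<lambda>Z :: real^'q^'p. T + S ** Z ** S') \<in> borel_measurable std_normal_matrix"
  using borel_measurable_continuous_onI[OF continuous_sandwich] by (simp cong: measurable_cong_sets)

lemma sets_matrix_normal[simp]: "sets (matrix_normal T A B) = sets borel"
  by (simp add: matrix_normal_def)

lemma matrix_normal_entry_moments:
  fixes T :: "real^'q^'p"
  shows "has_moments (matrix_normal T A B) (\<lambda>y. y $ i $ j)"
proof -
  interpret N: prob_space "std_normal_matrix :: (real^'q^'p) measure"
    by (rule prob_space_std_normal_matrix)
  have "has_moments std_normal_matrix (\<lambda>Z. (T + mat_sqrt A ** Z ** mat_sqrt B) $ i $ j)"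
    unfolding vector_add_component matrix_matrix_mult_def vec_lambda_beta
    by (intro has_moments_add has_moments_mult has_moments_sum[OF N.prob_space_axioms] has_moments_const[OF N.prob_space_axioms]
        std_normal_matrix_entry_moments)
  then show ?thesis
    unfolding matrix_normal_def has_moments_distr[OF sandwich_borel entry_borel] .
qed

lemma has_moments_form:
  assumes "prob_space N" and "\<And>i j. has_moments N (\<lambda>y. f y $ i $ j)"
  shows "has_moments N (\<lambda>y. a \<bullet> ((f y - m) *v b))"
proof -
  interpret N: prob_space N by fact
  have "has_moments N (\<lambda>y. a $ i * (f y $ i $ j - m $ i $ j) * b $ j)" for i j
  proof -
    have "has_moments N (\<lambda>y. f y $ i $ j + - m $ i $ j)"
      by (rule has_moments_add[OF assms(2) has_moments_const[OF N.prob_space_axioms]])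
    then have "has_moments N (\<lambda>y. f y $ i $ j - m $ i $ j)" by simp
    then show ?thesis by (intro has_moments_mult has_moments_const[OF N.prob_space_axioms])
  qed
  then show ?thesis
    unfolding inner_matrix_sum vector_minus_component by (intro has_moments_sum[OF N.prob_space_axioms])
qed

text \<open>The third moment \<open>g\<close> of the noise need not be computed: its coefficients in the two components
  cancel in the mixture.\<close>

lemma matrix_normal_form_moments:
  fixes A :: "real^'p^'p" and B :: "real^'q^'q" and u :: "real^'p" and v :: "real^'q" and m T :: "real^'q^'p"
  assumes A: "sym_posdef A" and B: "sym_posdef B"
  defines "k \<equiv> u \<bullet> ((T - m) *v v)" and "s \<equiv> (u \<bullet> (A *v u)) * (v \<bullet> (B *v v))"
    and "g \<equiv> (LINT Z|std_normal_matrix. ((mat_sqrt A *v u) \<bullet> (Z *v (mat_sqrt B *v v))) ^ 3)"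
  shows "(LINT y|matrix_normal T A B. (u \<bullet> ((y - m) *v v))) = k"
    and "(LINT y|matrix_normal T A B. (u \<bullet> ((y - m) *v v))\<^sup>2) = k\<^sup>2 + s"
    and "(LINT y|matrix_normal T A B. (u \<bullet> ((y - m) *v v)) ^ 4) = k ^ 4 + 6 * k\<^sup>2 * s + 4 * k * g + 3 * s\<^sup>2"
proof -
  interpret N: prob_space "std_normal_matrix :: (real^'q^'p) measure"
    by (rule prob_space_std_normal_matrix)
  define G where "G Z = (mat_sqrt A *v u) \<bullet> (Z *v (mat_sqrt B *v v))" for Z
  have SA: "(mat_sqrt A *v u) \<bullet> y = u \<bullet> (mat_sqrt A *v y)" for y
    using sym_posdef_inner_sym[OF mat_sqrt(1)[OF A], of u y] by (simp add: inner_commute)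
  have SB: "(mat_sqrt B *v v) \<bullet> y = v \<bullet> (mat_sqrt B *v y)" for y
    using sym_posdef_inner_sym[OF mat_sqrt(1)[OF B], of v y] by (simp add: inner_commute)
  have form: "u \<bullet> ((T + mat_sqrt A ** Z ** mat_sqrt B - m) *v v) = k + G Z" for Z
    by (simp add: k_def G_def SA matrix_vector_mul_assoc[symmetric] matrix_vector_mult_diff_rdistrib
        matrix_vector_mult_add_rdistrib inner_diff_right inner_add_right)
  have s: "s = ((mat_sqrt A *v u) \<bullet> (mat_sqrt A *v u)) * ((mat_sqrt B *v v) \<bullet> (mat_sqrt B *v v))"
    using SB by (simp add: s_def SA matrix_vector_mul_assoc mat_sqrt(2) A B inner_commute)
  have tr: "(LINT y|matrix_normal T A B. h (u \<bullet> ((y - m) *v v))) = N.expectation (\<lambda>Z. h (k + G Z))"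
    if [measurable]: "h \<in> borel_measurable borel" for h :: "real \<Rightarrow> real"
    unfolding matrix_normal_def form[symmetric] by (rule integral_distr) measurable
  have G: "N.expectation G = 0" "N.expectation (\<lambda>Z. (G Z)\<^sup>2) = s" "N.expectation (\<lambda>Z. G Z ^ 4) = 3 * s\<^sup>2"
    "N.expectation (\<lambda>Z. G Z ^ 3) = g"
    unfolding G_def s g_def by (rule std_normal_matrix_form_moments refl)+
  have "has_moments std_normal_matrix G"
    using has_moments_form[OF prob_space_std_normal_matrix std_normal_matrix_entry_moments, of "mat_sqrt A *v u" 0 "mat_sqrt B *v v"]
    by (simp add: G_def[abs_def])
  note i = has_moments_integrable_power[OF this] has_moments_integrable[OF this]
  have N1: "N.prob UNIV = 1" using N.prob_space by simp
  show "(LINT y|matrix_normal T A B. (u \<bullet> ((y - m) *v v))) = k"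
    using tr[of "\<lambda>x. x"] by (simp add: i G N1)
  show "(LINT y|matrix_normal T A B. (u \<bullet> ((y - m) *v v))\<^sup>2) = k\<^sup>2 + s"
    using tr[of "\<lambda>x. x\<^sup>2"] by (simp add: i G N1 power2_sum)
  have "(k + y) ^ 4 = k ^ 4 + 4 * k ^ 3 * y + 6 * k\<^sup>2 * y\<^sup>2 + 4 * k * y ^ 3 + y ^ 4" for y by algebra
  then show "(LINT y|matrix_normal T A B. (u \<bullet> ((y - m) *v v)) ^ 4) = k ^ 4 + 6 * k\<^sup>2 * s + 4 * k * g + 3 * s\<^sup>2"
    using tr[of "\<lambda>x. x ^ 4"] by (simp add: i G N1)
qed

text \<open>Relative to the mixture mean the component means are \<open>- a2 \<delta>\<close> and
  \<open>a1 \<delta>\<close>, so terms linear in them cancel, and the pure shift term is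
  \<open>a1 a2^4 + a2 a1^4 = a1 a2 (1 - 3 a1 a2)\<close> times \<open>\<delta>^4\<close>.\<close>

lemma mixture_normal_form_moments:
  fixes A :: "real^'p^'p" and B :: "real^'q^'q" and u :: "real^'p" and v :: "real^'q" and T1 T2 :: "real^'q^'p"
  assumes A: "sym_posdef A" and B: "sym_posdef B" and a: "0 \<le> a1" "0 \<le> a2" "a1 + a2 = 1"
  defines "\<mu> \<equiv> mixture a1 (matrix_normal T1 A B) a2 (matrix_normal T2 A B)"
    and "m \<equiv> a1 *\<^sub>R T1 + a2 *\<^sub>R T2" and "s \<equiv> (u \<bullet> (A *v u)) * (v \<bullet> (B *v v))"
    and "\<delta> \<equiv> u \<bullet> ((T2 - T1) *v v)"
  shows "(LINT y|\<mu>. (u \<bullet> ((y - m) *v v))) = 0"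
    and "(LINT y|\<mu>. (u \<bullet> ((y - m) *v v))\<^sup>2) = s + a1 * a2 * \<delta>\<^sup>2"
    and "(LINT y|\<mu>. (u \<bullet> ((y - m) *v v)) ^ 4) =
      3 * s\<^sup>2 + 6 * (a1 * a2) * s * \<delta>\<^sup>2 + (a1 * a2) * (1 - 3 * (a1 * a2)) * \<delta> ^ 4"
proof -
  have P: "prob_space (matrix_normal T A B)" for T :: "real^'q^'p"
    unfolding matrix_normal_def
    by (intro prob_space.prob_space_distr prob_space_std_normal_matrix) measurable
  have mom: "has_moments (matrix_normal T A B) (\<lambda>y. u \<bullet> ((y - m) *v v))" for T
    by (rule has_moments_form[OF P matrix_normal_entry_moments])
  have sets: "sets (matrix_normal T2 A B) = sets (matrix_normal T1 A B)" by simp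
  have I: "(LINT y|\<mu>. h y) = a1 * (LINT y|matrix_normal T1 A B. h y) + a2 * (LINT y|matrix_normal T2 A B. h y)"
    if "integrable (matrix_normal T1 A B) h" "integrable (matrix_normal T2 A B) h" for h :: "real^'q^'p \<Rightarrow> real"
    unfolding \<mu>_def using integral_mixture[OF sets a(1,2) that] by (rule has_bochner_integral_integral_eq)
  have a2: "a2 = 1 - a1" using a by simp
  have k1: "u \<bullet> ((T1 - m) *v v) = - a2 * \<delta>"
  proof -
    have "T1 - m = (- a2) *\<^sub>R (T2 - T1)" by (simp add: m_def a2 algebra_simps)
    then show ?thesis by (simp only: \<delta>_def scaleR_matrix_vector_assoc[symmetric] inner_scaleR_right)
  qed
  have k2: "u \<bullet> ((T2 - m) *v v) = a1 * \<delta>"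
  proof -
    have "T2 - m = a1 *\<^sub>R (T2 - T1)" by (simp add: m_def a2 algebra_simps)
    then show ?thesis by (simp only: \<delta>_def scaleR_matrix_vector_assoc[symmetric] inner_scaleR_right)
  qed
  note i = has_moments_integrable_power[OF mom] has_moments_integrable[OF mom]
  note F = matrix_normal_form_moments[OF A B, where u = u and m = m and v = v, folded s_def]
  show "(LINT y|\<mu>. (u \<bullet> ((y - m) *v v))) = 0"
    unfolding I[OF i(2) i(2)] F(1) k1 k2 by simp
  show "(LINT y|\<mu>. (u \<bullet> ((y - m) *v v))\<^sup>2) = s + a1 * a2 * \<delta>\<^sup>2"
    unfolding I[OF i(1) i(1)] F(2) k1 k2 a2 by algebra
  show "(LINT y|\<mu>. (u \<bullet> ((y - m) *v v)) ^ 4) =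
      3 * s\<^sup>2 + 6 * (a1 * a2) * s * \<delta>\<^sup>2 + (a1 * a2) * (1 - 3 * (a1 * a2)) * \<delta> ^ 4"
    unfolding I[OF i(1) i(1)] F(3) k1 k2 a2 by algebra
qed

text \<open>\<open>a (1 - a) = 1/4 - (a - 1/2)^2\<close> and
  \<open>1/4 - 1/12 = 1/6\<close>.\<close>

lemma mixing_product_bounds:
  fixes a :: real
  assumes "0 < a" "a < 1" "\<bar>a - 1 / 2\<bar> > 1 / sqrt 12"
  shows "0 < a * (1 - a)" "a * (1 - a) < 1 / 6"
proof -
  have "(1 / sqrt 12)\<^sup>2 < \<bar>a - 1 / 2\<bar>\<^sup>2"
    using assms(3) by (intro power_strict_mono) auto
  then have "1 / 12 < (a - 1 / 2)\<^sup>2" by (simp add: power_divide)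
  then show "a * (1 - a) < 1 / 6" by (simp add: power2_eq_square algebra_simps)
qed (use assms in simp)

theorem theorem5:
  fixes M :: "'a measure"
    and X :: "nat \<Rightarrow> 'a \<Rightarrow> real^'q^'p"
    and \<alpha>1 \<alpha>2 :: real
    and A :: "real^'p^'p" and B :: "real^'q^'q"
    and T1 T2 R :: "real^'q^'p"
    and d :: nat
    and \<sigma> :: "nat \<Rightarrow> real"
    and u0 :: "nat \<Rightarrow> real^'p" and v0 :: "nat \<Rightarrow> real^'q"
    and u :: "nat \<Rightarrow> nat \<Rightarrow> 'a \<Rightarrow> real^'p" and v :: "nat \<Rightarrow> nat \<Rightarrow> 'a \<Rightarrow> real^'q"
  assumes alpha1: "0 < \<alpha>1" "\<alpha>1 < 1" "\<bar>\<alpha>1 - 1 / 2\<bar> > 1 / sqrt 12"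
    and alpha2: "\<alpha>2 = 1 - \<alpha>1"
    and A: "sym_posdef A" and B: "sym_posdef B"
    and T: "T1 \<noteq> T2"
    and M: "prob_space M"
    and indep: "prob_space.indep_vars M (\<lambda>_. borel) X {1..}"
    and distr: "\<And>i. i \<ge> 1 \<Longrightarrow>
      distr M borel (X i) = mixture \<alpha>1 (matrix_normal T1 A B) \<alpha>2 (matrix_normal T2 A B)"
    and R: "R = mat_inv_sqrt A ** (T2 - T1) ** mat_inv_sqrt B"
    and d: "d = rank R"
    and distinct: "card (nonzero_singular_values R) = d"
    and pairs: "\<And>j. j \<in> {1..d} \<Longrightarrow> \<sigma> j > 0 \<and> singular_pair R (\<sigma> j) (u0 j) (v0 j)"
    and decreasing: "\<And>i j. i \<in> {1..d} \<Longrightarrow> j \<in> {1..d} \<Longrightarrow> i < j \<Longrightarrow> \<sigma> j < \<sigma> i"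
    and maximizers:
      "(AE \<omega> in M. \<forall>n > CARD('p) * CARD('q).
          kappa_maximizers d n (\<lambda>i. X i \<omega>) (\<lambda>j. u n j \<omega>) (\<lambda>j. v n j \<omega>)) \<or>
       (AE \<omega> in M. \<forall>n > CARD('p) * CARD('q).
          psi_maximizers d n (\<lambda>i. X i \<omega>) (\<lambda>j. u n j \<omega>) (\<lambda>j. v n j \<omega>))"
  shows "\<exists>su sv :: nat \<Rightarrow> nat \<Rightarrow> 'a \<Rightarrow> real.
    (\<forall>n j \<omega>. su n j \<omega> \<in> {-1, 1} \<and> sv n j \<omega> \<in> {-1, 1}) \<and>
    (AE \<omega> in M. \<forall>j\<in>{1..d}.
      (\<lambda>n. su n j \<omega> *\<^sub>R u n j \<omega>)
        \<longlonglongrightarrow> (mat_inv_sqrt A *v u0 j) /\<^sub>R norm (mat_inv_sqrt A *v u0 j) \<and>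
      (\<lambda>n. sv n j \<omega> *\<^sub>R v n j \<omega>)
        \<longlonglongrightarrow> (mat_inv_sqrt B *v v0 j) /\<^sub>R norm (mat_inv_sqrt B *v v0 j))"
proof -
  interpret prob_space M by (rule M)
  let ?c = "\<alpha>1 * \<alpha>2" and ?m = "\<alpha>1 *\<^sub>R T1 + \<alpha>2 *\<^sub>R T2"
  let ?\<mu> = "mixture \<alpha>1 (matrix_normal T1 A B) \<alpha>2 (matrix_normal T2 A B)"
  have a: "0 \<le> \<alpha>1" "0 \<le> \<alpha>2" "\<alpha>1 + \<alpha>2 = 1" using alpha1 alpha2 by auto
  note mix = mixture_normal_form_moments[OF A B a]
  have X[measurable]: "X i \<in> borel_measurable M" if "i \<ge> 1" for i
    using indep that unfolding indep_vars_def by auto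
  note X1 = X[OF order_refl]
  have tr: "expectation (\<lambda>\<omega>. h (X 1 \<omega>)) = (LINT y|?\<mu>. h y)"
    if "h \<in> borel_measurable borel" for h :: "real^'q^'p \<Rightarrow> real"
    using integral_distr[OF X1 that] distr[of 1] by simp
  have "has_moments ?\<mu> (\<lambda>y. y $ i $ j)" for i j
    using a by (intro has_moments_mixture matrix_normal_entry_moments) auto
  then have Xmom: "has_moments M (\<lambda>\<omega>. X 1 \<omega> $ i $ j)" for i j
    using has_moments_distr[OF X1 entry_borel] distr[of 1] by simp
  have entry_mom: "has_moments M (\<lambda>\<omega>. entry (X 1 \<omega>) e)" for e
  proof (cases e)
    case (Some p)
    then show ?thesis using Xmom by (cases p) simp
  qed (simp add: has_moments_const[OF M])
  let ?f = "\<lambda>e1 e2 e3 e4 (y :: real^'q^'p). entry y e1 * entry y e2 * entry y e3 * entry y e4"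
  have entry_meas: "(\<lambda>y :: real^'q^'p. entry y e) \<in> borel_measurable borel" for e
    by (cases e) (auto simp: entry_def split: prod.splits)
  have f_meas: "?f e1 e2 e3 e4 \<in> borel_measurable borel" for e1 e2 e3 e4
    by (intro borel_measurable_times entry_meas)
  have f_mom: "has_moments M (\<lambda>\<omega>. ?f e1 e2 e3 e4 (X 1 \<omega>))" for e1 e2 e3 e4
    by (intro has_moments_mult entry_mom)
  have "AE \<omega> in M. (\<lambda>n. (1 / real n) * (\<Sum>i=1..n. ?f e1 e2 e3 e4 (X i \<omega>)))
      \<longlonglongrightarrow> expectation (\<lambda>\<omega>. ?f e1 e2 e3 e4 (X 1 \<omega>))" for e1 e2 e3 e4
    by (rule fourth_moment_strong_law[OF M indep f_meas distr])
      (assumption, rule has_moments_integrable_power[OF f_mom])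
  \<comment> \<open>There are finitely many quadruples of indices, so one null set serves them all;
    on its complement the sample can be fixed.\<close>
  then have "AE \<omega> in M. \<forall>e1 e2 e3 e4. (\<lambda>n. (1 / real n) * (\<Sum>i=1..n. ?f e1 e2 e3 e4 (X i \<omega>)))
      \<longlonglongrightarrow> expectation (\<lambda>\<omega>. ?f e1 e2 e3 e4 (X 1 \<omega>))"
    by (simp add: AE_all_countable)
  then have svd: "AE \<omega> in M. shift_svd M (X 1) (\<lambda>i. X i \<omega>) A B (T2 - T1) ?c ?m R d \<sigma> u0 v0"
  proof (rule AE_mp, intro AE_I2 impI)
    fix \<omega> assume lln: "\<forall>e1 e2 e3 e4. (\<lambda>n. (1 / real n) * (\<Sum>i=1..n. ?f e1 e2 e3 e4 (X i \<omega>)))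
      \<longlonglongrightarrow> expectation (\<lambda>\<omega>. ?f e1 e2 e3 e4 (X 1 \<omega>))"
    show "shift_svd M (X 1) (\<lambda>i. X i \<omega>) A B (T2 - T1) ?c ?m R d \<sigma> u0 v0"
    proof (intro shift_svd.intro moment_sample.intro prob_space_axioms moment_sample_axioms.intro shift_svd_axioms.intro)
      show "integrable M (\<lambda>\<omega>. ?f e1 e2 e3 e4 (X 1 \<omega>))" for e1 e2 e3 e4
        by (rule has_moments_integrable[OF f_mom])
      show "0 < ?c" "?c < 1 / 6" unfolding alpha2 using mixing_product_bounds[OF alpha1] by auto
      show "expectation (\<lambda>\<omega>. X 1 \<omega> $ i $ j) = ?m $ i $ j" for i j
      proof -
        have "expectation (\<lambda>\<omega>. axis i 1 \<bullet> ((X 1 \<omega> - ?m) *v axis j 1)) = 0"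
          unfolding tr[OF bilinear_borel] by (rule mix(1))
        then have "expectation (\<lambda>\<omega>. X 1 \<omega> $ i $ j - ?m $ i $ j) = 0"
          unfolding inner_axis_matrix vector_minus_component .
        then show ?thesis
          unfolding Bochner_Integration.integral_diff[OF has_moments_integrable[OF Xmom] integrable_const]
          by (simp add: prob_space)
      qed
      show "expectation (\<lambda>\<omega>. (u \<bullet> ((X 1 \<omega> - ?m) *v v))\<^sup>2) =
          (u \<bullet> (A *v u)) * (v \<bullet> (B *v v)) + ?c * (u \<bullet> ((T2 - T1) *v v))\<^sup>2" for u v
        using tr[of "\<lambda>y. (u \<bullet> ((y - ?m) *v v))\<^sup>2"] mix(2)[where u=u and v=v] by simp
      show "expectation (\<lambda>\<omega>. (u \<bullet> ((X 1 \<omega> - ?m) *v v)) ^ 4) =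
          3 * ((u \<bullet> (A *v u)) * (v \<bullet> (B *v v)))\<^sup>2
          + 6 * ?c * ((u \<bullet> (A *v u)) * (v \<bullet> (B *v v))) * (u \<bullet> ((T2 - T1) *v v))\<^sup>2
          + ?c * (1 - 3 * ?c) * (u \<bullet> ((T2 - T1) *v v)) ^ 4" for u v
        using tr[of "\<lambda>y. (u \<bullet> ((y - ?m) *v v)) ^ 4"] mix(3)[where u=u and v=v] by simp
    qed (use lln A B R d pairs decreasing in auto)
  qed
  let ?us = "\<lambda>j. (mat_inv_sqrt A *v u0 j) /\<^sub>R norm (mat_inv_sqrt A *v u0 j)"
  let ?vs = "\<lambda>j. (mat_inv_sqrt B *v v0 j) /\<^sub>R norm (mat_inv_sqrt B *v v0 j)"
  \<comment> \<open>The signs are given by a formula at every sample point, so they lie in {-1, 1}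
    also off the almost sure event.\<close>
  let ?su = "\<lambda>n j \<omega>. align (?us j) (u n j \<omega>)" and ?sv = "\<lambda>n j \<omega>. align (?vs j) (v n j \<omega>)"
  have "AE \<omega> in M. \<forall>j\<in>{1..d}. (\<lambda>n. ?su n j \<omega> *\<^sub>R u n j \<omega>) \<longlonglongrightarrow> ?us j \<and> (\<lambda>n. ?sv n j \<omega> *\<^sub>R v n j \<omega>) \<longlonglongrightarrow> ?vs j"
    using maximizers
  proof
    assume "AE \<omega> in M. \<forall>n > CARD('p) * CARD('q).
          kappa_maximizers d n (\<lambda>i. X i \<omega>) (\<lambda>j. u n j \<omega>) (\<lambda>j. v n j \<omega>)"
    with svd show ?thesis
    proof eventually_elim
      case (elim \<omega>)
      then show ?case
        using shift_svd.kappa_maximizers_aligned[OF elim(1), of "CARD('p) * CARD('q)" "\<lambda>n j. u n j \<omega>" "\<lambda>n j. v n j \<omega>"]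
        unfolding aligned_def aligned_pair_def whitened_direction_def
        by blast
    qed
  next
    assume "AE \<omega> in M. \<forall>n > CARD('p) * CARD('q).
          psi_maximizers d n (\<lambda>i. X i \<omega>) (\<lambda>j. u n j \<omega>) (\<lambda>j. v n j \<omega>)"
    with svd show ?thesis
    proof eventually_elim
      case (elim \<omega>)
      then show ?case
        using shift_svd.psi_maximizers_aligned[OF elim(1), of "CARD('p) * CARD('q)" "\<lambda>n j. u n j \<omega>" "\<lambda>n j. v n j \<omega>"]
        unfolding aligned_def aligned_pair_def whitened_direction_def
        by blast
    qed
  qed
  note lim = this
  show ?thesis
    by (rule exI[of _ ?su], rule exI[of _ ?sv], intro conjI allI align_cases lim)
qed

end
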